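(* Let $d \geq 2$ be an integer. There exists a dense set of values $s \in (0,d-1)$, and for each of these values $s$ a compact set $E \subset \mathbb{R}^{d-1}$ with $0 < \mathcal{H}^{s}(E) < \infty$, with the following property. If $\nu$ is any Radon measure supported on $E$, then the conformal dimension of $\mathcal{L}\times\nu$ is zero. In fact, for any $\epsilon > 0$ there exists a quasisymmetric embedding $F \colon [0,1]\times E \to \mathbb{R}^{d}$ such that $\dim_{\mathrm{H}} F_{\sharp}(\mathcal{L}\times\nu) < \epsilon$ simultaneously for all Radon measures $\nu$ supported on $E$.
   Context: $\mathcal{L}$ denotes the restriction of one-dimensional Lebesgue measure to $[0,1]$. $\mathcal{H}^{s}$ denotes $s$-dimensional Hausdorff measure and $\dim_{\mathrm{H}}$ of a set denotes Hausdorff dimension; subsets of Euclidean spaces carry the Euclidean metric. A map $f \colon (X,d) \to (Y,d')$ between metric spaces is quasisymmetric if there is a homeomorphism $\eta \colon [0,\infty) \to [0,\infty)$ such that $$\frac{d'(f(x),f(a))}{d'(f(x),f(b))} \leq \eta\left(\frac{d(x,a)}{d(x,b)}\right)$$ for all $x,a,b \in X$ with $x \neq b$. A quasisymmetric embedding is a quasisymmetric map which is a homeomorphism onto its image. For a Borel measure $\mu$, $\dim_{\mathrm{H}} \mu := \inf\{\dim_{\mathrm{H}} A : \mu(A^{c}) = 0\}$, and $f_{\sharp}\mu$ is the push-forward, $(f_{\sharp}\mu)(A) = \mu(f^{-1}(A))$ for Borel sets $A$. The conformal dimension of a locally finite Borel measure $\mu$ on a metric space $(X,d)$ is $\inf_{f}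 \dim_{\mathrm{H}} f_{\sharp}\mu$, where the infimum ranges over all quasisymmetric homeomorphisms $f$ between $(\operatorname{spt}\mu, d)$ and any metric space $(Y,d')$. *)

theory Defs
  imports "HOL-Analysis.Analysis"
begin

section \<open>Hausdorff measure and dimension\<close>

text \<open>Conformal dimension ranges over arbitrary metric spaces, so everything is phrased for a
  carrier \<open>Y\<close> with a metric \<open>d\<close>, as in the locale \<^locale>\<open>Metric_space\<close>.  For the metric of a
  type take \<open>UNIV\<close> and \<^const>\<open>dist\<close>.\<close>

definition set_diam :: "('a \<Rightarrow> 'a \<Rightarrow> real) \<Rightarrow> 'a set \<Rightarrow> real" where
  "set_diam d U = Sup {d x y | x y. x \<in> U \<and> y \<in> U}"

text \<open>The summand \<open>(diam U)\<^sup>s\<close>, with the usual conventions that the empty set contributes \<open>0\<close> and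
  that \<open>0\<^sup>0 = 1\<close> for nonempty sets (whereas \<open>0 powr 0 = 0\<close> in HOL).\<close>

definition diam_pow :: "('a \<Rightarrow> 'a \<Rightarrow> real) \<Rightarrow> real \<Rightarrow> 'a set \<Rightarrow> ennreal" where
  "diam_pow d s U =
     (if U = {} then 0 else if s = 0 then 1 else ennreal (set_diam d U powr s))"

definition hausdorff_pre :: "'a set \<Rightarrow> ('a \<Rightarrow> 'a \<Rightarrow> real) \<Rightarrow> real \<Rightarrow> real \<Rightarrow> 'a set \<Rightarrow> ennreal" where
  "hausdorff_pre Y d \<delta> s A =
     Inf {(\<Sum>i. diam_pow d s (U i)) | U :: nat \<Rightarrow> 'a set.
            (\<forall>i. U i \<subseteq> Y \<and> (\<forall>x\<in>U i. \<forall>y\<in>U i. d x y \<le> \<delta>)) \<and> A \<subseteq> (\<Union>i. U i)}"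

definition hausdorff_measure :: "'a set \<Rightarrow> ('a \<Rightarrow> 'a \<Rightarrow> real) \<Rightarrow> real \<Rightarrow> 'a set \<Rightarrow> ennreal" where
  "hausdorff_measure Y d s A = (SUP \<delta>\<in>{0<..}. hausdorff_pre Y d \<delta> s A)"

definition hausdorff_dim :: "'a set \<Rightarrow> ('a \<Rightarrow> 'a \<Rightarrow> real) \<Rightarrow> 'a set \<Rightarrow> ennreal" where
  "hausdorff_dim Y d A = Inf {ennreal s | s. 0 \<le> s \<and> hausdorff_measure Y d s A = 0}"

definition measure_hdim :: "'a set \<Rightarrow> ('a \<Rightarrow> 'a \<Rightarrow> real) \<Rightarrow> 'a measure \<Rightarrow> ennreal" where
  "measure_hdim Y d \<mu> =
     Inf {hausdorff_dim Y d A | A. A \<in> sets \<mu> \<and> emeasure \<mu> (space \<mu> - A) = 0}"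

section \<open>Quasisymmetric maps\<close>

text \<open>The condition that \<open>d' (f x) (f b)\<close> is positive says that the quotient on the left is
  defined; without it, division by zero in HOL would admit maps that are not injective.\<close>

definition quasisymmetric ::
  "'a set \<Rightarrow> ('a \<Rightarrow> 'a \<Rightarrow> real) \<Rightarrow> 'b set \<Rightarrow> ('b \<Rightarrow> 'b \<Rightarrow> real) \<Rightarrow> ('a \<Rightarrow> 'b) \<Rightarrow> bool" where
  "quasisymmetric X d Y d' f \<longleftrightarrow>
     f \<in> X \<rightarrow> Y \<and>
     (\<exists>\<eta> \<theta> :: real \<Rightarrow> real. homeomorphism {0..} {0..} \<eta> \<theta> \<and>
        (\<forall>x\<in>X. \<forall>a\<in>X. \<forall>b\<in>X. x \<noteq> b \<longrightarrow>
           0 < d' (f x) (f b) \<and>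
           d' (f x) (f a) / d' (f x) (f b) \<le> \<eta> (d x a / d x b)))"

definition qs_embedding ::
  "'a set \<Rightarrow> ('a \<Rightarrow> 'a \<Rightarrow> real) \<Rightarrow> 'b set \<Rightarrow> ('b \<Rightarrow> 'b \<Rightarrow> real) \<Rightarrow> ('a \<Rightarrow> 'b) \<Rightarrow> bool" where
  "qs_embedding X d Y d' f \<longleftrightarrow>
     quasisymmetric X d Y d' f \<and>
     embedding_map (Metric_space.mtopology X d) (Metric_space.mtopology Y d') f"

definition qs_homeomorphism ::
  "'a set \<Rightarrow> ('a \<Rightarrow> 'a \<Rightarrow> real) \<Rightarrow> 'b set \<Rightarrow> ('b \<Rightarrow> 'b \<Rightarrow> real) \<Rightarrow> ('a \<Rightarrow> 'b) \<Rightarrow> bool" where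
  "qs_homeomorphism X d Y d' f \<longleftrightarrow>
     quasisymmetric X d Y d' f \<and>
     homeomorphic_map (Metric_space.mtopology X d) (Metric_space.mtopology Y d') f"

section \<open>Measures\<close>

definition unit_lebesgue :: "real measure" where
  "unit_lebesgue = density lborel (indicator {0..1})"

definition radon_measure :: "'a::t2_space measure \<Rightarrow> bool" where
  "radon_measure \<mu> \<longleftrightarrow>
     sets \<mu> = sets borel \<and>
     (\<forall>K. compact K \<longrightarrow> emeasure \<mu> K < \<infinity>) \<and>
     (\<forall>A\<in>sets borel. emeasure \<mu> A = (INF U\<in>{U. open U \<and> A \<subseteq> U}. emeasure \<mu> U)) \<and>
     (\<forall>U. open U \<longrightarrow> emeasure \<mu> U = (SUP K\<in>{K. compact K \<and> K \<subseteq> U}. emeasure \<mu> K))"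

definition spt :: "'a::topological_space measure \<Rightarrow> 'a set" where
  "spt \<mu> = {x. \<forall>U. open U \<and> x \<in> U \<longrightarrow> 0 < emeasure \<mu> U}"

definition metric_borel :: "'a set \<Rightarrow> ('a \<Rightarrow> 'a \<Rightarrow> real) \<Rightarrow> 'a measure" where
  "metric_borel Y d = sigma Y {U. openin (Metric_space.mtopology Y d) U}"

text \<open>Push-forward of \<open>\<mu>\<close> under a map \<open>f\<close> that is only defined on \<open>X\<close>: a Borel set \<open>A \<subseteq> Y\<close> has
  measure \<open>\<mu> {x \<in> X. f x \<in> A}\<close>.\<close>

definition push_forward ::
  "'a set \<Rightarrow> 'b set \<Rightarrow> ('b \<Rightarrow> 'b \<Rightarrow> real) \<Rightarrow> ('a \<Rightarrow> 'b) \<Rightarrow> 'a measure \<Rightarrow> 'b measure" where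
  "push_forward X Y d' f \<mu> = distr (restrict_space \<mu> X) (metric_borel Y d') f"

section \<open>Conformal dimension\<close>

text \<open>A definition in HOL cannot quantify over the type carrying the target space.  The targets
  here are all metric spaces \<open>(Y, d')\<close> whose points lie in the type of the source.  This loses
  nothing: a target is in bijection with the support, so up to isometry it is the support with
  another metric.  The lemma \<open>conformal_dim_le\<close> below confirms that targets in arbitrary types
  do not lower the infimum.\<close>

definition conformal_dim :: "'a::metric_space measure \<Rightarrow> ennreal" where
  "conformal_dim \<mu> =
     Inf {measure_hdim Y d' (push_forward (spt \<mu>) Y d' f \<mu>) | (Y :: 'a set) d' f.
            Metric_space Y d' \<and> qs_homeomorphism (spt \<mu>) dist Y d' f}"

subsection \<open>Independence of the target type\<close>

lemma metric_borel_UNIV: "metric_borel UNIV dist = (borel :: 'a::metric_space measure)"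
  by (simp add: metric_borel_def borel_def)

lemma sets_metric_borel:
  assumes "Metric_space Y d"
  shows "sets (metric_borel Y d) = sigma_sets Y {U. openin (Metric_space.mtopology Y d) U}"
    and "space (metric_borel Y d) = Y"
proof -
  interpret Metric_space Y d by fact
  have "{U. openin mtopology U} \<subseteq> Pow Y"
    using openin_subset by fastforce
  then show "sets (metric_borel Y d) = sigma_sets Y {U. openin mtopology U}"
    and "space (metric_borel Y d) = Y"
    by (auto simp: metric_borel_def)
qed

lemma closed_spt: "closed (spt \<mu>)"
proof -
  have "- spt \<mu> = \<Union>{U. open U \<and> emeasure \<mu> U = 0}"
    by (auto simp: spt_def)
  moreover have "open (\<Union>{U. open U \<and> emeasure \<mu> U = 0})" by auto
  ultimately show ?thesis by (simp add: closed_def)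
qed

lemma hausdorff_measure_pullback:
  assumes f: "bij_betw f X Y" and A: "A \<subseteq> Y"
  shows "hausdorff_measure X (\<lambda>x y. d (f x) (f y)) s (f -` A \<inter> X) \<le> hausdorff_measure Y d s A"
  unfolding hausdorff_measure_def
proof (rule SUP_mono)
  fix \<delta> :: real assume \<delta>: "\<delta> \<in> {0<..}"
  let ?d = "\<lambda>x y. d (f x) (f y)"
  have "hausdorff_pre X ?d \<delta> s (f -` A \<inter> X) \<le> hausdorff_pre Y d \<delta> s A"
    unfolding hausdorff_pre_def
  proof (rule Inf_greatest, clarify)
    fix U :: "nat \<Rightarrow> _"
    assume U: "\<forall>i. U i \<subseteq> Y \<and> (\<forall>x\<in>U i. \<forall>y\<in>U i. d x y \<le> \<delta>)" and AU: "A \<subseteq> (\<Union>i. U i)"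
    define V where "V i = f -` U i \<inter> X" for i
    have im: "f ` V i = U i" for i
      using U f unfolding V_def bij_betw_def by blast
    have "set_diam ?d (V i) = set_diam d (U i)" for i
    proof -
      have "{?d x y | x y. x \<in> V i \<and> y \<in> V i} = {d x y | x y. x \<in> U i \<and> y \<in> U i}"
        unfolding im[symmetric] by blast
      then show ?thesis by (simp add: set_diam_def)
    qed
    moreover have "V i = {} \<longleftrightarrow> U i = {}" for i using im[of i] by blast
    ultimately have eq: "diam_pow ?d s (V i) = diam_pow d s (U i)" for i
      by (simp add: diam_pow_def)
    have "(\<Sum>i. diam_pow d s (U i)) = (\<Sum>i. diam_pow ?d s (V i))" by (simp add: eq)
    moreover have "\<forall>i. V i \<subseteq> X \<and> (\<forall>x\<in>V i. \<forall>y\<in>V i. ?d x y \<le> \<delta>)"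
      using U by (auto simp: V_def)
    moreover have "f -` A \<inter> X \<subseteq> (\<Union>i. V i)" using AU unfolding V_def by blast
    ultimately show "Inf {(\<Sum>i. diam_pow ?d s (U i)) | U :: nat \<Rightarrow> _.
            (\<forall>i. U i \<subseteq> X \<and> (\<forall>x\<in>U i. \<forall>y\<in>U i. ?d x y \<le> \<delta>)) \<and> f -` A \<inter> X \<subseteq> (\<Union>i. U i)}
        \<le> (\<Sum>i. diam_pow d s (U i))"
      by (intro Inf_lower) blast
  qed
  then show "\<exists>m\<in>{0<..}. hausdorff_pre X ?d \<delta> s (f -` A \<inter> X) \<le> hausdorff_pre Y d m s A"
    using \<delta> by blast
qed

lemma hausdorff_dim_pullback:
  assumes "bij_betw f X Y" "A \<subseteq> Y"
  shows "hausdorff_dim X (\<lambda>x y. d (f x) (f y)) (f -` A \<inter> X) \<le> hausdorff_dim Y d A"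
  unfolding hausdorff_dim_def
proof (rule Inf_superset_mono, clarify)
  fix s :: real assume "0 \<le> s" "hausdorff_measure Y d s A = 0"
  then show "\<exists>sa. ennreal s = ennreal sa \<and> 0 \<le> sa \<and>
      hausdorff_measure X (\<lambda>x y. d (f x) (f y)) sa (f -` A \<inter> X) = 0"
    using hausdorff_measure_pullback[OF assms, of d s] by auto
qed

lemma conformal_dim_le:
  fixes \<mu> :: "'a::metric_space measure" and Y :: "'b set"
  assumes \<mu>: "sets \<mu> = sets borel" and Y: "Metric_space Y d'"
    and f: "qs_homeomorphism (spt \<mu>) dist Y d' f"
  shows "conformal_dim \<mu> \<le> measure_hdim Y d' (push_forward (spt \<mu>) Y d' f \<mu>)"
proof -
  define X where "X = spt \<mu>"
  define e where "e = (\<lambda>x y. d' (f x) (f y))"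
  interpret Y: Metric_space Y d' by fact
  interpret X: Metric_space X dist by (rule Met_TC.subspace) simp
  have hf: "homeomorphic_map X.mtopology Y.mtopology f" and qf: "quasisymmetric X dist Y d' f"
    using f by (auto simp: qs_homeomorphism_def X_def)
  have bij: "bij_betw f X Y"
    using hf by (metis X.topspace_mtopology Y.topspace_mtopology bij_betw_def
        homeomorphic_imp_injective_map homeomorphic_imp_surjective_map)
  have fX: "f x \<in> Y" if "x \<in> X" for x using bij that by (auto simp: bij_betw_def)
  interpret E: Metric_space X e
    using bij by unfold_locales (auto simp: e_def Y.commute fX bij_betw_def inj_on_def Y.triangle)
  have ball: "f ` E.mball x r = Y.mball (f x) r" if "x \<in> X" for x r
    using bij that unfolding E.mball_def Y.mball_def by (auto simp: e_def bij_betw_def)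
  have "openin E.mtopology U \<longleftrightarrow> openin X.mtopology U" for U
  proof (cases "U \<subseteq> X")
    case True
    have "openin X.mtopology U \<longleftrightarrow> openin Y.mtopology (f ` U)"
      using homeomorphic_map_openness[OF hf] True by simp
    also have "\<dots> \<longleftrightarrow> (\<forall>x\<in>U. \<exists>r>0. Y.mball (f x) r \<subseteq> f ` U)"
      using True fX by (auto simp: Y.openin_mtopology)
    also have "\<dots> \<longleftrightarrow> (\<forall>x\<in>U. \<exists>r>0. f ` E.mball x r \<subseteq> f ` U)"
      using True by (metis ball subsetD)
    also have "\<dots> \<longleftrightarrow> (\<forall>x\<in>U. \<exists>r>0. E.mball x r \<subseteq> U)"
      using True bij
      by (intro ball_cong refl ex_cong conj_cong)
        (simp add: bij_betw_def inj_on_image_subset_iff[of f X] E.mball_subset_mspace)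
    also have "\<dots> \<longleftrightarrow> openin E.mtopology U"
      using True by (auto simp: E.openin_mtopology)
    finally show ?thesis by simp
  qed (auto simp: E.openin_mtopology X.openin_mtopology)
  then have top: "E.mtopology = X.mtopology" by (simp add: topology_eq)
  have qid: "qs_homeomorphism X dist X e id"
    unfolding qs_homeomorphism_def top
    using qf by (auto simp: quasisymmetric_def e_def)
  have Xtop: "X.mtopology = subtopology euclidean X"
    using Submetric.mtopology_submetric[of UNIV dist X]
    by (simp add: Submetric_def Submetric_axioms_def Met_TC.Metric_space_axioms)
  have clX: "closed X" by (simp add: X_def closed_spt)
  have XM: "X \<inter> space \<mu> \<in> sets \<mu>" "space \<mu> = UNIV"
    using clX \<mu> sets_eq_imp_space_eq[OF \<mu>] by auto
  have spR: "space (restrict_space \<mu> X) = X" using XM by (simp add: space_restrict_space)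
  have Xopen: "U \<in> sets (restrict_space \<mu> X)" if U: "openin X.mtopology U" for U
  proof -
    obtain T where "open T" "U = T \<inter> X"
      using U unfolding Xtop openin_subtopology by auto
    then show ?thesis using \<mu> by (auto simp: sets_restrict_space)
  qed
  have mid: "id \<in> measurable (restrict_space \<mu> X) (metric_borel X e)"
    unfolding metric_borel_def
  proof (rule measurable_measure_of)
    show "{U. openin E.mtopology U} \<subseteq> Pow X" using openin_subset by fastforce
  next
    fix U assume "U \<in> {U. openin E.mtopology U}"
    then have "openin X.mtopology U" and "U \<subseteq> X"
      using openin_subset[of X.mtopology U] by (auto simp: top)
    then show "id -` U \<inter> space (restrict_space \<mu> X) \<in> sets (restrict_space \<mu> X)"
      using Xopen[of U] by (simp add: spR Int_absorb2)
  qed (simp add: spR)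
  have contf: "continuous_map X.mtopology Y.mtopology f"
    using hf by (rule homeomorphic_imp_continuous_map)
  have pre: "openin X.mtopology (f -` U \<inter> X)" if "openin Y.mtopology U" for U
  proof -
    have "f -` U \<inter> X = {x \<in> topspace X.mtopology. f x \<in> U}" by auto
    then show ?thesis using openin_continuous_map_preimage[OF contf that] by simp
  qed
  have mf: "f \<in> measurable (restrict_space \<mu> X) (metric_borel Y d')"
    unfolding metric_borel_def
  proof (rule measurable_measure_of)
    show "{U. openin Y.mtopology U} \<subseteq> Pow Y" using openin_subset by fastforce
  qed (use fX pre Xopen in \<open>auto simp: spR\<close>)
  have mfE: "f \<in> measurable (metric_borel X e) (metric_borel Y d')"
    unfolding metric_borel_def[of Y]
  proof (rule measurable_measure_of)
    show "{U. openin Y.mtopology U} \<subseteq> Pow Y" using openin_subset by fastforce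
  qed (use fX pre in \<open>auto simp: sets_metric_borel[OF E.Metric_space_axioms] top\<close>)
  have "measure_hdim X e (push_forward X X e id \<mu>) \<le> measure_hdim Y d' (push_forward X Y d' f \<mu>)"
    unfolding measure_hdim_def
  proof (rule Inf_greatest, clarify)
    fix A assume A: "A \<in> sets (push_forward X Y d' f \<mu>)"
      and 0: "emeasure (push_forward X Y d' f \<mu>) (space (push_forward X Y d' f \<mu>) - A) = 0"
    let ?B = "f -` A \<inter> X"
    have AS: "A \<in> sets (metric_borel Y d')" using A by (simp add: push_forward_def)
    then have AY: "A \<subseteq> Y"
      using sets.sets_into_space sets_metric_borel(2)[OF Y] by blast
    have BS: "?B \<in> sets (metric_borel X e)"
      using measurable_sets[OF mfE AS] sets_metric_borel(2)[OF E.Metric_space_axioms] by simp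
    have sp: "space (metric_borel X e) = X" "space (metric_borel Y d') = Y"
      using sets_metric_borel(2) Y E.Metric_space_axioms by auto
    have "emeasure (restrict_space \<mu> X) (f -` (Y - A) \<inter> X) = 0"
      using 0 emeasure_distr[OF mf, of "Y - A"] AS sets.compl_sets[OF AS]
      by (simp add: push_forward_def sp spR)
    moreover have "f -` (Y - A) \<inter> X = X - ?B" using fX by auto
    ultimately have "emeasure (push_forward X X e id \<mu>) (space (push_forward X X e id \<mu>) - ?B) = 0"
      using emeasure_distr[OF mid, of "X - ?B"] sets.compl_sets[OF BS]
      by (simp add: push_forward_def sp spR Int_absorb2)
    then have "Inf {hausdorff_dim X e A | A. A \<in> sets (push_forward X X e id \<mu>) \<and>
        emeasure (push_forward X X e id \<mu>) (space (push_forward X X e id \<mu>) - A) = 0}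
        \<le> hausdorff_dim X e ?B"
      using BS by (intro Inf_lower) (auto simp: push_forward_def)
    also have "\<dots> \<le> hausdorff_dim Y d' A"
      unfolding e_def by (rule hausdorff_dim_pullback[OF bij AY])
    finally show "Inf {hausdorff_dim X e A | A. A \<in> sets (push_forward X X e id \<mu>) \<and>
        emeasure (push_forward X X e id \<mu>) (space (push_forward X X e id \<mu>) - A) = 0}
        \<le> hausdorff_dim Y d' A" .
  qed
  moreover have "conformal_dim \<mu> \<le> measure_hdim X e (push_forward X X e id \<mu>)"
    unfolding conformal_dim_def X_def[symmetric]
    using qid E.Metric_space_axioms by (intro Inf_lower) blast
  ultimately show ?thesis unfolding X_def by (rule order_trans[rotated])
qed

end

theory Submission
  imports Defs
begin

text \<open>\<open>E\<close> is a power of a Cantor set of base-\<open>b\<close> expansions with digits below \<open>p\<close>.  Grouping the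
  digits into long blocks turns \<open>[0,1] \<times> E\<close> into a bundle of rows, each a chain of \<open>B\<close> cells, with
  \<open>P\<close> rows in each direction, where \<open>P\<close> is much smaller than \<open>B\<close>.  In the image, a row passes from one
  end of its parent cell to the other using about \<open>P\<close> subcells of relative size about \<open>1/P\<close>.  The
  remaining subcells, which are most of them, can be exponentially small in \<open>B\<close>, with sizes along a row
  changing by factors between \<open>1/2\<close> and \<open>2\<close>.  Where the size changes, the rows of the next generation
  fan out or close up and hence leave the direction of their parent by a small angle.  These angles
  need not be summable over the generations, so every row carries a frame of its own; the frames at
  the two ends of a cell are prescribed exactly, so that consecutive cells fit together.  Adjacent
  cells and successive generations have comparable sizes, which makes the limit map
  quasisymmetric.  For almost every \<open>t\<close>, infinitely often at least half of the digits of \<open>t\<close> select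
  small cells, and the images of all such points are covered by few very small balls, whatever
  \<open>\<nu>\<close> is.\<close>

section \<open>Rotations of coordinate planes\<close>

text \<open>Since \<open>E\<close> is fixed before epsilon, only the block length \<open>K\<close>
  may depend on epsilon. Put \<open>B = b ^ K\<close> and \<open>P = p ^ K\<close>, and let N be the
  dimension of the space of \<open>E\<close>. Rows are kept apart by offsets spaced at order
  \<open>1 / P\<close>, while they stray from straight lines by a few multiples of a cell size of
  order \<open>1 / B\<close>; as \<open>p < b\<close>, a large \<open>K\<close> makes the second
  quantity negligible against the first, and most cells are free to be tiny. One generation
  multiplies the number of covering balls by at most \<open>P ^ N * B\<close>, which is polynomial
  in \<open>B\<close>, whereas half of the digits being tiny gains a factor
  \<open>2 powr (- D / 2)\<close> per generation with \<open>D\<close> about \<open>B / 100\<close>.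
  So for every exponent \<open>e > 0\<close> a large \<open>K\<close> makes the covering sums
  geometric. The constants of quasisymmetry deteriorate as \<open>K\<close> grows, but each epsilon
  uses a single \<open>K\<close>. The exceptional set is a null set of times \<open>t\<close> alone,
  which gives one map for all measures at once.\<close>

definition plane_emb :: "'v::euclidean_space \<Rightarrow> complex \<Rightarrow> real \<times> 'v" where
  "plane_emb u c = (Re c, Im c *\<^sub>R u)"

text \<open>For a unit vector \<open>u\<close> and \<open>cmod z = 1\<close> this is the rotation by
  \<open>z\<close> in the plane of \<open>e1\<close> and \<open>(0, u)\<close>, which
  \<open>plane_emb\<close> identifies with the complex numbers; the orthogonal complement stays
  fixed. Turns in one plane then compose by complex multiplication.\<close>

definition plane_rot :: "'v::euclidean_space \<Rightarrow> complex \<Rightarrow> real \<times> 'v \<Rightarrow> real \<times> 'v" where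
  "plane_rot u z p =
     p + plane_emb u ((z - 1) * Complex (fst p) (u \<bullet> snd p))"

abbreviation e1 :: "real \<times> 'v::euclidean_space" where
  "e1 \<equiv> (1, 0)"

lemma plane_emb_add: "plane_emb u (c + c') = plane_emb u c + plane_emb u c'"
  by (simp add: plane_emb_def algebra_simps)

lemma plane_emb_scaleR: "plane_emb u (r *\<^sub>R c) = r *\<^sub>R plane_emb u c"
  by (simp add: plane_emb_def)

lemma linear_plane_emb: "linear (plane_emb u)"
  by (intro linearI plane_emb_add plane_emb_scaleR)

lemma plane_emb_1: "plane_emb u 1 = e1"
  by (simp add: plane_emb_def)

lemma norm_plane_emb: "norm u = 1 \<Longrightarrow> norm (plane_emb u c) = norm c"
  by (simp add: plane_emb_def norm_Pair cmod_def)

lemma linear_plane_rot: "linear (plane_rot u z)"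
  by (rule linearI)
    (simp_all add: plane_rot_def plane_emb_def algebra_simps inner_add_right Complex_eq)

lemma plane_rot_one [simp]: "plane_rot u 1 = (\<lambda>x. x)"
  by (auto simp: plane_rot_def plane_emb_def)

lemma plane_rot_emb:
  assumes "norm u = 1"
  shows "plane_rot u z (plane_emb u c) = plane_emb u (z * c)"
proof -
  have "u \<bullet> u = 1" using assms by (simp add: norm_eq_1)
  then have "Complex (fst (plane_emb u c)) (u \<bullet> snd (plane_emb u c)) = c"
    by (simp add: plane_emb_def)
  then show ?thesis
    by (simp add: plane_rot_def plane_emb_add[symmetric] algebra_simps)
qed

lemma plane_rot_e1: "norm u = 1 \<Longrightarrow> plane_rot u z e1 = plane_emb u z"
  using plane_rot_emb[of u z 1] by (simp add: plane_emb_1)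

lemma plane_rot_rot:
  assumes "norm u = 1"
  shows "plane_rot u z (plane_rot u z' p) = plane_rot u (z * z') p"
proof -
  let ?c = "Complex (fst p) (u \<bullet> snd p)"
  have "plane_rot u z (plane_rot u z' p) = plane_rot u z p + plane_rot u z (plane_emb u ((z' - 1) * ?c))"
    unfolding plane_rot_def[of u z'] by (simp add: linear_add[OF linear_plane_rot])
  also have "\<dots> = plane_rot u (z * z') p"
    unfolding plane_rot_emb[OF assms] unfolding plane_rot_def
    by (simp add: add.assoc plane_emb_add[symmetric] algebra_simps)
  finally show ?thesis .
qed

lemma plane_rot_dist:
  assumes "norm u = 1"
  shows "norm (plane_rot u z p - p) \<le> cmod (z - 1) * norm p"
proof -
  have "(u \<bullet> snd p)\<^sup>2 \<le> (norm (snd p))\<^sup>2"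
    using Cauchy_Schwarz_ineq2[of u "snd p"] assms by (simp add: abs_le_square_iff[symmetric])
  then have "cmod (Complex (fst p) (u \<bullet> snd p)) \<le> norm p"
    by (cases p) (simp add: cmod_def norm_Pair)
  then show ?thesis
    by (simp add: plane_rot_def norm_plane_emb[OF assms] norm_mult mult_left_mono)
qed

lemma orthogonal_plane_rot:
  assumes u: "norm u = 1" and z: "cmod z = 1"
  shows "orthogonal_transformation (plane_rot u z)"
proof -
  have uu: "u \<bullet> u = 1" using u by (simp add: norm_eq_1)
  obtain x y where xy: "z = Complex x y" by (cases z)
  have "(cmod z)\<^sup>2 = 1" using z by simp
  then have 1: "x\<^sup>2 + y\<^sup>2 = 1" by (simp add: cmod_def xy)
  have "norm (plane_rot u z p) = norm p" for p
  proof (cases p)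
    case (Pair a w)
    define r where "r = u \<bullet> w"
    have wu: "w \<bullet> u = r" by (simp add: r_def inner_commute)
    have *: "plane_rot u z p = (x * a - y * r, w + (x * r + y * a - r) *\<^sub>R u)"
      by (simp add: plane_rot_def plane_emb_def xy Pair r_def algebra_simps)
    have "(x * a - y * r)\<^sup>2 + (w + (x * r + y * a - r) *\<^sub>R u) \<bullet> (w + (x * r + y * a - r) *\<^sub>R u)
      = (x * a - y * r)\<^sup>2 + w \<bullet> w + 2 * (x * r + y * a - r) * r + (x * r + y * a - r)\<^sup>2"
      by (simp add: inner_add_left inner_add_right wu r_def[symmetric] uu power2_eq_square algebra_simps)
    also have "\<dots> = (x\<^sup>2 + y\<^sup>2) * (a\<^sup>2 + r\<^sup>2) + w \<bullet> w - r\<^sup>2"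
      by (simp add: power2_eq_square algebra_simps)
    also have "\<dots> = a\<^sup>2 + w \<bullet> w" by (simp add: 1)
    finally show ?thesis
      unfolding * unfolding Pair norm_Pair by (simp add: power2_norm_eq_inner)
  qed
  then show ?thesis
    by (simp add: orthogonal_transformation linear_plane_rot)
qed

text \<open>Multiplied by \<open>cmod X\<close>, the difference splits into \<open>X - 1\<close> and
  \<open>1 - cmod X\<close>, each of norm at most \<open>cmod (X - 1)\<close>.\<close>

lemma norm_sgn_diff_le:
  fixes X :: complex
  assumes "X \<noteq> 0"
  shows "cmod (sgn X - 1) \<le> 2 * cmod (X - 1) / cmod X"
proof -
  have "cmod X *\<^sub>R (sgn X - 1) = (X - 1) + of_real (1 - cmod X)"
    using assms by (simp add: sgn_div_norm algebra_simps scaleR_conv_of_real)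
  then have "cmod X * cmod (sgn X - 1) \<le> cmod (X - 1) + \<bar>1 - cmod X\<bar>"
    by (metis norm_scaleR abs_norm_cancel norm_triangle_ineq norm_of_real)
  also have "\<bar>1 - cmod X\<bar> \<le> cmod (X - 1)"
    using norm_triangle_ineq3[of X 1] by simp
  finally show ?thesis
    using assms by (simp add: field_simps)
qed

text \<open>\<open>1 + z\<close> bisects the angle between 1 and \<open>z\<close>, so its direction
  squares to \<open>z\<close>. For the factor \<open>6 / 10\<close>, a crude bound on
  \<open>h - 1\<close> keeps \<open>1 + h\<close> large, and then \<open>z - 1\<close> is factored
  as the product of \<open>h - 1\<close> and \<open>h + 1\<close>.\<close>

lemma half_angle:
  fixes z :: complex
  assumes z: "cmod z = 1" and d: "cmod (z - 1) \<le> 1 / 10"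
  defines "h \<equiv> sgn (1 + z)"
  shows "cmod h = 1" "h * h = z" "cmod (h - 1) \<le> (6 / 10) * cmod (z - 1)"
proof -
  have 2: "1 + z = 2 + (z - 1)" by simp
  have n: "cmod (1 + z) \<ge> 19 / 10"
    unfolding 2 using norm_triangle_ineq4[of "2 + (z - 1)" "z - 1"] d by simp
  then have nz: "1 + z \<noteq> 0" by auto
  show h1: "cmod h = 1" using nz by (simp add: h_def norm_sgn)
  have cz: "z * cnj z = 1" using z by (simp add: complex_norm_square[symmetric])
  have "(cmod (1 + z))\<^sup>2 * z = (1 + z) * (1 + z)"
  proof -
    have "complex_of_real ((cmod (1 + z))\<^sup>2) = (1 + z) * (1 + cnj z)"
      by (simp only: complex_norm_square complex_cnj_add complex_cnj_one)
    then have "complex_of_real ((cmod (1 + z))\<^sup>2) * z = (1 + z) * (z + z * cnj z)"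
      by (simp add: algebra_simps)
    then show ?thesis by (simp add: cz algebra_simps)
  qed
  then have "complex_of_real (cmod (1 + z)) * complex_of_real (cmod (1 + z)) * z = (1 + z) * (1 + z)"
    by (simp add: power2_eq_square)
  then show hh: "h * h = z"
    using n nz by (simp add: h_def sgn_eq field_simps)
  have "cmod (h - 1) \<le> 2 * cmod ((1 + z) / 2 - 1) / cmod ((1 + z) / 2)"
  proof -
    have "sgn ((1 + z) / 2) = h"
      using sgn_scaleR[of "1 / 2" "1 + z"] by (simp add: h_def scaleR_conv_of_real)
    then show ?thesis using norm_sgn_diff_le[of "(1 + z) / 2"] nz by simp
  qed
  also have "\<dots> = 2 * cmod (z - 1) / cmod (1 + z)"
  proof -
    have "(1 + z) / 2 - 1 = (z - 1) / 2" by (simp add: field_simps)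
    then have "cmod ((1 + z) / 2 - 1) = cmod (z - 1) / 2" by (simp only: norm_divide) simp
    then show ?thesis by (simp add: norm_divide)
  qed
  finally have h3: "cmod (h - 1) \<le> 2 * cmod (z - 1) / cmod (1 + z)" .
  have "2 * cmod (z - 1) / cmod (1 + z) \<le> 2 * (1 / 10) / (19 / 10)"
    using d n by (intro frac_le) auto
  then have "cmod (h - 1) \<le> 2 / 19" using h3 by simp
  moreover have "1 + h = 2 + (h - 1)" by simp
  ultimately have "cmod (1 + h) \<ge> 17 / 10"
    using norm_triangle_ineq4[of "2 + (h - 1)" "h - 1"] by simp
  moreover have "cmod (z - 1) = cmod (h - 1) * cmod (1 + h)"
    unfolding norm_mult[symmetric] hh[symmetric] by (simp add: algebra_simps)
  ultimately have "cmod (z - 1) \<ge> cmod (h - 1) * (17 / 10)"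
    using mult_left_mono[of "17 / 10" "cmod (1 + h)" "cmod (h - 1)"] by simp
  then show "cmod (h - 1) \<le> (6 / 10) * cmod (z - 1)" using norm_ge_zero[of "h - 1"] by linarith
qed

section \<open>A single row of cells\<close>

text \<open>Shape of a cell of size \<open>1\<close> in its own frame: its axis runs from \<open>0\<close> to \<^term>\<open>e1\<close>, the two end
  faces have scales \<open>\<alpha>\<close> and \<open>\<omega>\<close>, and \<open>L\<close> turns the frame of the first face into that of the
  second.  A cell either rescales or turns, never both; this keeps every row of it in a translate
  of a plane.\<close>

definition cell_type :: "real \<Rightarrow> real \<Rightarrow> (real \<times> 'v::euclidean_space \<Rightarrow> real \<times> 'v) \<Rightarrow> bool" where
  "cell_type \<alpha> \<omega> L \<longleftrightarrow> 1 / 2 \<le> \<alpha> \<and> \<alpha> \<le> 1 \<and> 1 / 2 \<le> \<omega> \<and> \<omega> \<le> 1 \<and> (\<alpha> = 1 \<or> \<omega> = 1) \<and>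
     (\<exists>u z. norm u = 1 \<and> cmod z = 1 \<and> cmod (z - 1) \<le> 1 / 10 \<and> L = plane_rot u z \<and>
        (z = 1 \<or> \<alpha> = 1 \<and> \<omega> = 1))"

text \<open>The straight segment joining the points with offset \<open>v\<close> on the two end
  faces. It is the model of a row: the true row only stays close to it.\<close>

definition row_path :: "real \<Rightarrow> real \<Rightarrow> (real \<times> 'v::euclidean_space \<Rightarrow> real \<times> 'v) \<Rightarrow> 'v \<Rightarrow> real \<Rightarrow> real \<times> 'v" where
  "row_path \<alpha> \<omega> L v f = f *\<^sub>R e1 + ((1 - f) * \<alpha>) *\<^sub>R (0, v) + (f * \<omega>) *\<^sub>R L (0, v)"

text \<open>The \<open>b\<close> subcells along the row with offset \<open>v\<close>: node \<open>j\<close> has position \<open>Q j\<close>, scale \<open>\<nu> j\<close> and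
  frame \<open>T j\<close>, and subcell \<open>j\<close> lies between the nodes \<open>j\<close> and \<open>j + 1\<close>.\<close>

definition row :: "nat \<Rightarrow> nat \<Rightarrow> nat \<Rightarrow> real \<Rightarrow> real \<Rightarrow> real \<Rightarrow> (real \<times> 'v::euclidean_space \<Rightarrow> real \<times> 'v) \<Rightarrow> 'v \<Rightarrow>
   (nat \<Rightarrow> real \<times> 'v) \<Rightarrow> (nat \<Rightarrow> real) \<Rightarrow> (nat \<Rightarrow> real \<times> 'v \<Rightarrow> real \<times> 'v) \<Rightarrow>
   (nat \<Rightarrow> real \<times> 'v \<Rightarrow> real \<times> 'v) \<Rightarrow> bool" where
  "row b a D \<sigma> \<alpha> \<omega> L v Q \<nu> T L' \<longleftrightarrow>
     Q 0 = \<alpha> *\<^sub>R (0, v) \<and> Q b = e1 + \<omega> *\<^sub>R L (0, v) \<and> T 0 = (\<lambda>x. x) \<and> T b = L \<and>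
     \<nu> 0 = \<sigma> * \<alpha> \<and> \<nu> b = \<sigma> * \<omega> \<and>
     (\<forall>j\<le>b. orthogonal_transformation (T j) \<and> (\<forall>x. norm (T j x - x) \<le> norm x / 10) \<and>
        \<sigma> / 2 ^ Suc D \<le> \<nu> j \<and> \<nu> j \<le> \<sigma>) \<and>
     (\<forall>j<b. let g = max (\<nu> j) (\<nu> (Suc j)) in
        Q (Suc j) = Q j + g *\<^sub>R T j e1 \<and> T (Suc j) = T j \<circ> L' j \<and>
        cell_type (\<nu> j / g) (\<nu> (Suc j) / g) (L' j) \<and>
        (\<exists>f\<in>{0..1}. norm (Q j - row_path \<alpha> \<omega> L v f) \<le> 8 * \<sigma>) \<and>
        (a + D \<le> j \<and> j + D + 4 < b \<longrightarrow> g \<le> \<sigma> / 2 ^ D))"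

text \<open>Relative node scales: \<open>1\<close> on the first \<open>a\<close> nodes, which cover almost all of the length,
  then halving down to \<open>2\<^sup>-\<^sup>D\<close> and back up at the end.  The last four nodes are left for turns.\<close>

definition dip :: "nat \<Rightarrow> nat \<Rightarrow> nat \<Rightarrow> nat \<Rightarrow> real" where
  "dip b a D j = (1 / 2) ^ min D (min (j - a) (b - 4 - j))"

text \<open>The sum is the length of the variable middle stretch in units of the scale. This stretch
  must have length near 1, and the factor \<open>3 / 2\<close> leaves room to shrink the scale by a
  factor in [1/2, 1] for an individual row. The value depends on \<open>b\<close>, \<open>a\<close>,
  \<open>D\<close> only, so all rows of all cells share it.\<close>

definition row_scale :: "nat \<Rightarrow> nat \<Rightarrow> nat \<Rightarrow> real" where
  "row_scale b a D = 3 / (2 * (\<Sum>j\<in>{3..<b - 4}. max (dip b a D j) (dip b a D (Suc j))))"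

lemma dip_bounds: "(1 / 2) ^ D \<le> dip b a D j" "dip b a D j \<le> 1" "0 < dip b a D j"
  unfolding dip_def by (auto intro!: power_decreasing power_le_one)

lemma dip_Suc: "dip b a D j \<le> 2 * dip b a D (Suc j)" "dip b a D (Suc j) \<le> 2 * dip b a D j"
proof -
  have *: "(1 / 2 :: real) ^ m \<le> 2 * (1 / 2) ^ n" if "n \<le> Suc m" for m n
    using power_decreasing[OF that, of "1 / 2 :: real"] by simp
  show "dip b a D j \<le> 2 * dip b a D (Suc j)" "dip b a D (Suc j) \<le> 2 * dip b a D j"
    unfolding dip_def by (rule *, linarith)+
qed

text \<open>Truncated subtraction makes \<open>dip\<close> equal to 1 at all nodes up to
  \<open>a\<close>, so the sum is at least \<open>a - 3\<close>.\<close>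

lemma row_scale_le:
  assumes "3 < a" "a \<le> b - 4"
  shows "0 < row_scale b a D" "row_scale b a D \<le> 3 / (2 * (real a - 3))"
proof -
  let ?P = "\<Sum>j\<in>{3..<b - 4}. max (dip b a D j) (dip b a D (Suc j))"
  have "real a - 3 = (\<Sum>j\<in>{3..<a}. 1)" using assms by (simp add: of_nat_diff)
  also have "\<dots> \<le> (\<Sum>j\<in>{3..<a}. max (dip b a D j) (dip b a D (Suc j)))"
    by (intro sum_mono) (auto simp: dip_def)
  also have "\<dots> \<le> ?P"
    using assms dip_bounds(3)[of b a D] by (intro sum_mono2) (auto simp: less_imp_le less_max_iff_disj le_max_iff_disj)
  finally have "real a - 3 \<le> ?P" .
  moreover have "0 < real a - 3" using assms by simp
  ultimately show "0 < row_scale b a D" "row_scale b a D \<le> 3 / (2 * (real a - 3))"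
    unfolding row_scale_def by (auto intro!: frac_le)
qed

text \<open>In the plane containing the row, \<open>d\<^sub>0\<close> is the direction of nearly all of the path; the first two
  steps (direction \<open>1\<close>) and the last two (directions \<open>h\<close> and \<open>z\<close>, with \<open>h\<^sup>2 = z\<close>) match the
  prescribed end frames, and \<open>\<sigma>'\<close> is the common scale that gives the path exactly the right length.\<close>

lemma row_exists:
  fixes v :: "'v::euclidean_space" and a b D :: nat
  defines "\<sigma> \<equiv> row_scale b a D"
  assumes a: "3 < a" "a \<le> b - 4" and \<sigma>: "\<sigma> \<le> 1 / 2000" and v: "norm v \<le> 1 / 100"
    and ty: "cell_type \<alpha> \<omega> L"
  shows "\<exists>Q \<nu> T L'. row b a D \<sigma> \<alpha> \<omega> L v Q \<nu> T L'"
proof -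
  have \<sigma>0: "0 < \<sigma>" unfolding \<sigma>_def using row_scale_le(1)[OF a] .
  have al: "1 / 2 \<le> \<alpha>" "\<alpha> \<le> 1" and om: "1 / 2 \<le> \<omega>" "\<omega> \<le> 1"
    using ty by (auto simp: cell_type_def)
  obtain u0 z where u0: "norm u0 = 1" and z1: "cmod z = 1" and zd: "cmod (z - 1) \<le> 1 / 10"
    and L0: "L = plane_rot u0 z" and pure: "z = 1 \<or> \<alpha> = 1 \<and> \<omega> = 1"
    using ty unfolding cell_type_def by blast
  \<comment> \<open>The row will stay in a translate of the plane of \<open>e1\<close> and
    \<open>(0, u)\<close>. A rescaling cell moves the offset along \<open>v\<close>, which asks for
    \<open>sgn v\<close>; a turning cell brings its own \<open>u0\<close>. The two demands never
    meet because no cell does both.\<close>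
  obtain u y where u: "norm u = 1" and y: "y = u \<bullet> v" and L: "L = plane_rot u z"
    and vy: "(\<omega> - \<alpha>) *\<^sub>R v = ((\<omega> - \<alpha>) * y) *\<^sub>R u"
  proof (cases "z = 1 \<and> v \<noteq> 0")
    case True
    have "norm (sgn v) = 1" using True by (simp add: norm_sgn)
    moreover have "v = (sgn v \<bullet> v) *\<^sub>R sgn v"
    proof -
      have "sgn v \<bullet> v = norm v"
        using True by (simp add: sgn_div_norm dot_square_norm power2_eq_square)
      then show ?thesis using True by (simp add: sgn_div_norm)
    qed
    then have "(\<omega> - \<alpha>) *\<^sub>R v = ((\<omega> - \<alpha>) * (sgn v \<bullet> v)) *\<^sub>R sgn v"
      by (metis scaleR_scaleR)
    ultimately show thesis using True L0 by (intro that[of "sgn v"]) auto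
  next
    case False
    then show thesis using u0 L0 pure by (intro that[of u0]) auto
  qed
  have y_le: "\<bar>y\<bar> \<le> 1 / 100"
    using Cauchy_Schwarz_ineq2[of u v] u v by (simp add: y)
  \<comment> \<open>\<open>Z\<close> is the displacement between the prescribed end points
    \<open>Q 0\<close> and \<open>Q b\<close>, read as a complex number (see \<open>key\<close>).
    Taking away two steps in direction 1 and one each in directions \<open>h\<close> and
    \<open>z\<close>, all of length \<open>\<sigma>\<close>, leaves \<open>X\<close> to be covered
    in direction \<open>d\<^sub>0\<close>.\<close>
  define Z where "Z = 1 + (\<omega> * z - \<alpha>) * (\<i> * y)"
  define h where "h = sgn (1 + z)"
  define X where "X = Z - 2 * \<sigma> - \<sigma> * h - \<sigma> * z"
  define d\<^sub>0 where "d\<^sub>0 = sgn X"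
  define S where "S = (\<Sum>j\<in>{3..<b - 4}. max (dip b a D j) (dip b a D (Suc j)))"
  \<comment> \<open>Besides the middle stretch, the steps \<open>2\<close>, \<open>b - 4\<close> and
    \<open>b - 3\<close> run along \<open>d\<^sub>0\<close>, each of length \<open>\<sigma>\<close>;
    hence \<open>3 * \<sigma>\<close>.\<close>
  define \<sigma>' where "\<sigma>' = (cmod X - 3 * \<sigma>) / S"
  define \<nu> where "\<nu> j = (if j = 0 then \<sigma> * \<alpha> else if j = b then \<sigma> * \<omega>
     else if j < 3 \<or> b - 4 < j then \<sigma> else \<sigma>' * dip b a D j)" for j
  define d where "d j = (if j < 2 then 1 else if j \<le> b - 3 then d\<^sub>0 else if j = b - 2 then h else z)" for j
  define g where "g j = max (\<nu> j) (\<nu> (Suc j))" for j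
  define s where "s j = (\<Sum>l<j. g l *\<^sub>R d l)" for j
  note h = half_angle[OF z1 zd, folded h_def]
  have \<sigma>S: "\<sigma> * S = 3 / 2" "S > 0"
    using \<sigma>0 by (auto simp: \<sigma>_def row_scale_def S_def[symmetric] zero_less_divide_iff)
  have "cmod (\<omega> * z - \<alpha>) \<le> 1 / 2"
  proof (cases "z = 1")
    case True
    then have "cmod (\<omega> * z - \<alpha>) = \<bar>\<omega> - \<alpha>\<bar>"
      by (metis mult.right_neutral norm_of_real of_real_diff)
    then show ?thesis using al om by linarith
  next
    case False
    then show ?thesis using pure zd by simp
  qed
  then have Z1: "cmod (Z - 1) \<le> 1 / 200"
    using mult_mono[of "cmod (\<omega> * z - \<alpha>)" "1 / 2" "\<bar>y\<bar>" "1 / 100"] y_le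
    by (simp add: Z_def norm_mult)
  have "X - 1 = (Z - 1) - 2 * \<sigma> - \<sigma> * h - \<sigma> * z" by (simp add: X_def)
  also have "cmod \<dots> \<le> cmod (Z - 1) + 2 * \<sigma> + \<sigma> + \<sigma>"
  proof -
    have "cmod ((Z - 1) - 2 * \<sigma> - \<sigma> * h - \<sigma> * z)
        \<le> cmod (Z - 1) + cmod (2 * \<sigma>) + cmod (\<sigma> * h) + cmod (\<sigma> * z)"
      by (meson norm_triangle_ineq4 order_trans add_right_mono)
    then show ?thesis using \<sigma>0 h(1) z1 by (simp add: norm_mult)
  qed
  finally have X1: "cmod (X - 1) \<le> 7 / 1000" using Z1 \<sigma> by simp
  have cX: "993 / 1000 \<le> cmod X" "cmod X \<le> 1007 / 1000"
    using norm_triangle_ineq2[of X "X - 1"] norm_triangle_ineq2[of X 1] X1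
      norm_triangle_ineq[of "X - 1" 1] norm_triangle_ineq4[of X "X - 1"] by simp_all
  then have X0: "X \<noteq> 0" by auto
  have d01: "cmod d\<^sub>0 = 1" using X0 by (simp add: d\<^sub>0_def norm_sgn)
  have "cmod (d\<^sub>0 - 1) \<le> 2 * (7 / 1000) / (993 / 1000)"
    unfolding d\<^sub>0_def using norm_sgn_diff_le[OF X0] frac_le[of "2 * (7 / 1000)" "2 * cmod (X - 1)" "993 / 1000" "cmod X"] X1 cX
    by simp
  then have d0d: "cmod (d\<^sub>0 - 1) \<le> 2 / 100" by simp
  have \<sigma>'S: "\<sigma>' * S = cmod X - 3 * \<sigma>" using \<sigma>S by (simp add: \<sigma>'_def)
  \<comment> \<open>As \<open>\<sigma> * S = 3 / 2\<close>, it suffices that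
    \<open>cmod X - 3 * \<sigma>\<close> lies in [3/4, 3/2].\<close>
  have "\<sigma> / 2 * S \<le> \<sigma>' * S" "\<sigma>' * S \<le> \<sigma> * S" using \<sigma>S \<sigma>'S cX \<sigma> \<sigma>0 by simp_all
  then have \<sigma>': "\<sigma> / 2 \<le> \<sigma>'" "\<sigma>' \<le> \<sigma>" using \<sigma>S(2) by (auto simp: mult_le_cancel_right)
  have b: "8 \<le> b" using a by linarith
  define c where "c = b - 4"
  have bc: "b = Suc (Suc (Suc (Suc c)))" "4 \<le> c" using b by (auto simp: c_def)
  have dn: "cmod (d j) = 1" for j using d01 h(1) z1 by (simp add: d_def)
  have d1: "cmod (d j - 1) \<le> 1 / 10" for j using d0d h(3) zd by (simp add: d_def)
  have d_0: "d 0 = 1" and d_b: "d b = z" using b by (auto simp: d_def)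
  have \<nu>_0: "\<nu> 0 = \<sigma> * \<alpha>" and \<nu>_b: "\<nu> b = \<sigma> * \<omega>" using b by (auto simp: \<nu>_def)
  have \<nu>_up: "\<nu> j \<le> \<sigma>" for j
    using al om \<sigma>' \<sigma>0 dip_bounds(2)[of b a D j] mult_mono[of \<sigma>' \<sigma> "dip b a D j" 1]
      dip_bounds(3)[of b a D j]
    by (auto simp: \<nu>_def less_imp_le)
  have half_pow: "\<sigma> / 2 ^ Suc D \<le> \<sigma> / 2" using \<sigma>0 by (simp add: field_simps)
  have \<nu>_low: "\<sigma> / 2 ^ Suc D \<le> \<nu> j" for j
  proof -
    have "\<sigma> / 2 * (1 / 2) ^ D \<le> \<sigma>' * dip b a D j"
      using \<sigma>' \<sigma>0 dip_bounds(1)[of D b a j] by (intro mult_mono) auto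
    then have 1: "\<sigma> / 2 ^ Suc D \<le> \<sigma>' * dip b a D j" by (simp add: power_divide)
    have "\<sigma> / 2 \<le> \<sigma> * \<alpha>" "\<sigma> / 2 \<le> \<sigma> * \<omega>" "\<sigma> / 2 \<le> \<sigma>" using al om \<sigma>0 by auto
    then show ?thesis using half_pow 1 unfolding \<nu>_def by (smt (verit))
  qed
  have \<nu>0: "0 < \<nu> j" for j using \<nu>_low[of j] \<sigma>0 by (smt (verit) divide_pos_pos zero_less_power)
  have \<nu>_mid: "\<nu> j = \<sigma>' * dip b a D j" if "3 \<le> j" "j \<le> c" for j
    using that bc by (auto simp: \<nu>_def)
  have \<nu>_end: "\<nu> j = \<sigma>" if "j \<noteq> 0" "j \<noteq> b" "j < 3 \<or> c < j" for j
    using that by (auto simp: \<nu>_def c_def)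
  have dip1: "dip b a D 3 = 1" "dip b a D c = 1" using a by (auto simp: dip_def c_def)
  have ratio: "\<nu> j \<le> 2 * \<nu> (Suc j) \<and> \<nu> (Suc j) \<le> 2 * \<nu> j" if j: "j < b" for j
  proof (cases "3 \<le> j \<and> j < c")
    case True
    then have "\<nu> j = \<sigma>' * dip b a D j" "\<nu> (Suc j) = \<sigma>' * dip b a D (Suc j)"
      using \<nu>_mid by auto
    moreover have "\<sigma>' > 0" using \<sigma>' \<sigma>0 by linarith
    ultimately show ?thesis
      using dip_Suc[of b a D j] by (simp add: mult.left_commute)
  next
    case False
    have *: "\<sigma> / 2 \<le> \<nu> i" if "i < 4 \<or> c \<le> i" for i
    proof -
      have "i = 0 \<or> i = b \<or> (i \<noteq> 0 \<and> i \<noteq> b \<and> (i < 3 \<or> c < i)) \<or> i = 3 \<or> i = c"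
        using that by linarith
      then consider "i = 0" | "i = b" | "i \<noteq> 0" "i \<noteq> b" "i < 3 \<or> c < i" | "i = 3" | "i = c"
        by blast
      then show ?thesis
        using al om \<sigma>0 \<sigma>' \<nu>_0 \<nu>_b \<nu>_end[of i] \<nu>_mid[of 3] \<nu>_mid[of c] dip1 bc(2)
        by cases (auto simp: mult_left_mono)
    qed
    show ?thesis using *[of j] *[of "Suc j"] \<nu>_up[of j] \<nu>_up[of "Suc j"] False by auto
  qed
  \<comment> \<open>Directions change only across cells with both end scales equal to
    \<open>\<sigma>\<close>, so that a subcell which turns does not rescale.\<close>
  have turn: "d (Suc j) = d j \<or> \<nu> j = \<sigma> \<and> \<nu> (Suc j) = \<sigma>" if "j < b" for j
  proof -
    have "j = 0 \<or> j = 1 \<or> (2 \<le> j \<and> j \<le> c) \<or> j = Suc c \<or> j = Suc (Suc c) \<or> j = Suc (Suc (Suc c))"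
      using \<open>j < b\<close> bc by linarith
    then consider "j = 0" | "j = 1" | "2 \<le> j" "j \<le> c" | "j = Suc c" | "j = Suc (Suc c)" | "j = Suc (Suc (Suc c))"
      by blast
    then show ?thesis
      using bc \<nu>_end[of j] \<nu>_end[of "Suc j"] by cases (auto simp: d_def)
  qed
  \<comment> \<open>This is what \<open>h\<close> is for: a direct turn from
    \<open>d\<^sub>0\<close> to \<open>z\<close> is only bounded by \<open>1 / 10 + 2 / 100\<close>,
    above the permitted \<open>1 / 10\<close>, while the two turns through \<open>h\<close> are at
    most \<open>8 / 100\<close> each.\<close>
  have turn_size: "cmod (d (Suc j) - d j) \<le> 1 / 10" for j
  proof -
    have "cmod (h - d\<^sub>0) \<le> cmod (h - 1) + cmod (d\<^sub>0 - 1)"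
      using norm_triangle_ineq4[of "h - 1" "d\<^sub>0 - 1"] by simp
    moreover have "cmod (z - h) = cmod (h - 1)"
    proof -
      have "z - h = h * (h - 1)" by (simp add: h(2) algebra_simps)
      then show ?thesis by (simp add: norm_mult h(1))
    qed
    moreover have "d (Suc j) = d j \<or> d j = 1 \<and> d (Suc j) = d\<^sub>0 \<or> d j = d\<^sub>0 \<and> d (Suc j) = h \<or> d j = h \<and> d (Suc j) = z"
      using b by (simp add: d_def) linarith
    moreover have "cmod (h - 1) \<le> 6 / 100" using h(3) zd by linarith
    ultimately show ?thesis
      using d0d by (elim disjE conjE) simp_all
  qed
  have g_le: "0 < g j" "g j \<le> \<sigma>" for j
    using \<nu>0[of j] \<nu>_up[of j] \<nu>_up[of "Suc j"] by (auto simp: g_def)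
  have g_eq: "g j = \<sigma>" if "\<nu> j = \<sigma> \<or> \<nu> (Suc j) = \<sigma>" for j
    using that \<nu>_up[of j] \<nu>_up[of "Suc j"] by (auto simp: g_def)
  have sum_split: "(\<Sum>l<b. F l) = F 0 + F 1 + F 2 + (\<Sum>l\<in>{3..<c}. F l) + F c + F (Suc c)
      + F (Suc (Suc c)) + F (Suc (Suc (Suc c)))" for F :: "nat \<Rightarrow> complex"
  proof -
    have "(\<Sum>l<c. F l) = (\<Sum>l\<in>{0..<3}. F l) + (\<Sum>l\<in>{3..<c}. F l)"
      using bc by (simp add: lessThan_atLeast0 sum.atLeastLessThan_concat)
    also have "(\<Sum>l\<in>{0..<3}. F l) = F 0 + F 1 + F 2" by (simp add: eval_nat_numeral)
    finally show ?thesis by (simp add: bc(1) add.assoc)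
  qed
  have sb: "s b = Z"
  proof -
    have gs: "g 0 = \<sigma>" "g 1 = \<sigma>" "g 2 = \<sigma>" "g c = \<sigma>" "g (Suc c) = \<sigma>" "g (Suc (Suc c)) = \<sigma>"
        "g (Suc (Suc (Suc c))) = \<sigma>"
      using bc by (auto intro!: g_eq \<nu>_end)
    have ds: "d 0 = 1" "d 1 = 1" "d 2 = d\<^sub>0" "d c = d\<^sub>0" "d (Suc c) = d\<^sub>0" "d (Suc (Suc c)) = h"
        "d (Suc (Suc (Suc c))) = z"
      using bc by (auto simp: d_def)
    have "(\<Sum>l\<in>{3..<c}. g l *\<^sub>R d l) = (\<Sum>l\<in>{3..<c}. (\<sigma>' * max (dip b a D l) (dip b a D (Suc l))) *\<^sub>R d\<^sub>0)"
    proof (rule sum.cong[OF refl])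
      fix l assume l: "l \<in> {3..<c}"
      have "\<sigma>' > 0" using \<sigma>' \<sigma>0 by linarith
      then have "g l = \<sigma>' * max (dip b a D l) (dip b a D (Suc l))"
        using l by (simp add: g_def \<nu>_mid max_mult_distrib_left)
      moreover have "d l = d\<^sub>0" using l bc by (auto simp: d_def)
      ultimately show "g l *\<^sub>R d l = (\<sigma>' * max (dip b a D l) (dip b a D (Suc l))) *\<^sub>R d\<^sub>0" by simp
    qed
    also have "\<dots> = (\<sigma>' * S) *\<^sub>R d\<^sub>0"
      by (simp add: S_def c_def sum_distrib_left scaleR_sum_left)
    finally have mid: "(\<Sum>l\<in>{3..<c}. g l *\<^sub>R d l) = (cmod X - 3 * \<sigma>) *\<^sub>R d\<^sub>0" by (simp add: \<sigma>'S)
    have X_eq: "cmod X *\<^sub>R d\<^sub>0 = X" using X0 by (simp add: d\<^sub>0_def sgn_div_norm)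
    have "s b = cmod X *\<^sub>R d\<^sub>0 + 2 * \<sigma> + \<sigma> * h + \<sigma> * z"
      unfolding s_def sum_split gs ds mid by (simp add: scaleR_conv_of_real algebra_simps)
    then have "s b = X + 2 * \<sigma> + \<sigma> * h + \<sigma> * z" by (simp only: X_eq)
    then show ?thesis by (simp add: X_def)
  qed
  \<comment> \<open>\<open>G j\<close> is the arc length up to node \<open>j\<close>. All but four
    steps have direction \<open>d\<^sub>0\<close>, so the path leaves a straight line by at most
    \<open>4 * \<sigma>\<close>, and it leaves the chord, at the same fraction of arc length, by at
    most \<open>8 * \<sigma>\<close>.\<close>
  define G where "G j = (\<Sum>l<j. g l)" for j
  define r where "r j = (\<Sum>l<j. g l *\<^sub>R (d l - d\<^sub>0))" for j
  have s_eq: "s j = G j *\<^sub>R d\<^sub>0 + r j" for j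
    by (simp add: s_def G_def r_def scaleR_diff_right sum_subtractf scaleR_sum_left)
  have r_le: "cmod (r j) \<le> 4 * \<sigma>" if "j \<le> b" for j
  proof -
    have "cmod (r j) \<le> (\<Sum>l<j. cmod (g l *\<^sub>R (d l - d\<^sub>0)))" unfolding r_def by (rule norm_sum)
    also have "\<dots> \<le> (\<Sum>l<b. cmod (g l *\<^sub>R (d l - d\<^sub>0)))"
      using that by (intro sum_mono2) auto
    also have "\<dots> = (\<Sum>l\<in>{0, 1, Suc (Suc c), Suc (Suc (Suc c))}. cmod (g l *\<^sub>R (d l - d\<^sub>0)))"
      using bc by (intro sum.mono_neutral_right) (auto simp: d_def)
    also have "\<dots> \<le> (\<Sum>l\<in>{0, 1, Suc (Suc c), Suc (Suc (Suc c))}. \<sigma>)"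
    proof (rule sum_mono)
      fix l
      have "cmod (d l - d\<^sub>0) \<le> cmod (d l - 1) + cmod (d\<^sub>0 - 1)"
        using norm_triangle_ineq4[of "d l - 1" "d\<^sub>0 - 1"] by simp
      then have "cmod (d l - d\<^sub>0) \<le> 1" using d1[of l] d0d by linarith
      then show "cmod (g l *\<^sub>R (d l - d\<^sub>0)) \<le> \<sigma>"
        using g_le[of l] mult_mono[of "g l" \<sigma> "cmod (d l - d\<^sub>0)" 1] by simp
    qed
    also have "\<dots> = 4 * \<sigma>" using bc by simp
    finally show ?thesis .
  qed
  have key: "\<alpha> *\<^sub>R (0, v) + plane_emb u Z = e1 + \<omega> *\<^sub>R L (0, v)"
  proof -
    have "Complex 0 y = \<i> * y" by (simp add: complex_eq_iff)
    then have 1: "L (0, v) = (0, v) + plane_emb u ((z - 1) * (\<i> * y))"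
      by (simp add: L plane_rot_def y)
    have 2: "Z = 1 + \<omega> *\<^sub>R ((z - 1) * (\<i> * y)) + ((\<omega> - \<alpha>) * y) *\<^sub>R \<i>"
      by (simp add: Z_def scaleR_conv_of_real algebra_simps)
    have 3: "plane_emb u (((\<omega> - \<alpha>) * y) *\<^sub>R \<i>) = (\<omega> - \<alpha>) *\<^sub>R (0, v)"
      by (simp add: plane_emb_def vy)
    have "\<alpha> *\<^sub>R w + (e1 + \<omega> *\<^sub>R w' + (\<omega> - \<alpha>) *\<^sub>R w) = e1 + \<omega> *\<^sub>R (w + w')" for w w' :: "real \<times> 'v"
      by (simp add: algebra_simps)
    then show ?thesis
      unfolding 2 plane_emb_add plane_emb_1 3 unfolding plane_emb_scaleR 1 .
  qed
  define Q where "Q j = \<alpha> *\<^sub>R (0, v) + plane_emb u (s j)" for j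
  define T where "T j = plane_rot u (d j)" for j
  define L' where "L' j = plane_rot u (d (Suc j) / d j)" for j
  have near: "\<exists>f\<in>{0..1}. norm (Q j - row_path \<alpha> \<omega> L v f) \<le> 8 * \<sigma>" if "j < b" for j
  proof
    define f where "f = G j / G b"
    have Gb: "0 < G b" unfolding G_def using b g_le(1) by (intro sum_pos) (auto simp: lessThan_empty_iff)
    have "0 \<le> G j" "G j \<le> G b"
      unfolding G_def using that g_le(1) by (auto intro!: sum_nonneg sum_mono2 simp: less_imp_le)
    then show f01: "f \<in> {0..1}" using Gb by (simp add: f_def)
    have "row_path \<alpha> \<omega> L v f = \<alpha> *\<^sub>R (0, v) + f *\<^sub>R (e1 + \<omega> *\<^sub>R L (0, v) - \<alpha> *\<^sub>R (0, v))"
      by (simp add: row_path_def algebra_simps)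
    also have "\<dots> = \<alpha> *\<^sub>R (0, v) + plane_emb u (f *\<^sub>R Z)"
      unfolding key[symmetric] by (simp add: plane_emb_scaleR)
    finally have "Q j - row_path \<alpha> \<omega> L v f = plane_emb u (s j - f *\<^sub>R Z)"
      by (simp add: Q_def linear_diff[OF linear_plane_emb])
    moreover have "s j - f *\<^sub>R Z = r j - f *\<^sub>R r b"
      using Gb by (simp add: s_eq sb[symmetric] f_def scaleR_add_right)
    moreover have "cmod (r j - f *\<^sub>R r b) \<le> 8 * \<sigma>"
      using norm_triangle_ineq4[of "r j" "f *\<^sub>R r b"] r_le[of j] r_le[of b] that f01
        mult_mono[of f 1 "cmod (r b)" "4 * \<sigma>"] by simp
    ultimately show "norm (Q j - row_path \<alpha> \<omega> L v f) \<le> 8 * \<sigma>"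
      by (simp add: norm_plane_emb[OF u])
  qed
  have step: "Q (Suc j) = Q j + g j *\<^sub>R T j e1 \<and> T (Suc j) = T j \<circ> L' j \<and>
      cell_type (\<nu> j / g j) (\<nu> (Suc j) / g j) (L' j) \<and> (a + D \<le> j \<and> j + D + 4 < b \<longrightarrow> g j \<le> \<sigma> / 2 ^ D)"
    if j: "j < b" for j
  proof (intro conjI impI)
    show "Q (Suc j) = Q j + g j *\<^sub>R T j e1"
      by (simp add: Q_def s_def T_def plane_rot_e1[OF u] plane_emb_add plane_emb_scaleR)
    have dj: "d j \<noteq> 0" using dn[of j] by auto
    then show "T (Suc j) = T j \<circ> L' j"
      by (auto simp: T_def L'_def plane_rot_rot[OF u])
    have "d (Suc j) / d j - 1 = (d (Suc j) - d j) / d j" using dj by (simp add: field_simps)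
    then have "cmod (d (Suc j) / d j - 1) \<le> 1 / 10" using turn_size[of j] by (simp add: norm_divide dn)
    moreover have "d (Suc j) / d j = 1 \<or> \<nu> j / g j = 1 \<and> \<nu> (Suc j) / g j = 1"
      using turn[OF j] dj g_eq[of j] \<sigma>0 by auto
    moreover have "\<nu> j / g j = 1 \<or> \<nu> (Suc j) / g j = 1"
      using g_le(1)[of j] by (auto simp: g_def max_def split: if_splits)
    moreover have "1 / 2 \<le> \<nu> j / g j" "\<nu> j / g j \<le> 1" "1 / 2 \<le> \<nu> (Suc j) / g j" "\<nu> (Suc j) / g j \<le> 1"
      using g_le(1)[of j] ratio[OF j] \<nu>0[of j] \<nu>0[of "Suc j"] by (auto simp: g_def field_simps)
    moreover have "cmod (d (Suc j) / d j) = 1" by (simp add: norm_divide dn)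
    ultimately show "cell_type (\<nu> j / g j) (\<nu> (Suc j) / g j) (L' j)"
      unfolding cell_type_def L'_def using u by blast
    assume m: "a + D \<le> j \<and> j + D + 4 < b"
    have *: "\<nu> i \<le> \<sigma> / 2 ^ D" if "i = j \<or> i = Suc j" for i
    proof -
      have "min D (min (i - a) (b - 4 - i)) = D" "3 \<le> i" "i \<le> c"
        using that m a bc by auto
      then have "\<nu> i = \<sigma>' * (1 / 2) ^ D" using \<nu>_mid[of i] by (simp add: dip_def)
      also have "\<dots> \<le> \<sigma> * (1 / 2) ^ D" using \<sigma>' by (intro mult_right_mono) auto
      finally show ?thesis by (simp add: power_divide)
    qed
    show "g j \<le> \<sigma> / 2 ^ D" using * by (auto simp: g_def)
  qed
  have "row b a D \<sigma> \<alpha> \<omega> L v Q \<nu> T L'"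
    unfolding row_def Let_def g_def[symmetric]
  proof (intro conjI allI impI)
    show "Q 0 = \<alpha> *\<^sub>R (0, v)" by (simp add: Q_def s_def linear_0[OF linear_plane_emb])
    show "Q b = e1 + \<omega> *\<^sub>R L (0, v)" unfolding Q_def sb by (rule key)
    show "T 0 = (\<lambda>x. x)" by (simp add: T_def d_0)
    show "T b = L" by (simp add: T_def d_b L)
    show "orthogonal_transformation (T j)" for j unfolding T_def by (rule orthogonal_plane_rot[OF u dn])
    show "norm (T j x - x) \<le> norm x / 10" for j x
      using plane_rot_dist[OF u, of "d j" x] d1[of j] mult_right_mono[OF d1[of j], of "norm x"]
      by (simp add: T_def)
  qed (use step near \<nu>_0 \<nu>_b \<nu>_up \<nu>_low in auto)
  then show ?thesis by blast
qed

section \<open>Separation of rows\<close>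

text \<open>The last bound uses that a cell rescales or turns but not both: the scales differ by at
  most \<open>1 / 2\<close>, or the turn moves \<open>x\<close> by at most a tenth of its
  norm.\<close>

lemma cell_typeD:
  assumes "cell_type \<alpha> \<omega> L"
  shows "orthogonal_transformation L" "norm (L x - x) \<le> norm x / 10"
    "1 / 2 \<le> \<alpha>" "\<alpha> \<le> 1" "1 / 2 \<le> \<omega>" "\<omega> \<le> 1" "norm (\<omega> *\<^sub>R L x - \<alpha> *\<^sub>R x) \<le> norm x / 2"
proof -
  obtain u z where uz: "norm u = 1" "cmod z = 1" "cmod (z - 1) \<le> 1 / 10" "L = plane_rot u z"
    and p: "z = 1 \<or> \<alpha> = 1 \<and> \<omega> = 1"
    using assms unfolding cell_type_def by blast
  show "orthogonal_transformation L" using uz orthogonal_plane_rot by blast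
  show Lx: "norm (L x - x) \<le> norm x / 10"
    using plane_rot_dist[OF uz(1), of z x] mult_right_mono[OF uz(3), of "norm x"] uz(4) by simp
  show *: "1 / 2 \<le> \<alpha>" "\<alpha> \<le> 1" "1 / 2 \<le> \<omega>" "\<omega> \<le> 1"
    using assms by (auto simp: cell_type_def)
  show "norm (\<omega> *\<^sub>R L x - \<alpha> *\<^sub>R x) \<le> norm x / 2"
  proof (cases "z = 1")
    case True
    then have "norm (\<omega> *\<^sub>R L x - \<alpha> *\<^sub>R x) = \<bar>\<omega> - \<alpha>\<bar> * norm x"
      by (simp add: uz(4) scaleR_diff_left[symmetric])
    also have "\<bar>\<omega> - \<alpha>\<bar> \<le> 1 / 2" using * by linarith
    finally show ?thesis by (simp add: mult_right_mono)
  next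
    case False
    then have "norm (\<omega> *\<^sub>R L x - \<alpha> *\<^sub>R x) = norm (L x - x)" using p by simp
    also have "\<dots> \<le> norm x / 2" using Lx norm_ge_zero[of x] by linarith
    finally show ?thesis .
  qed
qed

text \<open>\<open>7 / 10\<close> is a rational lower bound for \<open>1 / sqrt 2\<close>, the
  constant comparing the sum norm with the Euclidean norm in two dimensions.\<close>

lemma norm_Pair_ge: "7 / 10 * (\<bar>r\<bar> + norm x) \<le> norm (r :: real, x :: 'v::euclidean_space)"
proof -
  have "(\<bar>r\<bar> + norm x)\<^sup>2 \<le> 2 * (r\<^sup>2 + (norm x)\<^sup>2)"
    using sum_squares_bound[of "\<bar>r\<bar>" "norm x"] by (simp add: power2_sum)
  moreover have "49 / 100 * p \<le> q" if "p \<le> 2 * q" "0 \<le> q" for p q :: real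
    using that by linarith
  ultimately have "49 / 100 * (\<bar>r\<bar> + norm x)\<^sup>2 \<le> r\<^sup>2 + (norm x)\<^sup>2"
    by (meson add_nonneg_nonneg zero_le_power2)
  moreover have "(7 / 10 * p)\<^sup>2 = 49 / 100 * p\<^sup>2" for p :: real
    by (simp add: power2_eq_square)
  ultimately have "(7 / 10 * (\<bar>r\<bar> + norm x))\<^sup>2 \<le> r\<^sup>2 + (norm x)\<^sup>2"
    by (simp only:)
  then show ?thesis unfolding norm_Pair by (intro real_le_rsqrt) simp
qed

lemma row_path_near_axis:
  assumes "cell_type \<alpha> \<omega> L" "norm v \<le> 1 / 100" "f \<in> {0..1}"
  shows "norm (row_path \<alpha> \<omega> L v f - f *\<^sub>R e1) \<le> 1 / 100"
proof -
  note ty = cell_typeD[OF assms(1)]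
  have "norm (row_path \<alpha> \<omega> L v f - f *\<^sub>R e1) = norm (((1 - f) * \<alpha>) *\<^sub>R (0 :: real, v) + (f * \<omega>) *\<^sub>R L (0, v))"
    unfolding row_path_def by (rule arg_cong[of _ _ norm], simp only: add.assoc add_diff_cancel_left')
  also have "\<dots> \<le> \<bar>(1 - f) * \<alpha>\<bar> * norm v + \<bar>f * \<omega>\<bar> * norm v"
    using norm_triangle_ineq[of "((1 - f) * \<alpha>) *\<^sub>R (0 :: real, v)" "(f * \<omega>) *\<^sub>R L (0, v)"]
    by (simp add: orthogonal_transformation_norm[OF ty(1)])
  also have "\<dots> = ((1 - f) * \<alpha> + f * \<omega>) * norm v"
    using assms(3) ty by (simp add: abs_mult algebra_simps)
  also have "\<dots> \<le> 1 * (1 / 100)"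
  proof (rule mult_mono)
    have "(1 - f) * \<alpha> + f * \<omega> \<le> (1 - f) * 1 + f * 1"
      using assms(3) ty by (intro add_mono mult_left_mono) auto
    then show "(1 - f) * \<alpha> + f * \<omega> \<le> 1" by simp
  qed (use assms in auto)
  finally show ?thesis by simp
qed

text \<open>The main part \<open>m\<close> has orthogonal components \<open>f - f'\<close> and at
  least half of \<open>v - v'\<close>. The slant error \<open>r\<close> is small against
  \<open>f - f'\<close> because \<open>v'\<close> is short, and the turn error \<open>q\<close> is
  at most a tenth of the difference of the offsets. There remains
  \<open>7 / 20 - 1 / 10 = 1 / 4\<close>.\<close>

lemma row_path_sep:
  fixes v v' :: "'v::euclidean_space"
  assumes ty: "cell_type \<alpha> \<omega> L" and v': "norm v' \<le> 1 / 100"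
    and f: "f \<in> {0..1}" "f' \<in> {0..1}"
  shows "norm (v - v') / 4 \<le> norm (row_path \<alpha> \<omega> L v f - row_path \<alpha> \<omega> L v' f')"
proof -
  note t = cell_typeD[OF ty]
  have lin: "linear L" using t(1) by (rule orthogonal_transformation_linear)
  define \<Delta> where "\<Delta> = v - v'"
  define \<mu> where "\<mu> = (1 - f) * \<alpha> + f * \<omega>"
  define m where "m = ((f - f') *\<^sub>R e1 + \<mu> *\<^sub>R (0, \<Delta>) :: real \<times> 'v)"
  define r where "r = (f - f') *\<^sub>R (\<omega> *\<^sub>R L (0, v') - \<alpha> *\<^sub>R (0, v'))"
  define q where "q = (f * \<omega>) *\<^sub>R (L (0, \<Delta>) - (0, \<Delta>))"
  have Lv: "L (0, v) = L (0, v') + L (0, \<Delta>)"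
    using linear_add[OF lin, of "(0, v')" "(0, \<Delta>)"] by (simp add: \<Delta>_def)
  have v: "(0::real, v) = (0, v') + (0, \<Delta>)" by (simp add: \<Delta>_def)
  have eq: "row_path \<alpha> \<omega> L v f - row_path \<alpha> \<omega> L v' f' = m + r + q"
  proof -
    have "f *\<^sub>R e + ((1 - f) * \<alpha>) *\<^sub>R (p + d) + (f * \<omega>) *\<^sub>R (p' + d')
        - (f' *\<^sub>R e + ((1 - f') * \<alpha>) *\<^sub>R p + (f' * \<omega>) *\<^sub>R p')
      = (f - f') *\<^sub>R e + \<mu> *\<^sub>R d + (f - f') *\<^sub>R (\<omega> *\<^sub>R p' - \<alpha> *\<^sub>R p) + (f * \<omega>) *\<^sub>R (d' - d)"
      for e p d p' d' :: "real \<times> 'v"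
      unfolding \<mu>_def by (simp add: algebra_simps)
    then show ?thesis unfolding row_path_def m_def r_def q_def Lv unfolding v by blast
  qed
  have \<mu>: "1 / 2 \<le> \<mu>"
  proof -
    have "(1 - f) * (1 / 2) + f * (1 / 2) \<le> \<mu>"
      unfolding \<mu>_def using f t by (intro add_mono mult_left_mono) auto
    moreover have "(1 - f) * (1 / 2) + f * (1 / 2) = 1 / 2" by (simp add: field_simps)
    ultimately show ?thesis by linarith
  qed
  have "m = (f - f', \<mu> *\<^sub>R \<Delta>)" by (simp add: m_def)
  then have "7 / 10 * (\<bar>f - f'\<bar> + \<mu> * norm \<Delta>) \<le> norm m"
    using norm_Pair_ge[of "f - f'" "\<mu> *\<^sub>R \<Delta>"] \<mu> by simp
  moreover have "1 / 2 * norm \<Delta> \<le> \<mu> * norm \<Delta>" using \<mu> by (intro mult_right_mono) auto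
  moreover have "norm r \<le> \<bar>f - f'\<bar> * (1 / 200)"
    using t(7)[of "(0, v')"] v'
      mult_left_mono[of "norm (\<omega> *\<^sub>R L (0, v') - \<alpha> *\<^sub>R (0, v'))" "1 / 200" "\<bar>f - f'\<bar>"]
    by (simp add: r_def)
  moreover have "norm q \<le> 1 * (norm \<Delta> / 10)"
    unfolding q_def norm_scaleR using t(2)[of "(0, \<Delta>)"] f t(3-6)
    by (intro mult_mono) (auto simp: abs_mult intro: mult_le_one)
  moreover have "norm m - norm r - norm q \<le> norm (m + r + q)"
    using norm_triangle_ineq4[of "m + r + q" "r + q"] norm_triangle_ineq[of r q] by (simp add: algebra_simps)
  ultimately show ?thesis unfolding eq \<Delta>_def[symmetric]
    using abs_ge_zero[of "f - f'"] by argo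
qed

text \<open>The row with offset \<open>v'\<close> of the next cell, seen from the frame of a cell with scales \<open>\<alpha>\<close>,
  \<open>\<omega>\<close>; \<open>\<kappa>\<close> is the ratio of the two cell sizes.\<close>

lemma row_path_sep_next:
  fixes v v' :: "'v::euclidean_space"
  assumes ty: "cell_type \<alpha> \<omega> L" and ty': "cell_type \<alpha>' \<omega>' L'"
    and v: "norm v \<le> 1 / 100" "norm v' \<le> 1 / 100"
    and f: "f \<in> {0..1}" "f' \<in> {0..1}" and \<kappa>: "\<kappa> * \<alpha>' = \<omega>"
  shows "norm (v' - v) / 4 \<le> norm (e1 + \<kappa> *\<^sub>R L (row_path \<alpha>' \<omega>' L' v' f') - row_path \<alpha> \<omega> L v f)"
proof -
  note t = cell_typeD[OF ty] and t' = cell_typeD[OF ty']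
  have "\<kappa> = \<omega> / \<alpha>'" using \<kappa> t'(3) by (auto simp: field_simps)
  then have \<kappa>0: "0 \<le> \<kappa>" using t(5) t'(3) by simp
  have lin: "linear L" using t(1) by (rule orthogonal_transformation_linear)
  define \<Delta> where "\<Delta> = v' - v"
  \<comment> \<open>\<open>A\<close> is the way along the axis: \<open>1 - f\<close> left in the
    first cell, \<open>f' * \<kappa>\<close> done in the second. The errors \<open>p\<close>,
    \<open>r\<close>, \<open>s\<close> are absorbed by it, the error \<open>q\<close> by the
    difference of the offsets.\<close>
  define A where "A = 1 - f + f' * \<kappa>"
  define m where "m = (A *\<^sub>R e1 + \<omega> *\<^sub>R (0, \<Delta>) :: real \<times> 'v)"
  define p where "p = (f' * \<kappa>) *\<^sub>R (L e1 - e1)"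
  define q where "q = \<omega> *\<^sub>R (L (0, \<Delta>) - (0, \<Delta>))"
  define r where "r = (1 - f) *\<^sub>R (\<omega> *\<^sub>R L (0, v) - \<alpha> *\<^sub>R (0, v))"
  define s where "s = (f' * \<kappa>) *\<^sub>R L (\<omega>' *\<^sub>R L' (0, v') - \<alpha>' *\<^sub>R (0, v'))"
  have Lv: "L (0, v') = L (0, v) + L (0, \<Delta>)"
    using linear_add[OF lin, of "(0, v)" "(0, \<Delta>)"] by (simp add: \<Delta>_def)
  have eq: "e1 + \<kappa> *\<^sub>R L (row_path \<alpha>' \<omega>' L' v' f') - row_path \<alpha> \<omega> L v f = m + p + q + r + s"
  proof -
    have "L (row_path \<alpha>' \<omega>' L' v' f') = f' *\<^sub>R L e1 + ((1 - f') * \<alpha>') *\<^sub>R L (0, v') + (f' * \<omega>') *\<^sub>R L (L' (0, v'))"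
      unfolding row_path_def by (simp only: linear_add[OF lin] linear_scale[OF lin])
    then have k1: "\<kappa> *\<^sub>R L (row_path \<alpha>' \<omega>' L' v' f')
      = (f' * \<kappa>) *\<^sub>R L e1 + ((1 - f') * \<omega>) *\<^sub>R L (0, v') + (f' * \<omega>' * \<kappa>) *\<^sub>R L (L' (0, v'))"
      by (simp add: \<kappa>[symmetric] scaleR_add_right mult.commute mult.left_commute)
    have k2: "s = (f' * \<omega>' * \<kappa>) *\<^sub>R L (L' (0, v')) - (f' * \<omega>) *\<^sub>R L (0, v')"
    proof -
      have "L (\<omega>' *\<^sub>R L' (0, v') - \<alpha>' *\<^sub>R (0, v')) = \<omega>' *\<^sub>R L (L' (0, v')) - \<alpha>' *\<^sub>R L (0, v')"
        by (simp only: linear_diff[OF lin] linear_scale[OF lin])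
      moreover have "(f' * \<kappa>) *\<^sub>R (\<omega>' *\<^sub>R x - \<alpha>' *\<^sub>R y) = (f' * \<omega>' * \<kappa>) *\<^sub>R x - (f' * \<omega>) *\<^sub>R y"
        for x y :: "real \<times> 'v"
        by (simp add: \<kappa>[symmetric] algebra_simps)
      ultimately show ?thesis unfolding s_def by (rule ssubst)
    qed
    have kp: "p = (f' * \<kappa>) *\<^sub>R L e1 - (f' * \<kappa>) *\<^sub>R e1"
      by (simp only: p_def scaleR_diff_right)
    have k3: "e + (x + ((1 - f') * \<omega>) *\<^sub>R (y + d) + y') - (f *\<^sub>R e + ((1 - f) * \<alpha>) *\<^sub>R w + (f * \<omega>) *\<^sub>R y)
      = ((1 - f + f' * \<kappa>) *\<^sub>R e + \<omega> *\<^sub>R d') + (x - (f' * \<kappa>) *\<^sub>R e) + \<omega> *\<^sub>R (d - d') + (1 - f) *\<^sub>R (\<omega> *\<^sub>R y - \<alpha> *\<^sub>R w)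
        + (y' - (f' * \<omega>) *\<^sub>R (y + d))" for e x y d y' w d' :: "real \<times> 'v"
      by (simp add: algebra_simps)
    show ?thesis
      unfolding row_path_def[of \<alpha> \<omega> L v f] k1 k2 kp m_def A_def q_def r_def Lv by (rule k3)
  qed
  have A0: "0 \<le> f' * \<kappa>" "0 \<le> 1 - f" using f \<kappa>0 by auto
  have "m = (A, \<omega> *\<^sub>R \<Delta>)" by (simp add: m_def)
  then have "7 / 10 * (A + \<omega> * norm \<Delta>) \<le> norm m"
    using norm_Pair_ge[of A "\<omega> *\<^sub>R \<Delta>"] t(5) A0 by (simp add: A_def)
  moreover have "1 / 2 * norm \<Delta> \<le> \<omega> * norm \<Delta>" using t(5) by (intro mult_right_mono) auto
  moreover have "norm p \<le> f' * \<kappa> * (1 / 10)"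
    unfolding p_def norm_scaleR using t(2)[of e1] A0 mult_left_mono[of "norm (L e1 - e1)" "1 / 10" "f' * \<kappa>"] by simp
  moreover have "norm q \<le> 1 * (norm \<Delta> / 10)"
    unfolding q_def norm_scaleR using t(2)[of "(0, \<Delta>)"] t(3-6) by (intro mult_mono) auto
  moreover have "norm r \<le> (1 - f) * (1 / 200)"
    unfolding r_def using t(7)[of "(0, v)"] v A0
      mult_left_mono[of "norm (\<omega> *\<^sub>R L (0, v) - \<alpha> *\<^sub>R (0, v))" "1 / 200" "1 - f"] by simp
  moreover have "norm s \<le> f' * \<kappa> * (1 / 200)"
    unfolding s_def norm_scaleR orthogonal_transformation_norm[OF t(1)] using t'(7)[of "(0, v')"] v A0
      mult_left_mono[of "norm (\<omega>' *\<^sub>R L' (0, v') - \<alpha>' *\<^sub>R (0, v'))" "1 / 200" "f' * \<kappa>"] by simp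
  moreover have "norm m - norm p - norm q - norm r - norm s \<le> norm (m + p + q + r + s)"
    using norm_triangle_ineq4[of "m + p + q + r + s" "p + q + r + s"] norm_triangle_ineq[of "p + q + r" s]
      norm_triangle_ineq[of "p + q" r] norm_triangle_ineq[of p q] by (simp add: algebra_simps)
  ultimately show ?thesis
    unfolding eq \<Delta>_def[symmetric] A_def using A0 norm_ge_zero[of \<Delta>] by argo
qed

text \<open>The unit shape with face scales \<open>cal\<close>, \<open>com\<close> and relative turn
  \<open>clin\<close> is placed in space by the similarity taking \<open>x\<close> to
  \<open>cpos + csiz *\<^sub>R crot x\<close>.\<close>

datatype 'v cell = Cell (cpos: "real \<times> 'v") (csiz: real) (crot: "real \<times> 'v \<Rightarrow> real \<times> 'v")
  (cal: real) (com: real) (clin: "real \<times> 'v \<Rightarrow> real \<times> 'v")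

abbreviation cell_path :: "'v::euclidean_space cell \<Rightarrow> 'v \<Rightarrow> real \<Rightarrow> real \<times> 'v" where
  "cell_path c \<equiv> row_path (cal c) (com c) (clin c)"

definition wf_cell :: "'v::euclidean_space cell \<Rightarrow> bool" where
  "wf_cell c \<longleftrightarrow> 0 < csiz c \<and> orthogonal_transformation (crot c) \<and> cell_type (cal c) (com c) (clin c)"

text \<open>The second face of \<open>c\<close> is the first face of \<open>c'\<close>, with the
  same position, scale and frame. Exact equality is what can be handed down to the next generation
  without accumulating errors.\<close>

definition follows :: "'v::euclidean_space cell \<Rightarrow> 'v cell \<Rightarrow> bool" where
  "follows c c' \<longleftrightarrow> cpos c' = cpos c + csiz c *\<^sub>R crot c e1 \<and> csiz c' * cal c' = csiz c * com c \<and>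
     crot c' = crot c \<circ> clin c"

lemma follows_size:
  assumes "follows c c'" "wf_cell c" "wf_cell c'"
  shows "csiz c \<le> 2 * csiz c'" "csiz c' \<le> 2 * csiz c"
proof -
  have t: "1 / 2 \<le> cal c'" "cal c' \<le> 1" "1 / 2 \<le> com c" "com c \<le> 1" "0 < csiz c" "0 < csiz c'"
    using assms(2,3) cell_typeD(3-6) unfolding wf_cell_def by blast+
  have eq: "csiz c' * cal c' = csiz c * com c" using assms(1) by (simp add: follows_def)
  have "csiz c * (1 / 2) \<le> csiz c * com c" "csiz c * com c \<le> csiz c * 1"
    "csiz c' * (1 / 2) \<le> csiz c' * cal c'" "csiz c' * cal c' \<le> csiz c' * 1"
    using t by (auto intro!: mult_left_mono simp del: mult_1_right)
  then show "csiz c \<le> 2 * csiz c'" "csiz c' \<le> 2 * csiz c" using eq by linarith+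
qed

section \<open>Generations of cells\<close>

text \<open>\<open>I\<close> is the set of row offsets. A row wanders from its model by several
  multiples of \<open>\<sigma>\<close>, so the separation \<open>\<gamma>\<close> of the offsets has
  to dominate \<open>\<sigma>\<close>.\<close>

locale cascade =
  fixes b a D :: nat and \<sigma> \<gamma> :: real and I :: "'v::euclidean_space set"
  assumes a: "3 < a" "a \<le> b - 4" and \<sigma>_def: "\<sigma> = row_scale b a D"
    and \<sigma>_small: "\<sigma> \<le> 1 / 2000" "\<sigma> \<le> \<gamma> / 1000"
    and I_small: "\<And>v. v \<in> I \<Longrightarrow> norm v \<le> 1 / 100"
    and I_sep: "\<And>v v'. v \<in> I \<Longrightarrow> v' \<in> I \<Longrightarrow> v \<noteq> v' \<Longrightarrow> \<gamma> \<le> norm (v - v')"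
begin

lemma b_ge: "8 \<le> b" using a by linarith

lemma \<sigma>_pos: "0 < \<sigma>" unfolding \<sigma>_def using row_scale_le(1)[OF a] .

definition place_cell where
  "place_cell c Q \<nu> T L' j = (let g = max (\<nu> j) (\<nu> (Suc j)) in
     Cell (cpos c + csiz c *\<^sub>R crot c (Q j)) (csiz c * g) (crot c \<circ> T j) (\<nu> j / g) (\<nu> (Suc j) / g) (L' j))"

text \<open>The choice depends on the cell and the offset only; therefore codes that agree below
  \<open>n\<close> give the same cells of generation \<open>n\<close>.\<close>

definition the_row where
  "the_row c v = (SOME r. case r of (Q, \<nu>, T, L') \<Rightarrow> row b a D \<sigma> (cal c) (com c) (clin c) v Q \<nu> T L')"

definition child :: "'v cell \<Rightarrow> 'v \<Rightarrow> nat \<Rightarrow> 'v cell" where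
  "child c v j = (case the_row c v of (Q, \<nu>, T, L') \<Rightarrow> place_cell c Q \<nu> T L' j)"

text \<open>\<open>k\<close> numbers the cells of a generation consecutively, and its last
  \<open>n\<close> digits in base \<open>b\<close> are the positions in the nested rows. There is no
  bound on \<open>k\<close>: the time \<open>t = 1\<close> has index \<open>b ^ n\<close>, and every
  cell has a successor.\<close>

primrec cell :: "nat \<Rightarrow> (nat \<Rightarrow> 'v) \<Rightarrow> nat \<Rightarrow> 'v cell" where
  "cell 0 w k = Cell (real k, 0) 1 (\<lambda>x. x) 1 1 (\<lambda>x. x)"
| "cell (Suc n) w k = child (cell n w (k div b)) (w n) (k mod b)"

lemma child_row:
  assumes c: "wf_cell c" and v: "v \<in> I"
  obtains Q \<nu> T L' where "row b a D \<sigma> (cal c) (com c) (clin c) v Q \<nu> T L'"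
    "\<And>j. child c v j = place_cell c Q \<nu> T L' j"
proof -
  have "cell_type (cal c) (com c) (clin c)" using c by (simp add: wf_cell_def)
  then obtain Q \<nu> T L' where "row b a D \<sigma> (cal c) (com c) (clin c) v Q \<nu> T L'"
    using row_exists[OF a _ I_small[OF v]] \<sigma>_small unfolding \<sigma>_def by blast
  then have "\<exists>r. case r of (Q, \<nu>, T, L') \<Rightarrow> row b a D \<sigma> (cal c) (com c) (clin c) v Q \<nu> T L'"
    by (intro exI[of _ "(Q, \<nu>, T, L')"]) simp
  from someI_ex[OF this]
  have *: "case the_row c v of (Q, \<nu>, T, L') \<Rightarrow> row b a D \<sigma> (cal c) (com c) (clin c) v Q \<nu> T L'"
    unfolding the_row_def .
  obtain Q \<nu> T L' where r: "the_row c v = (Q, \<nu>, T, L')" by (cases "the_row c v")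
  show thesis by (rule that[of Q \<nu> T L']) (use * in \<open>auto simp: r child_def\<close>)
qed

lemma orthogonal_comp:
  "orthogonal_transformation f \<Longrightarrow> orthogonal_transformation g \<Longrightarrow> orthogonal_transformation (f \<circ> g)"
  by (simp add: orthogonal_transformation_def linear_compose)

lemma
  assumes c: "wf_cell c" and v: "v \<in> I" and j: "j < b"
  shows wf_child: "wf_cell (child c v j)"
    and child_size: "csiz c * (\<sigma> / 2 ^ Suc D) \<le> csiz (child c v j)" "csiz (child c v j) \<le> csiz c * \<sigma>"
    and child_tiny: "a + D \<le> j \<Longrightarrow> j + D + 4 < b \<Longrightarrow> csiz (child c v j) \<le> csiz c * (\<sigma> / 2 ^ D)"
    and child_rot: "norm (crot (child c v j) x - crot c x) \<le> norm x / 10"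
    and child_pos: "\<exists>f\<in>{0..1}. norm (cpos (child c v j) -
          (cpos c + csiz c *\<^sub>R crot c (cell_path c v f))) \<le> csiz c * (8 * \<sigma>)"
proof -
  obtain Q \<nu> T L' where r: "row b a D \<sigma> (cal c) (com c) (clin c) v Q \<nu> T L'"
    and ch: "\<And>j. child c v j = place_cell c Q \<nu> T L' j"
    using child_row[OF c v] by metis
  have c': "0 < csiz c" "orthogonal_transformation (crot c)" using c by (auto simp: wf_cell_def)
  have lin: "linear (crot c)" using c'(2) by (rule orthogonal_transformation_linear)
  have Tj: "orthogonal_transformation (T j)" "\<And>x. norm (T j x - x) \<le> norm x / 10"
    and \<nu>: "\<sigma> / 2 ^ Suc D \<le> \<nu> j" "\<nu> j \<le> \<sigma>" "\<sigma> / 2 ^ Suc D \<le> \<nu> (Suc j)" "\<nu> (Suc j) \<le> \<sigma>"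
    using r j unfolding row_def by auto
  define g where "g = max (\<nu> j) (\<nu> (Suc j))"
  have st: "cell_type (\<nu> j / g) (\<nu> (Suc j) / g) (L' j)"
       "\<exists>f\<in>{0..1}. norm (Q j - cell_path c v f) \<le> 8 * \<sigma>"
        "a + D \<le> j \<and> j + D + 4 < b \<longrightarrow> g \<le> \<sigma> / 2 ^ D"
    using r j unfolding row_def Let_def g_def by blast+
  have g: "\<sigma> / 2 ^ Suc D \<le> g" "g \<le> \<sigma>" "0 < g"
    using \<nu> \<sigma>_pos unfolding g_def by (auto simp: le_max_iff_disj less_max_iff_disj intro: less_le_trans[of _ "\<sigma> / 2 ^ Suc D"])
  note ch = ch[of j, unfolded place_cell_def Let_def, folded g_def]
  show "wf_cell (child c v j)"
    using c' g st(1) orthogonal_comp[OF c'(2) Tj(1)] by (simp add: wf_cell_def ch)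
  show "csiz c * (\<sigma> / 2 ^ Suc D) \<le> csiz (child c v j)" "csiz (child c v j) \<le> csiz c * \<sigma>"
    unfolding ch cell.sel by (rule mult_left_mono[OF g(1) less_imp_le[OF c'(1)]],
      rule mult_left_mono[OF g(2) less_imp_le[OF c'(1)]])
  show "csiz (child c v j) \<le> csiz c * (\<sigma> / 2 ^ D)" if "a + D \<le> j" "j + D + 4 < b"
    unfolding ch cell.sel using that st(3) by (intro mult_left_mono less_imp_le[OF c'(1)]) blast
  show "norm (crot (child c v j) x - crot c x) \<le> norm x / 10"
    using Tj(2)[of x] by (simp add: ch linear_diff[OF lin, symmetric] orthogonal_transformation_norm[OF c'(2)])
  obtain f where f: "f \<in> {0..1}" "norm (Q j - cell_path c v f) \<le> 8 * \<sigma>"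
    using st(2) by blast
  have "cpos (child c v j) - (cpos c + csiz c *\<^sub>R crot c (cell_path c v f))
    = csiz c *\<^sub>R crot c (Q j - cell_path c v f)"
    by (simp add: ch linear_diff[OF lin] scaleR_diff_right)
  then have "norm (cpos (child c v j) - (cpos c + csiz c *\<^sub>R crot c (cell_path c v f)))
     = csiz c * norm (Q j - cell_path c v f)"
    using c'(1) by (simp add: orthogonal_transformation_norm[OF c'(2)])
  then show "\<exists>f\<in>{0..1}. norm (cpos (child c v j) -
          (cpos c + csiz c *\<^sub>R crot c (cell_path c v f))) \<le> csiz c * (8 * \<sigma>)"
    using f c'(1) mult_left_mono[OF f(2), of "csiz c"] by (intro bexI[of _ f]) auto
qed

lemma follows_child:
  assumes c: "wf_cell c" and v: "v \<in> I" and j: "Suc j < b"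
  shows "follows (child c v j) (child c v (Suc j))"
proof -
  obtain Q \<nu> T L' where r: "row b a D \<sigma> (cal c) (com c) (clin c) v Q \<nu> T L'"
    and ch: "\<And>j. child c v j = place_cell c Q \<nu> T L' j"
    using child_row[OF c v] by metis
  have lin: "linear (crot c)"
    using c by (auto simp: wf_cell_def intro: orthogonal_transformation_linear)
  have \<nu>: "0 < \<nu> i" if "i \<le> b" for i
    using r that \<sigma>_pos unfolding row_def
    by (meson divide_pos_pos less_le_trans zero_less_numeral zero_less_power)
  have "Q (Suc j) = Q j + max (\<nu> j) (\<nu> (Suc j)) *\<^sub>R T j e1" "T (Suc j) = T j \<circ> L' j"
    using r j unfolding row_def Let_def by auto
  then show ?thesis
    using \<nu>[of j] \<nu>[of "Suc j"] \<nu>[of "Suc (Suc j)"] j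
    by (auto simp: follows_def ch place_cell_def Let_def linear_add[OF lin] linear_scale[OF lin] scaleR_add_right o_assoc max_def)
qed

text \<open>Both rows have the same offset and meet on the common face of \<open>c\<close> and
  \<open>c'\<close>. The row in \<open>c\<close> ends with the scale \<open>com c\<close> and the
  frame \<open>clin c\<close>, the row in \<open>c'\<close> starts with the scale
  \<open>cal c'\<close> and the identity frame; \<open>follows c c'\<close> says that these
  match.\<close>

lemma follows_child_next:
  assumes c: "wf_cell c" "wf_cell c'" "follows c c'" and v: "v \<in> I"
  shows "follows (child c v (b - 1)) (child c' v 0)"
proof -
  obtain Q \<nu> T L' where r: "row b a D \<sigma> (cal c) (com c) (clin c) v Q \<nu> T L'"
    and ch: "\<And>j. child c v j = place_cell c Q \<nu> T L' j"
    using child_row[OF c(1) v] by metis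
  obtain Q' \<nu>' T' L'' where r': "row b a D \<sigma> (cal c') (com c') (clin c') v Q' \<nu>' T' L''"
    and ch': "\<And>j. child c' v j = place_cell c' Q' \<nu>' T' L'' j"
    using child_row[OF c(2) v] by metis
  have b: "Suc (b - 1) = b" using b_ge by simp
  have lin: "linear (crot c)" and linL: "linear (clin c)"
    using c(1) cell_typeD(1) by (auto simp: wf_cell_def intro: orthogonal_transformation_linear)
  have \<nu>: "0 < \<nu> i" "0 < \<nu>' i" if "i \<le> b" for i
    using r r' that \<sigma>_pos unfolding row_def
    by (meson divide_pos_pos less_le_trans zero_less_numeral zero_less_power)+
  have "b - 1 < b" using b_ge by simp
  then have Q: "Q b = Q (b - 1) + max (\<nu> (b - 1)) (\<nu> b) *\<^sub>R T (b - 1) e1" "T b = T (b - 1) \<circ> L' (b - 1)"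
    using r b unfolding row_def Let_def by metis+
  have ends: "Q b = e1 + com c *\<^sub>R clin c (0, v)" "T b = clin c" "\<nu> b = \<sigma> * com c"
    "Q' 0 = cal c' *\<^sub>R (0, v)" "T' 0 = (\<lambda>x. x)" "\<nu>' 0 = \<sigma> * cal c'"
    using r r' unfolding row_def by auto
  have f: "cpos c' = cpos c + csiz c *\<^sub>R crot c e1" "csiz c' * cal c' = csiz c * com c" "crot c' = crot c \<circ> clin c"
    using c(3) by (auto simp: follows_def)
  have pos: "cpos (child c' v 0) = cpos c + csiz c *\<^sub>R crot c (Q b)"
  proof -
    have "csiz c' *\<^sub>R crot c' (Q' 0) = (csiz c' * cal c') *\<^sub>R crot c (clin c (0, v))"
      unfolding ends f(3) by (simp only: o_apply linear_scale[OF linL] linear_scale[OF lin] scaleR_scaleR)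
    also have "\<dots> = csiz c *\<^sub>R crot c (com c *\<^sub>R clin c (0, v))"
      unfolding f(2) by (simp only: linear_scale[OF lin] scaleR_scaleR)
    finally show ?thesis
      unfolding ch' ends(1) by (simp add: place_cell_def Let_def f(1) linear_add[OF lin] scaleR_add_right)
  qed
  show ?thesis unfolding follows_def
  proof (intro conjI)
    show "cpos (child c' v 0) = cpos (child c v (b - 1)) + csiz (child c v (b - 1)) *\<^sub>R crot (child c v (b - 1)) e1"
      unfolding pos Q(1) by (simp add: ch place_cell_def Let_def b linear_add[OF lin] linear_scale[OF lin] scaleR_add_right del: One_nat_def)
    show "csiz (child c' v 0) * cal (child c' v 0) = csiz (child c v (b - 1)) * com (child c v (b - 1))"
    proof -
      have "csiz (child c' v 0) * cal (child c' v 0) = csiz c' * \<nu>' 0"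
        using \<nu>[of 0] by (simp add: ch' place_cell_def Let_def less_max_iff_disj)
      moreover have "csiz (child c v (b - 1)) * com (child c v (b - 1)) = csiz c * \<nu> b"
        using \<nu>[of b] by (simp add: ch place_cell_def Let_def b less_max_iff_disj del: One_nat_def)
      ultimately show ?thesis using f(2) by (simp add: ends mult.left_commute)
    qed
    show "crot (child c' v 0) = crot (child c v (b - 1)) \<circ> clin (child c v (b - 1))"
      using Q(2) by (auto simp: ch ch' place_cell_def Let_def ends f(3) fun_eq_iff)
  qed
qed

lemma cell_wf: "(\<And>i. w i \<in> I) \<Longrightarrow> wf_cell (cell n w k)"
proof (induction n arbitrary: k)
  case 0
  obtain u :: 'v where "norm u = 1" using vector_choose_size[of 1] by (metis zero_le_one)
  then show ?case
    by (auto simp: wf_cell_def cell_type_def intro!: exI[of _ u] exI[of _ 1])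
next
  case (Suc n)
  then show ?case using b_ge by (auto intro: wf_child)
qed

lemma cell_follows: "(\<And>i. w i \<in> I) \<Longrightarrow> follows (cell n w k) (cell n w (Suc k))"
proof (induction n arbitrary: k)
  case 0
  then show ?case by (simp add: follows_def fun_eq_iff)
next
  case (Suc n)
  show ?case
  proof (cases "Suc (k mod b) = b")
    case True
    then have "Suc k div b = Suc (k div b)" "Suc k mod b = 0" "k mod b = b - 1"
      by (auto simp: div_Suc mod_Suc)
    then show ?thesis using Suc cell_wf follows_child_next by auto
  next
    case False
    then have "Suc k div b = k div b" "Suc k mod b = Suc (k mod b)"
      by (auto simp: div_Suc mod_Suc)
    moreover have "Suc (k mod b) < b" using False b_ge by (simp add: Suc_lessI)
    ultimately show ?thesis using Suc cell_wf follows_child by auto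
  qed
qed

lemma cell_cong: "(\<And>i. i < n \<Longrightarrow> w i = w' i) \<Longrightarrow> cell n w k = cell n w' k"
  by (induction n arbitrary: k) auto

end

section \<open>The limit map\<close>

lemma inner_ge_near_unit:
  fixes u q :: "'a::real_inner"
  assumes "norm u = 1" "norm q = 1" "norm (u - q) \<le> 1 / 5"
  shows "9 / 10 \<le> u \<bullet> q"
proof -
  have "u \<bullet> u = 1" "q \<bullet> q = 1" using assms by (auto simp: norm_eq_1)
  moreover have "(norm (u - q))\<^sup>2 \<le> (1 / 5)\<^sup>2" using assms(3) by (intro power_mono) auto
  ultimately show ?thesis
    by (simp add: power2_norm_eq_inner inner_diff_left inner_diff_right inner_commute power_divide)
qed

context cascade
begin

definition idx :: "real \<Rightarrow> nat \<Rightarrow> nat" where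
  "idx t n = nat \<lfloor>real b ^ n * t\<rfloor>"

lemma idx_Suc:
  assumes "0 \<le> t"
  shows "idx t (Suc n) div b = idx t n"
proof -
  have "\<lfloor>real b ^ n * t\<rfloor> = \<lfloor>real b ^ Suc n * t / real_of_int (int b)\<rfloor>"
    using b_ge by simp
  also have "\<dots> = \<lfloor>real b ^ Suc n * t\<rfloor> div int b"
    by (rule floor_divide_real_eq_div) simp
  finally show ?thesis
    using assms by (simp add: idx_def nat_div_distrib)
qed

abbreviation cell_at :: "(nat \<Rightarrow> 'v) \<Rightarrow> real \<Rightarrow> nat \<Rightarrow> 'v cell" where
  "cell_at w t n \<equiv> cell n w (idx t n)"

lemma cell_at_Suc: "0 \<le> t \<Longrightarrow> cell_at w t (Suc n) = child (cell_at w t n) (w n) (idx t (Suc n) mod b)"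
  by (simp add: idx_Suc cell.simps(2))

definition point :: "(nat \<Rightarrow> 'v) \<Rightarrow> real \<Rightarrow> real \<times> 'v" where
  "point w t = lim (\<lambda>n. cpos (cell_at w t n))"

declare cell.simps(2) [simp del]

context
  fixes w :: "nat \<Rightarrow> 'v"
  assumes w: "\<And>i. w i \<in> I"
begin

lemma cell_size_pos: "0 < csiz (cell n w k)"
  using cell_wf[OF w] by (auto simp: wf_cell_def)

lemma cell_size_step:
  assumes "0 \<le> t"
  shows "csiz (cell_at w t n) * (\<sigma> / 2 ^ Suc D) \<le> csiz (cell_at w t (Suc n))"
    "csiz (cell_at w t (Suc n)) \<le> csiz (cell_at w t n) * \<sigma>"
  unfolding cell_at_Suc[OF assms] using b_ge
  by (intro child_size cell_wf w mod_less_divisor; simp)+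

lemma cell_size_le: "0 \<le> t \<Longrightarrow> csiz (cell_at w t n) \<le> \<sigma> ^ n"
proof (induction n)
  case (Suc n)
  have "csiz (cell_at w t (Suc n)) \<le> csiz (cell_at w t n) * \<sigma>"
    by (rule cell_size_step(2)[OF Suc.prems])
  also have "\<dots> \<le> \<sigma> ^ n * \<sigma>" using Suc \<sigma>_pos by (intro mult_right_mono) auto
  finally show ?case by (simp add: mult.commute)
qed simp

lemma pos_step:
  assumes "0 \<le> t"
  shows "\<exists>f\<in>{0..1}. norm (cpos (cell_at w t (Suc n)) - (cpos (cell_at w t n) + csiz (cell_at w t n) *\<^sub>R
      crot (cell_at w t n) (cell_path (cell_at w t n) (w n) f)))
     \<le> csiz (cell_at w t n) * (8 * \<sigma>)"
  unfolding cell_at_Suc[OF assms] using b_ge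
  by (intro child_pos cell_wf w mod_less_divisor) simp

lemma pos_step_le:
  assumes t: "0 \<le> t"
  shows "norm (cpos (cell_at w t (Suc n)) - cpos (cell_at w t n)) \<le> 11 / 10 * csiz (cell_at w t n)"
proof -
  let ?c = "cell_at w t n"
  have wf: "wf_cell ?c" by (rule cell_wf[OF w])
  obtain f where f: "f \<in> {0..1}" and *: "norm (cpos (cell_at w t (Suc n)) - (cpos ?c + csiz ?c *\<^sub>R
      crot ?c (cell_path ?c (w n) f))) \<le> csiz ?c * (8 * \<sigma>)"
    using pos_step[OF t] by blast
  let ?r = "cell_path ?c (w n) f"
  have "norm (?r - f *\<^sub>R e1) \<le> 1 / 100"
    using wf f I_small[OF w] by (intro row_path_near_axis) (auto simp: wf_cell_def)
  then have "norm ?r \<le> 101 / 100"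
    using norm_triangle_sub[of ?r "f *\<^sub>R e1"] f by simp
  then have "norm (csiz ?c *\<^sub>R crot ?c ?r) \<le> csiz ?c * (101 / 100)"
    using wf by (auto simp: wf_cell_def orthogonal_transformation_norm)
  moreover have "csiz ?c * (8 * \<sigma>) \<le> csiz ?c * (8 / 2000)"
    using cell_size_pos[of n "idx t n"] \<sigma>_small by (intro mult_left_mono) auto
  moreover have "norm (cpos (cell_at w t (Suc n)) - cpos ?c)
      \<le> norm (cpos (cell_at w t (Suc n)) - (cpos ?c + csiz ?c *\<^sub>R crot ?c ?r)) + norm (csiz ?c *\<^sub>R crot ?c ?r)"
    using norm_triangle_ineq[of "cpos (cell_at w t (Suc n)) - (cpos ?c + csiz ?c *\<^sub>R crot ?c ?r)" "csiz ?c *\<^sub>R crot ?c ?r"]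
    by (simp only: diff_diff_eq[symmetric] diff_add_cancel)
  ultimately show ?thesis
    using * cell_size_pos[of n "idx t n"] by linarith
qed

text \<open>Sizes shrink by a factor of at most \<open>1 / 2000\<close> per generation, so
  everything after the first step adds less than a tenth of the size.\<close>

lemma pos_dist_le:
  assumes t: "0 \<le> t"
  shows "norm (cpos (cell_at w t (n + m)) - cpos (cell_at w t n)) \<le> 12 / 10 * csiz (cell_at w t n)"
proof (induction m arbitrary: n)
  case 0
  then show ?case using cell_size_pos[of n "idx t n"] by simp
next
  case (Suc m)
  have "norm (cpos (cell_at w t (n + Suc m)) - cpos (cell_at w t n))
    \<le> norm (cpos (cell_at w t (Suc n + m)) - cpos (cell_at w t (Suc n))) + norm (cpos (cell_at w t (Suc n)) - cpos (cell_at w t n))"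
    using norm_triangle_ineq[of "cpos (cell_at w t (Suc n + m)) - cpos (cell_at w t (Suc n))"
      "cpos (cell_at w t (Suc n)) - cpos (cell_at w t n)"] by (simp del: cell.simps)
  also have "\<dots> \<le> 12 / 10 * csiz (cell_at w t (Suc n)) + 11 / 10 * csiz (cell_at w t n)"
    by (intro add_mono Suc pos_step_le t)
  also have "csiz (cell_at w t (Suc n)) \<le> csiz (cell_at w t n) * (1 / 2000)"
    using cell_size_step(2)[OF t, of n] \<sigma>_small cell_size_pos[of n "idx t n"]
      mult_left_mono[of \<sigma> "1 / 2000" "csiz (cell_at w t n)"] by linarith
  finally show ?case using cell_size_pos[of n "idx t n"] by (simp del: cell.simps)
qed

lemma pos_tendsto:
  assumes t: "0 \<le> t"
  shows "(\<lambda>n. cpos (cell_at w t n)) \<longlonglongrightarrow> point w t"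
proof -
  have "Cauchy (\<lambda>n. cpos (cell_at w t n))"
  proof (rule CauchyI)
    fix e :: real assume e: "0 < e"
    obtain N where N: "\<sigma> ^ N < e / 4"
      using real_arch_pow_inv[of "e / 4" \<sigma>] e \<sigma>_small by auto
    have *: "norm (cpos (cell_at w t m) - cpos (cell_at w t N)) < e / 2" if "N \<le> m" for m
      using pos_dist_le[OF t, of N "m - N"] that cell_size_le[OF t, of N] N e by simp
    have "norm (cpos (cell_at w t m) - cpos (cell_at w t n)) < e" if "N \<le> m" "N \<le> n" for m n
      using *[of m] *[of n] that
        norm_triangle_ineq4[of "cpos (cell_at w t m) - cpos (cell_at w t N)" "cpos (cell_at w t n) - cpos (cell_at w t N)"]
      by simp
    then show "\<exists>M. \<forall>m\<ge>M. \<forall>n\<ge>M. norm (cpos (cell_at w t m) - cpos (cell_at w t n)) < e" by blast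
  qed
  then show ?thesis
    unfolding point_def by (simp add: Cauchy_convergent_iff convergent_LIMSEQ_iff)
qed

lemma point_near:
  assumes t: "0 \<le> t"
  shows "norm (point w t - cpos (cell_at w t n)) \<le> 12 / 10 * csiz (cell_at w t n)"
proof (rule tendsto_upperbound)
  show "(\<lambda>m. norm (cpos (cell_at w t m) - cpos (cell_at w t n))) \<longlonglongrightarrow> norm (point w t - cpos (cell_at w t n))"
    by (intro tendsto_intros pos_tendsto t)
  show "\<forall>\<^sub>F m in sequentially. norm (cpos (cell_at w t m) - cpos (cell_at w t n)) \<le> 12 / 10 * csiz (cell_at w t n)"
    unfolding eventually_sequentially
    by (rule exI[of _ n]) (metis pos_dist_le[OF t] le_add_diff_inverse)
qed simp

text \<open>The error \<open>10 * \<sigma>\<close> covers \<open>8 * \<sigma>\<close> for the start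
  of the child cell and \<open>12 / 10 * \<sigma>\<close> for the descent inside it.\<close>

lemma point_local:
  assumes t: "0 \<le> t" and c: "c = cell_at w t n"
  obtains f e where "f \<in> {0..1}" "norm e \<le> 10 * \<sigma>"
    "point w t = cpos c + csiz c *\<^sub>R crot c (cell_path c (w n) f + e)"
proof -
  have wf: "0 < csiz c" "orthogonal_transformation (crot c)"
    using cell_wf[OF w] by (auto simp: wf_cell_def c)
  obtain f where f: "f \<in> {0..1}" and *: "norm (cpos (cell_at w t (Suc n)) - (cpos c + csiz c *\<^sub>R
      crot c (cell_path c (w n) f))) \<le> csiz c * (8 * \<sigma>)"
    using pos_step[OF t] unfolding c by blast
  define x where "x = point w t - (cpos c + csiz c *\<^sub>R crot c (cell_path c (w n) f))"
  have "norm x \<le> norm (point w t - cpos (cell_at w t (Suc n))) + csiz c * (8 * \<sigma>)"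
    unfolding x_def using * norm_triangle_ineq[of "point w t - cpos (cell_at w t (Suc n))"
      "cpos (cell_at w t (Suc n)) - (cpos c + csiz c *\<^sub>R crot c (cell_path c (w n) f))"]
    by (simp add: algebra_simps del: cell.simps)
  also have "norm (point w t - cpos (cell_at w t (Suc n))) \<le> 12 / 10 * (csiz c * \<sigma>)"
    using point_near[OF t, of "Suc n"] cell_size_step(2)[OF t, of n] unfolding c by linarith
  finally have x: "norm x \<le> csiz c * (10 * \<sigma>)" using mult_pos_pos[OF wf(1) \<sigma>_pos] by (simp add: algebra_simps)
  obtain e where e: "crot c e = x /\<^sub>R csiz c"
    using orthogonal_transformation_surj[OF wf(2)] by (metis surj_def)
  have "norm e = norm x / csiz c"
    using arg_cong[OF e, of norm] wf by (simp add: orthogonal_transformation_norm divide_inverse_commute)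
  also have "\<dots> \<le> csiz c * (10 * \<sigma>) / csiz c" using x wf(1) by (intro divide_right_mono) auto
  finally have "norm e \<le> 10 * \<sigma>" using wf(1) by simp
  moreover have "x = csiz c *\<^sub>R crot c e" using e wf(1) by simp
  then have "point w t = cpos c + csiz c *\<^sub>R crot c (cell_path c (w n) f + e)"
    using wf(2) by (simp add: x_def linear_add orthogonal_transformation_linear scaleR_add_right algebra_simps)
  ultimately show thesis using f that by blast
qed

text \<open>This forgets the offset and keeps the closeness to the axis of the cell, which is enough
  for comparing positions along a row.\<close>

lemma point_coarse:
  assumes t: "0 \<le> t" and c: "c = cell_at w t n"
  obtains f e where "f \<in> {0..1}" "norm e \<le> 1 / 50"
    "point w t = cpos c + csiz c *\<^sub>R crot c (f *\<^sub>R e1 + e)"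
proof -
  obtain f e where f: "f \<in> {0..1}" and e: "norm e \<le> 10 * \<sigma>"
    and p: "point w t = cpos c + csiz c *\<^sub>R crot c (cell_path c (w n) f + e)"
    using point_local[OF t c] by blast
  let ?r = "cell_path c (w n) f"
  have "norm (?r - f *\<^sub>R e1) \<le> 1 / 100"
    using cell_wf[of w n "idx t n", OF w] f I_small[OF w] by (intro row_path_near_axis) (auto simp: wf_cell_def c)
  then have "norm (?r + e - f *\<^sub>R e1) \<le> 1 / 50"
    using norm_triangle_ineq[of "?r - f *\<^sub>R e1" e] e \<sigma>_small by (simp add: algebra_simps)
  then show thesis using p f by (intro that[of f "?r + e - f *\<^sub>R e1"]) auto
qed

end

text \<open>In the frame of the first cell the model paths are \<open>\<gamma> / 4\<close> apart.
  The deviations sum to at most \<open>30 * \<sigma>\<close>, namely \<open>10 * \<sigma>\<close> in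
  the first cell and twice that in a successor of up to double size. As
  \<open>\<sigma> \<le> \<gamma> / 1000\<close>, half of the distance survives.\<close>

lemma sep_rows:
  assumes w: "\<And>i. w i \<in> I" "\<And>i. w' i \<in> I" and agree: "\<And>i. i < n \<Longrightarrow> w i = w' i"
    and t: "0 \<le> t" "0 \<le> t'" and k: "idx t' n = idx t n \<or> idx t' n = Suc (idx t n)"
    and ne: "w n \<noteq> w' n"
  shows "\<gamma> / 8 * csiz (cell_at w t n) \<le> norm (point w' t' - point w t)"
proof -
  define c where "c = cell_at w t n"
  define c' where "c' = cell_at w' t' n"
  have c'_eq: "c' = cell n w (idx t' n)" unfolding c'_def by (rule cell_cong) (simp add: agree)
  have wfs: "wf_cell c" "wf_cell c'" using cell_wf[OF w(1)] cell_wf[OF w(2)] by (auto simp: c_def c'_def)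
  have ct: "cell_type (cal c) (com c) (clin c)" "cell_type (cal c') (com c') (clin c')"
    and R: "orthogonal_transformation (crot c)" "orthogonal_transformation (crot c')" and h: "0 < csiz c"
    using wfs by (auto simp: wf_cell_def)
  have lin: "linear (crot c)" using R(1) by (rule orthogonal_transformation_linear)
  obtain f e where f: "f \<in> {0..1}" and e: "norm e \<le> 10 * \<sigma>"
    and p: "point w t = cpos c + csiz c *\<^sub>R crot c (cell_path c (w n) f + e)"
    using point_local[OF w(1) t(1) c_def] by blast
  obtain f' e' where f': "f' \<in> {0..1}" and e': "norm e' \<le> 10 * \<sigma>"
    and p': "point w' t' = cpos c' + csiz c' *\<^sub>R crot c' (cell_path c' (w' n) f' + e')"
    using point_local[OF w(2) t(2) c'_def] by blast
  let ?r = "cell_path c (w n) f"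
  let ?r' = "cell_path c' (w' n) f'"
  have \<gamma>: "\<gamma> \<le> norm (w' n - w n)" using I_sep[OF w(1) w(2) ne] by (simp add: norm_minus_commute)
  have "\<exists>x y. point w' t' - point w t = csiz c *\<^sub>R crot c (x + y) \<and> \<gamma> / 4 \<le> norm x \<and> norm y \<le> 30 * \<sigma>"
  proof (cases "idx t' n = idx t n")
    case True
    then have eq: "c' = c" by (simp add: c'_eq c_def)
    have "point w' t' - point w t = csiz c *\<^sub>R crot c ((?r' - ?r) + (e' - e))"
      unfolding p p' eq by (simp add: linear_add[OF lin] linear_diff[OF lin] algebra_simps)
    moreover have "\<gamma> / 4 \<le> norm (?r' - ?r)"
    proof -
      have "norm (w' n - w n) / 4 \<le> norm (?r' - ?r)"
        unfolding eq by (rule row_path_sep[OF ct(1) I_small[OF w(1)] f' f])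
      then show ?thesis using \<gamma> by simp
    qed
    moreover have "norm (e' - e) \<le> 30 * \<sigma>"
      using norm_triangle_ineq4[of e' e] e e' \<sigma>_pos by linarith
    ultimately show ?thesis by blast
  next
    case False
    then have fol: "follows c c'" using k cell_follows[OF w(1)] by (auto simp: c_def c'_eq)
    then have F: "cpos c' = cpos c + csiz c *\<^sub>R crot c e1" "csiz c' * cal c' = csiz c * com c" "crot c' = crot c \<circ> clin c"
      by (auto simp: follows_def)
    define \<kappa> where "\<kappa> = csiz c' / csiz c"
    have \<kappa>: "csiz c' = csiz c * \<kappa>" "\<kappa> * cal c' = com c" "0 \<le> \<kappa>" "\<kappa> \<le> 2"
      using F(2) h follows_size[OF fol wfs] wfs(2) by (auto simp: \<kappa>_def field_simps wf_cell_def)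
    have linL: "linear (clin c)" using cell_typeD(1)[OF ct(1)] by (rule orthogonal_transformation_linear)
    have "csiz c' *\<^sub>R crot c' (?r' + e') = csiz c *\<^sub>R crot c (\<kappa> *\<^sub>R clin c ?r' + \<kappa> *\<^sub>R clin c e')"
      by (simp add: \<kappa>(1) F(3) linear_add[OF lin] linear_add[OF linL] linear_scale[OF lin] scaleR_add_right)
    then have "point w' t' - point w t = csiz c *\<^sub>R crot c ((e1 + \<kappa> *\<^sub>R clin c ?r' - ?r) + (\<kappa> *\<^sub>R clin c e' - e))"
      unfolding p p' F(1) by (simp add: linear_add[OF lin] linear_diff[OF lin] algebra_simps)
    moreover have "\<gamma> / 4 \<le> norm (e1 + \<kappa> *\<^sub>R clin c ?r' - ?r)"
    proof -
      have "norm (w' n - w n) / 4 \<le> norm (e1 + \<kappa> *\<^sub>R clin c ?r' - ?r)"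
        by (rule row_path_sep_next[OF ct I_small[OF w(1)] I_small[OF w(2)] f f' \<kappa>(2)])
      then show ?thesis using \<gamma> by simp
    qed
    moreover have "norm (\<kappa> *\<^sub>R clin c e' - e) \<le> 30 * \<sigma>"
    proof -
      have "norm (\<kappa> *\<^sub>R clin c e') = \<kappa> * norm e'"
        using \<kappa>(3) by (simp add: orthogonal_transformation_norm[OF cell_typeD(1)[OF ct(1)]])
      also have "\<dots> \<le> 2 * (10 * \<sigma>)" using \<kappa> e' by (intro mult_mono) auto
      finally show ?thesis using norm_triangle_ineq4[of "\<kappa> *\<^sub>R clin c e'" e] e by linarith
    qed
    ultimately show ?thesis by blast
  qed
  then obtain x y where xy: "point w' t' - point w t = csiz c *\<^sub>R crot c (x + y)" "\<gamma> / 4 \<le> norm x" "norm y \<le> 30 * \<sigma>"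
    by blast
  have "\<gamma> / 8 \<le> norm (x + y)"
    using norm_triangle_ineq4[of "x + y" y] xy(2,3) \<sigma>_small \<sigma>_pos by simp
  then have "csiz c * (\<gamma> / 8) \<le> csiz c * norm (x + y)" using h by (intro mult_left_mono) auto
  also have "\<dots> = norm (point w' t' - point w t)"
    unfolding xy(1) using h by (simp add: orthogonal_transformation_norm[OF R(1)])
  finally show ?thesis by (simp add: c_def mult.commute)
qed

text \<open>Everything is projected to the direction \<open>q\<close> of the parent cell. The cells
  in between point within \<open>1 / 5\<close> of \<open>q\<close>, a tenth for a child against its
  parent and a tenth for the following parent, so each advances by \<open>9 / 10\<close> of its
  size; angles of earlier generations do not enter. An index gap of 2 leaves a whole cell in
  between, and it outweighs the errors \<open>1 / 50\<close> at both ends because consecutive cells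
  differ in size by a factor of at most 2.\<close>

lemma sep_times:
  assumes w: "\<And>i. w i \<in> I" "\<And>i. w' i \<in> I" and agree: "\<And>i. i \<le> n \<Longrightarrow> w i = w' i"
    and t: "0 \<le> t" "0 \<le> t'" and k: "idx t' n \<le> Suc (idx t n)"
    and far: "idx t (Suc n) + 2 \<le> idx t' (Suc n)"
  shows "\<sigma> / 2 ^ (D + 3) * csiz (cell_at w t n) \<le> norm (point w' t' - point w t)"
proof -
  define k where "k = idx t (Suc n)"
  define k' where "k' = idx t' (Suc n)"
  define C where "C l = cell (Suc n) w l" for l
  define P where "P = cell_at w t n"
  define q where "q = crot P e1"
  have kd: "k div b = idx t n" "k' div b = idx t' n" unfolding k_def k'_def using idx_Suc t by auto
  have C: "C k = cell_at w t (Suc n)" "C k' = cell_at w' t' (Suc n)"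
    unfolding C_def k_def k'_def by (simp, rule cell_cong) (simp add: agree)
  have wfC: "wf_cell (C l)" for l unfolding C_def by (rule cell_wf[OF w(1)])
  have fol: "follows (C l) (C (Suc l))" for l unfolding C_def by (rule cell_follows[OF w(1)])
  have h: "0 < csiz (C l)" and R: "orthogonal_transformation (crot (C l))" for l
    using wfC by (auto simp: wf_cell_def)
  have wfP: "wf_cell P" unfolding P_def by (rule cell_wf[OF w(1)])
  then have RP: "orthogonal_transformation (crot P)" by (simp add: wf_cell_def)
  have q: "norm q = 1" by (simp add: q_def orthogonal_transformation_norm[OF RP] norm_Pair)
  have dir: "9 / 10 \<le> crot (C l) e1 \<bullet> q" if "k \<le> l" "l \<le> k'" for l
  proof (rule inner_ge_near_unit[OF _ q])
    show "norm (crot (C l) e1) = 1" by (simp add: orthogonal_transformation_norm[OF R] norm_Pair)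
    have "l div b = idx t n \<or> l div b = Suc (idx t n)"
      using div_le_mono[OF that(1), of b] div_le_mono[OF that(2), of b] kd \<open>idx t' n \<le> Suc (idx t n)\<close> by linarith
    moreover have "norm (crot (C l) e1 - crot (cell n w (l div b)) e1) \<le> norm (e1 :: real \<times> 'v) / 10"
      unfolding C_def cell.simps using b_ge by (intro child_rot cell_wf w) simp
    moreover have "norm (crot (cell n w (Suc (idx t n))) e1 - q) \<le> norm (e1 :: real \<times> 'v) / 10"
    proof -
      have "crot (cell n w (Suc (idx t n))) = crot P \<circ> clin P"
        using cell_follows[of w n "idx t n", OF w(1)] by (simp add: follows_def P_def)
      then have "crot (cell n w (Suc (idx t n))) e1 - q = crot P (clin P e1 - e1)"
        by (simp add: q_def linear_diff[OF orthogonal_transformation_linear[OF RP]])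
      moreover have "norm (clin P e1 - e1) \<le> norm (e1 :: real \<times> 'v) / 10"
        using wfP by (intro cell_typeD(2)[of "cal P" "com P"]) (simp add: wf_cell_def)
      ultimately show ?thesis by (simp add: orthogonal_transformation_norm[OF RP])
    qed
    moreover have "crot (cell n w (idx t n)) e1 = q" by (simp add: q_def P_def)
    moreover have "norm (e1 :: real \<times> 'v) = 1" by (simp add: norm_Pair)
    ultimately show "norm (crot (C l) e1 - q) \<le> 1 / 5"
      using norm_triangle_ineq[of "crot (C l) e1 - crot (cell n w (l div b)) e1" "crot (cell n w (l div b)) e1 - q"]
      by auto
  qed
  have Rq: "\<bar>crot (C l) e \<bullet> q\<bar> \<le> norm e" for l e
    using Cauchy_Schwarz_ineq2[of "crot (C l) e" q] by (simp add: q orthogonal_transformation_norm[OF R])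
  have linC: "linear (crot (C l))" for l using R by (rule orthogonal_transformation_linear)
  have Rf: "crot (C l) (f *\<^sub>R e1 + e) = f *\<^sub>R crot (C l) e1 + crot (C l) e" for l f e
    by (simp only: linear_add[OF linC] linear_scale[OF linC])
  define \<Sigma> where "\<Sigma> l = (\<Sum>i\<in>{Suc k..<l}. csiz (C i))" for l
  have prog: "9 / 10 * \<Sigma> l \<le> (cpos (C l) - cpos (C (Suc k))) \<bullet> q" if "Suc k \<le> l" "l \<le> k'" for l
    using that
  proof (induction l rule: dec_induct)
    case base
    then show ?case by (simp add: \<Sigma>_def)
  next
    case (step l)
    have "cpos (C (Suc l)) = cpos (C l) + csiz (C l) *\<^sub>R crot (C l) e1"
      using fol[of l] by (simp add: follows_def)
    then have "(cpos (C (Suc l)) - cpos (C (Suc k))) \<bullet> q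
      = (cpos (C l) - cpos (C (Suc k))) \<bullet> q + csiz (C l) * (crot (C l) e1 \<bullet> q)"
      by (simp add: algebra_simps)
    moreover have "csiz (C l) * (9 / 10) \<le> csiz (C l) * (crot (C l) e1 \<bullet> q)"
      using step h[of l] by (intro mult_left_mono dir) auto
    moreover have "\<Sigma> (Suc l) = \<Sigma> l + csiz (C l)" using step by (simp add: \<Sigma>_def)
    ultimately show ?case using step by simp
  qed
  obtain f e where f: "f \<in> {0..1}" and e: "norm e \<le> 1 / 50"
    and p: "point w t = cpos (C k) + csiz (C k) *\<^sub>R crot (C k) (f *\<^sub>R e1 + e)"
    using point_coarse[OF w(1) t(1) C(1)] by blast
  obtain f' e' where f': "f' \<in> {0..1}" and e': "norm e' \<le> 1 / 50"
    and p': "point w' t' = cpos (C k') + csiz (C k') *\<^sub>R crot (C k') (f' *\<^sub>R e1 + e')"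
    using point_coarse[OF w(2) t(2) C(2)] by blast
  have kk: "k + 2 \<le> k'" using far by (simp add: k_def k'_def)
  have "cpos (C (Suc k)) = cpos (C k) + csiz (C k) *\<^sub>R crot (C k) e1"
    using fol[of k] by (simp add: follows_def)
  then have "(cpos (C (Suc k)) - point w t) \<bullet> q
      = csiz (C k) * ((1 - f) * (crot (C k) e1 \<bullet> q) - crot (C k) e \<bullet> q)"
    unfolding p Rf by (simp add: algebra_simps)
  moreover have "0 \<le> (1 - f) * (crot (C k) e1 \<bullet> q)" using f dir[of k] kk by (intro mult_nonneg_nonneg) auto
  then have "csiz (C k) * (- 1 / 50) \<le> csiz (C k) * ((1 - f) * (crot (C k) e1 \<bullet> q) - crot (C k) e \<bullet> q)"
    using Rq[of k e] e h[of k] by (intro mult_left_mono) auto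
  ultimately have 1: "csiz (C k) * (- 1 / 50) \<le> (cpos (C (Suc k)) - point w t) \<bullet> q" by simp
  have "(point w' t' - cpos (C k')) \<bullet> q = csiz (C k') * (f' * (crot (C k') e1 \<bullet> q) + crot (C k') e' \<bullet> q)"
    unfolding p' Rf by (simp add: algebra_simps)
  moreover have "0 \<le> f' * (crot (C k') e1 \<bullet> q)" using f' dir[of k'] kk by (intro mult_nonneg_nonneg) auto
  then have "csiz (C k') * (- 1 / 50) \<le> csiz (C k') * (f' * (crot (C k') e1 \<bullet> q) + crot (C k') e' \<bullet> q)"
    using Rq[of k' e'] e' h[of k'] by (intro mult_left_mono) auto
  ultimately have 2: "csiz (C k') * (- 1 / 50) \<le> (point w' t' - cpos (C k')) \<bullet> q" by simp
  have s1: "csiz (C (Suc k)) \<le> \<Sigma> k'" "csiz (C (k' - 1)) \<le> \<Sigma> k'"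
    unfolding \<Sigma>_def using kk h by (auto intro!: member_le_sum simp: less_imp_le)
  have s2: "csiz (C k) \<le> 2 * csiz (C (Suc k))" using follows_size(1)[OF fol wfC wfC] .
  have s3: "csiz (C k') \<le> 2 * csiz (C (k' - 1))"
    using follows_size(2)[OF fol[of "k' - 1"] wfC wfC] kk by simp
  have "(point w' t' - point w t) \<bullet> q = (point w' t' - cpos (C k')) \<bullet> q
     + (cpos (C k') - cpos (C (Suc k))) \<bullet> q + (cpos (C (Suc k)) - point w t) \<bullet> q"
    by (simp add: inner_diff_left)
  also have "\<dots> \<ge> csiz (C k) / 4"
    using 1 2 prog[of k'] kk s1 s2 s3 h[of k] h[of "Suc k"] by simp
  finally have 3: "csiz (C k) / 4 \<le> (point w' t' - point w t) \<bullet> q" .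
  have 4: "(point w' t' - point w t) \<bullet> q \<le> norm (point w' t' - point w t)"
    using norm_cauchy_schwarz[of "point w' t' - point w t" q] q by simp
  have 5: "csiz P * (\<sigma> / 2 ^ Suc D) \<le> csiz (C k)"
    using cell_size_step(1)[of w t n, OF w(1) t(1)] unfolding C P_def by simp
  have "\<sigma> / 2 ^ (D + 3) * csiz P = csiz P * (\<sigma> / 2 ^ Suc D) / 4"
    by (simp add: power_add mult.commute)
  also have "\<dots> \<le> csiz (C k) / 4" using 5 by (rule divide_right_mono) simp
  also have "\<dots> \<le> norm (point w' t' - point w t)" using 3 4 by linarith
  finally show ?thesis unfolding P_def .
qed

text \<open>Half of the constants of \<open>sep_rows\<close> and \<open>sep_times\<close>: these
  treat one order of the two points, and exchanging the points changes the reference size by a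
  factor of at most 2.\<close>

definition sep_const :: real where
  "sep_const = min (\<gamma> / 16) (\<sigma> / 2 ^ (D + 4))"

lemma sep_const_pos: "0 < sep_const"
  using \<sigma>_pos \<sigma>_small by (simp add: sep_const_def)

text \<open>Two points are compared at a level where they still lie in equal or adjacent cells of
  the same rows. The constant 6 covers \<open>12 / 10\<close> for the first point, 2 between the
  cells and \<open>24 / 10\<close> for the second point.\<close>

lemma point_dist_bounds:
  assumes w: "\<And>i. w i \<in> I" "\<And>i. w' i \<in> I" and agree: "\<And>i. i < n \<Longrightarrow> w i = w' i"
    and t: "0 \<le> t" "0 \<le> t'" and near: "idx t' n \<le> Suc (idx t n)" "idx t n \<le> Suc (idx t' n)"
  shows "norm (point w t - point w' t') \<le> 6 * csiz (cell_at w t n)"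
    and "w n \<noteq> w' n \<or> idx t (Suc n) + 2 \<le> idx t' (Suc n) \<or> idx t' (Suc n) + 2 \<le> idx t (Suc n) \<Longrightarrow>
      sep_const * csiz (cell_at w t n) \<le> norm (point w t - point w' t')"
proof -
  have agree': "w' i = w i" if "i < n" for i using agree[OF that] by simp
  have eq: "cell_at w' t' n = cell n w (idx t' n)" by (rule cell_cong) (simp add: agree)
  let ?h = "csiz (cell_at w t n)" and ?h' = "csiz (cell_at w' t' n)"
  have h: "0 < ?h" "0 < ?h'" using cell_size_pos w by auto
  consider "idx t' n = idx t n" | "idx t' n = Suc (idx t n)" | "idx t n = Suc (idx t' n)"
    using near by linarith
  note cs = this
  have "?h \<le> 2 * ?h' \<and> ?h' \<le> 2 * ?h \<and> norm (cpos (cell_at w t n) - cpos (cell_at w' t' n)) \<le> 2 * ?h"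
  proof -
    have *: "csiz c \<le> 2 * csiz c' \<and> csiz c' \<le> 2 * csiz c \<and> norm (cpos c' - cpos c) = csiz c"
      if "wf_cell c" "wf_cell c'" "follows c c'" for c c' :: "'v cell"
      using follows_size[OF that(3,1,2)] that
      by (auto simp: follows_def wf_cell_def orthogonal_transformation_norm norm_Pair)
    show ?thesis
      using cs
    proof cases
      case 1
      then have "cell_at w' t' n = cell_at w t n" using eq by metis
      then show ?thesis using h by simp
    next
      case 2
      then have "cell_at w' t' n = cell n w (Suc (idx t n))" using eq by metis
      then show ?thesis using *[OF cell_wf[OF w(1)] cell_wf[OF w(1)] cell_follows[of w n "idx t n", OF w(1)]] h
        by (simp add: norm_minus_commute)
    next
      case 3
      then show ?thesis using *[OF cell_wf[OF w(1)] cell_wf[OF w(1)] cell_follows[of w n "idx t' n", OF w(1)]] h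
        by (simp add: eq)
    qed
  qed
  then have hh: "?h \<le> 2 * ?h'" "?h' \<le> 2 * ?h" and pp: "norm (cpos (cell_at w t n) - cpos (cell_at w' t' n)) \<le> 2 * ?h"
    by auto
  have "norm (point w t - point w' t') \<le> norm (point w t - cpos (cell_at w t n))
      + norm (cpos (cell_at w t n) - cpos (cell_at w' t' n)) + norm (cpos (cell_at w' t' n) - point w' t')"
    using norm_triangle_ineq[of "point w t - cpos (cell_at w t n)" "cpos (cell_at w t n) - point w' t'"]
      norm_triangle_ineq[of "cpos (cell_at w t n) - cpos (cell_at w' t' n)" "cpos (cell_at w' t' n) - point w' t'"]
    by simp
  then show "norm (point w t - point w' t') \<le> 6 * ?h"
    using point_near[of w t n, OF w(1) t(1)] point_near[of w' t' n, OF w(2) t(2)] hh pp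
    by (simp add: norm_minus_commute)
  have sc: "sep_const \<le> \<gamma> / 16" "sep_const \<le> \<sigma> / 2 ^ (D + 3) / 2"
    by (auto simp: sep_const_def power_add min.coboundedI2)
  assume sep: "w n \<noteq> w' n \<or> idx t (Suc n) + 2 \<le> idx t' (Suc n) \<or> idx t' (Suc n) + 2 \<le> idx t (Suc n)"
  have low: "sep_const * ?h \<le> x" if "c * ?h \<le> x \<or> c * ?h' \<le> x" "sep_const \<le> c / 2" for x c
  proof -
    have c: "0 \<le> c" using that(2) sep_const_pos by linarith
    have "sep_const * ?h \<le> c / 2 * ?h" using that(2) h by (intro mult_right_mono) auto
    moreover have "c * ?h \<le> c * (2 * ?h')" using c hh by (intro mult_left_mono) auto
    moreover have "0 \<le> c * ?h" using c h by simp
    ultimately show ?thesis using that(1) by auto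
  qed
  show "sep_const * ?h \<le> norm (point w t - point w' t')"
  proof (cases "w n = w' n")
    case False
    have 1: "\<gamma> / 8 * ?h \<le> norm (point w' t' - point w t)" if "idx t' n = idx t n \<or> idx t' n = Suc (idx t n)"
      by (rule sep_rows) (use w agree t that False in auto)
    have 2: "\<gamma> / 8 * ?h' \<le> norm (point w t - point w' t')" if "idx t n = idx t' n \<or> idx t n = Suc (idx t' n)"
      by (rule sep_rows) (use w agree' t that False in auto)
    have "\<gamma> / 8 * ?h \<le> norm (point w t - point w' t') \<or> \<gamma> / 8 * ?h' \<le> norm (point w t - point w' t')"
      using cs 1 2 by cases (auto simp: norm_minus_commute)
    then show ?thesis by (rule low) (use sc in simp)
  next
    case True
    then have ae: "w i = w' i" if "i \<le> n" for i using agree that by (cases "i = n") auto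
    have 1: "\<sigma> / 2 ^ (D + 3) * ?h \<le> norm (point w' t' - point w t)" if "idx t (Suc n) + 2 \<le> idx t' (Suc n)"
      by (rule sep_times) (use w ae t near that in auto)
    have 2: "\<sigma> / 2 ^ (D + 3) * ?h' \<le> norm (point w t - point w' t')" if "idx t' (Suc n) + 2 \<le> idx t (Suc n)"
      by (rule sep_times) (use w ae t near that in auto)
    have "\<sigma> / 2 ^ (D + 3) * ?h \<le> norm (point w t - point w' t') \<or> \<sigma> / 2 ^ (D + 3) * ?h' \<le> norm (point w t - point w' t')"
      using sep True 1 2 by (auto simp: norm_minus_commute)
    then show ?thesis by (rule low) (use sc in simp)
  qed
qed

end

section \<open>Quasisymmetry from sizes\<close>

lemma mtopology_dist_eq: "Metric_space.mtopology X dist = top_of_set X"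
  using Submetric.mtopology_submetric[of UNIV dist X]
  by (simp add: Submetric_def Submetric_axioms_def Met_TC.Metric_space_axioms)

lemma homeomorphism_imp_homeomorphic_map:
  assumes "homeomorphism S T f g"
  shows "homeomorphic_map (top_of_set S) (top_of_set T) f"
proof -
  have "homeomorphic_maps (top_of_set S) (top_of_set T) f g"
    using assms by (auto simp: homeomorphic_maps_def homeomorphism_def)
  then show ?thesis by (rule homeomorphic_maps_imp_map)
qed

text \<open>A maximum of two increasing bijections of the half-line is again one, and its inverse is
  the minimum of the inverses. The two exponents serve ratios below and above 1.\<close>

lemma homeomorphism_max_powr:
  fixes \<alpha> \<beta> K C :: real
  assumes pos: "0 < \<alpha>" "0 < \<beta>" "0 < K" "0 < C"
  shows "homeomorphism {0..} {0..} (\<lambda>x. K * max ((C * x) powr \<alpha>) ((C * x) powr \<beta>))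
    (\<lambda>y. min ((y / K) powr (1 / \<alpha>)) ((y / K) powr (1 / \<beta>)) / C)"
proof
  show "continuous_on {0..} (\<lambda>x. K * max ((C * x) powr \<alpha>) ((C * x) powr \<beta>))"
    using pos by (intro continuous_intros continuous_on_powr') auto
  show "continuous_on {0..} (\<lambda>y. min ((y / K) powr (1 / \<alpha>)) ((y / K) powr (1 / \<beta>)) / C)"
    using pos by (intro continuous_intros continuous_on_powr') auto
  show "(\<lambda>x. K * max ((C * x) powr \<alpha>) ((C * x) powr \<beta>)) ` {0..} \<subseteq> {0..}"
    using pos by (auto simp: le_max_iff_disj)
  show "(\<lambda>y. min ((y / K) powr (1 / \<alpha>)) ((y / K) powr (1 / \<beta>)) / C) ` {0..} \<subseteq> {0..}"
    using pos by auto
  have inv: "(u powr p) powr (1 / p) = u" "(u powr (1 / p)) powr p = u" if "0 \<le> u" "0 < p" for u p :: real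
    using that by (simp_all add: powr_powr)
  have mono: "u powr p \<le> v powr p" if "0 \<le> u" "u \<le> v" "0 < p" for u v p :: real
    using that by (intro powr_mono2) auto
  show "min ((K * max ((C * x) powr \<alpha>) ((C * x) powr \<beta>) / K) powr (1 / \<alpha>))
      ((K * max ((C * x) powr \<alpha>) ((C * x) powr \<beta>) / K) powr (1 / \<beta>)) / C = x" if "x \<in> {0..}" for x
  proof -
    define u where "u = C * x"
    have u: "0 \<le> u" using that pos by (simp add: u_def)
    have "min (max (u powr \<alpha>) (u powr \<beta>) powr (1 / \<alpha>)) (max (u powr \<alpha>) (u powr \<beta>) powr (1 / \<beta>)) = u"
    proof (rule antisym)
      consider "max (u powr \<alpha>) (u powr \<beta>) = u powr \<alpha>" | "max (u powr \<alpha>) (u powr \<beta>) = u powr \<beta>"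
        by linarith
      then show "min (max (u powr \<alpha>) (u powr \<beta>) powr (1 / \<alpha>)) (max (u powr \<alpha>) (u powr \<beta>) powr (1 / \<beta>)) \<le> u"
        by cases (use inv(1)[OF u] pos in auto)
      have "(u powr \<alpha>) powr (1 / \<alpha>) \<le> max (u powr \<alpha>) (u powr \<beta>) powr (1 / \<alpha>)"
        "(u powr \<beta>) powr (1 / \<beta>) \<le> max (u powr \<alpha>) (u powr \<beta>) powr (1 / \<beta>)"
        using pos by (intro mono; simp)+
      then show "u \<le> min (max (u powr \<alpha>) (u powr \<beta>) powr (1 / \<alpha>)) (max (u powr \<alpha>) (u powr \<beta>) powr (1 / \<beta>))"
        using inv(1)[OF u] pos by simp
    qed
    then show ?thesis using pos by (simp add: u_def)
  qed
  show "K * max ((C * (min ((y / K) powr (1 / \<alpha>)) ((y / K) powr (1 / \<beta>)) / C)) powr \<alpha>)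
      ((C * (min ((y / K) powr (1 / \<alpha>)) ((y / K) powr (1 / \<beta>)) / C)) powr \<beta>) = y" if "y \<in> {0..}" for y
  proof -
    define u where "u = y / K"
    have u: "0 \<le> u" using that pos by (simp add: u_def)
    define m where "m = min (u powr (1 / \<alpha>)) (u powr (1 / \<beta>))"
    have m0: "0 \<le> m" by (simp add: m_def)
    have "max (m powr \<alpha>) (m powr \<beta>) = u"
    proof (rule antisym)
      have "m powr \<alpha> \<le> (u powr (1 / \<alpha>)) powr \<alpha>" "m powr \<beta> \<le> (u powr (1 / \<beta>)) powr \<beta>"
        using pos m0 by (intro mono; simp add: m_def)+
      then show "max (m powr \<alpha>) (m powr \<beta>) \<le> u" using inv(2)[OF u] pos by simp
      consider "m = u powr (1 / \<alpha>)" | "m = u powr (1 / \<beta>)" unfolding m_def by linarith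
      then show "u \<le> max (m powr \<alpha>) (m powr \<beta>)"
        by cases (use inv(2)[OF u] pos in auto)
    qed
    then show ?thesis using pos by (simp add: u_def m_def)
  qed
qed

text \<open>\<open>H p n\<close> is the size of the image of the ball of radius about \<open>b\<^sup>-\<^sup>n\<close> around \<open>p\<close>.\<close>

locale scale_function =
  fixes X :: "'a::metric_space set" and f :: "'a \<Rightarrow> 'c::metric_space" and H :: "'a \<Rightarrow> nat \<Rightarrow> real"
    and b g s c1 C1 c2 C2 :: real
  assumes b: "1 < b" and g: "0 < g" "g < 1" and s: "0 < s" "s < 1"
    and c: "0 < c1" "0 < C1" "0 < c2" "0 < C2"
    and H: "\<And>p n. p \<in> X \<Longrightarrow> 0 < H p n" "\<And>p n. p \<in> X \<Longrightarrow> g * H p n \<le> H p (Suc n)"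
      "\<And>p n. p \<in> X \<Longrightarrow> H p (Suc n) \<le> s * H p n" "\<And>p. p \<in> X \<Longrightarrow> H p 0 \<le> 1"
    and level: "\<And>p q. p \<in> X \<Longrightarrow> q \<in> X \<Longrightarrow> p \<noteq> q \<Longrightarrow> \<exists>n. c1 / b ^ n \<le> dist p q \<and> dist p q \<le> C1 / b ^ n \<and>
      c2 * H p n \<le> dist (f p) (f q) \<and> dist (f p) (f q) \<le> C2 * H p n"
begin

lemma H_upper: "p \<in> X \<Longrightarrow> H p (n + m) \<le> s ^ m * H p n"
proof (induction m)
  case (Suc m)
  have "H p (n + Suc m) \<le> s * H p (n + m)" using H(3)[OF Suc.prems, of "n + m"] by simp
  also have "\<dots> \<le> s * (s ^ m * H p n)" using Suc s by (intro mult_left_mono) auto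
  finally show ?case by simp
qed simp

lemma H_lower: "p \<in> X \<Longrightarrow> g ^ m * H p n \<le> H p (n + m)"
proof (induction m)
  case (Suc m)
  have "g * (g ^ m * H p n) \<le> g * H p (n + m)" using Suc g by (intro mult_left_mono) auto
  also have "\<dots> \<le> H p (n + Suc m)" using H(2)[OF Suc.prems, of "n + m"] by simp
  finally show ?case by simp
qed simp

text \<open>If \<open>a\<close> and \<open>b'\<close> sit at levels \<open>n\<close> and
  \<open>m\<close> from \<open>x\<close>, the image ratio is comparable to
  \<open>H x n / H x m\<close>, hence at most of order \<open>s ^ (n - m)\<close> or
  \<open>(1 / g) ^ (m - n)\<close>, while the source ratio is comparable to
  \<open>b ^ m / b ^ n\<close>. The exponents \<open>\<alpha>\<close> and \<open>\<beta>\<close>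
  convert powers of \<open>b\<close> into powers of \<open>1 / s\<close> and
  \<open>1 / g\<close>.\<close>

lemma quasisymmetric:
  assumes Y: "f ` X \<subseteq> Y"
  shows "quasisymmetric X dist Y dist f"
  unfolding quasisymmetric_def
proof (intro conjI)
  show "f \<in> X \<rightarrow> Y" using Y by auto
  define \<alpha> where "\<alpha> = log b (1 / s)"
  define \<beta> where "\<beta> = log b (1 / g)"
  define K where "K = C2 / c2"
  define C where "C = C1 / c1"
  have \<alpha>: "0 < \<alpha>" and \<beta>: "0 < \<beta>" and K: "0 < K" and C: "0 < C"
    using b g s c by (auto simp: \<alpha>_def \<beta>_def K_def C_def zero_less_log_cancel_iff)
  define \<eta> where "\<eta> = (\<lambda>x. K * max ((C * x) powr \<alpha>) ((C * x) powr \<beta>))"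
  have "0 < dist (f x) (f b') \<and> dist (f x) (f a) / dist (f x) (f b') \<le> \<eta> (dist x a / dist x b')"
    if X: "x \<in> X" "a \<in> X" "b' \<in> X" and ne: "x \<noteq> b'" for x a b'
  proof
    obtain m where m: "c1 / b ^ m \<le> dist x b'" "dist x b' \<le> C1 / b ^ m" "c2 * H x m \<le> dist (f x) (f b')"
      using level[OF X(1,3) ne] by blast
    have Hm: "0 < c2 * H x m" using H(1)[OF X(1)] c by simp
    then show pos: "0 < dist (f x) (f b')" using m(3) by linarith
    show "dist (f x) (f a) / dist (f x) (f b') \<le> \<eta> (dist x a / dist x b')"
    proof (cases "x = a")
      case True
      then show ?thesis using K by (simp add: \<eta>_def)
    next
      case False
      obtain n where n: "c1 / b ^ n \<le> dist x a" "dist (f x) (f a) \<le> C2 * H x n"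
        using level[OF X(1,2) False] by blast
      define u where "u = C * (dist x a / dist x b')"
      have "dist (f x) (f a) / dist (f x) (f b') \<le> (C2 * H x n) / (c2 * H x m)"
        using n(2) m(3) Hm c H(1)[OF X(1)] by (intro frac_le) (auto simp: less_imp_le)
      also have "\<dots> = K * (H x n / H x m)" by (simp add: K_def)
      also have "\<dots> \<le> K * max (u powr \<alpha>) (u powr \<beta>)"
      proof (intro mult_left_mono)
        have "(c1 / b ^ n) / (C1 / b ^ m) \<le> dist x a / dist x b'"
          using n(1) m(2) ne b c by (intro frac_le) auto
        then have "C * ((c1 / b ^ n) / (C1 / b ^ m)) \<le> u"
          unfolding u_def using C by (intro mult_left_mono) auto
        then have u: "b ^ m / b ^ n \<le> u" using c b by (simp add: C_def)
        have powr: "(b ^ i) powr (log b (1 / r)) = (1 / r) ^ i" if "0 < r" for r i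
        proof -
          have "(b ^ i) powr (log b (1 / r)) = (b powr log b (1 / r)) powr real i"
            using b by (simp add: powr_realpow[symmetric] powr_powr mult.commute)
          also have "\<dots> = (1 / r) ^ i"
            using b that by (simp add: powr_realpow)
          finally show ?thesis .
        qed
        show "H x n / H x m \<le> max (u powr \<alpha>) (u powr \<beta>)"
        proof (cases "m \<le> n")
          case True
          then obtain i where i: "n = m + i" using le_Suc_ex by blast
          have "H x n / H x m \<le> s ^ i"
            using H_upper[OF X(1), of m i] H(1)[OF X(1), of m] by (simp add: i divide_le_eq)
          also have "\<dots> = (b ^ m / b ^ n) powr \<alpha>"
          proof -
            have "b ^ m / b ^ n = 1 / b ^ i" using b by (simp add: i power_add)
            then have "(b ^ m / b ^ n) powr \<alpha> = 1 / (b ^ i) powr \<alpha>" using b by (simp add: powr_divide)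
            then show ?thesis using s by (simp add: \<alpha>_def powr power_one_over)
          qed
          also have "\<dots> \<le> u powr \<alpha>" using u \<alpha> b by (intro powr_mono2) auto
          finally show ?thesis by simp
        next
          case False
          then obtain i where i: "m = n + i" using le_Suc_ex[of n m] by auto
          have "H x n / H x m \<le> (1 / g) ^ i"
            using H_lower[OF X(1), of i n] H(1)[OF X(1), of m] g by (simp add: i field_simps power_one_over)
          also have "\<dots> = (b ^ m / b ^ n) powr \<beta>"
            using b g by (simp add: i power_add \<beta>_def powr)
          also have "\<dots> \<le> u powr \<beta>" using u \<beta> b by (intro powr_mono2) auto
          finally show ?thesis by simp
        qed
      qed (use K in simp)
      finally show ?thesis by (simp add: \<eta>_def u_def)
    qed
  qed
  moreover have "\<exists>\<theta>. homeomorphism {0..} {0..} \<eta> \<theta>"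
    unfolding \<eta>_def using homeomorphism_max_powr[OF \<alpha> \<beta> K C] by blast
  ultimately show "\<exists>\<eta> \<theta>. homeomorphism {0..} {0..} \<eta> \<theta> \<and> (\<forall>x\<in>X. \<forall>a\<in>X. \<forall>b\<in>X. x \<noteq> b \<longrightarrow>
      0 < dist (f x) (f b) \<and> dist (f x) (f a) / dist (f x) (f b) \<le> \<eta> (dist x a / dist x b))"
    by blast
qed

lemma inj: "inj_on f X"
proof (rule inj_onI, rule ccontr)
  fix p q assume X: "p \<in> X" "q \<in> X" and eq: "f p = f q" and "p \<noteq> q"
  then obtain n where "c2 * H p n \<le> dist (f p) (f q)" using level by blast
  moreover have "0 < c2 * H p n" using H(1)[OF X(1)] c by simp
  ultimately show False using eq by simp
qed

lemma continuous: "continuous_on X f"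
  unfolding continuous_on_iff
proof (intro ballI allI impI)
  fix p and e :: real assume p: "p \<in> X" and e: "0 < e"
  obtain N where N: "s ^ N < e / C2" using real_arch_pow_inv[of "e / C2" s] e c s by auto
  show "\<exists>d>0. \<forall>q\<in>X. dist q p < d \<longrightarrow> dist (f q) (f p) < e"
  proof (intro exI[of _ "c1 / b ^ N"] conjI ballI impI)
    show "0 < c1 / b ^ N" using b c by simp
    fix q assume q: "q \<in> X" "dist q p < c1 / b ^ N"
    show "dist (f q) (f p) < e"
    proof (cases "p = q")
      case True
      then show ?thesis using e by simp
    next
      case False
      obtain n where n: "c1 / b ^ n \<le> dist p q" "dist (f p) (f q) \<le> C2 * H p n"
        using level[OF p q(1) False] by blast
      have "c1 / b ^ n < c1 / b ^ N" using n(1) q(2) by (simp add: dist_commute)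
      then have "b ^ N < b ^ n" using b c by (simp add: field_simps)
      then have "N < n" using b power_less_imp_less_exp by blast
      then have "s ^ n \<le> s ^ N" using s by (intro power_decreasing) auto
      moreover have "H p n \<le> s ^ n"
      proof -
        have "H p n \<le> s ^ n * H p 0" using H_upper[OF p, of 0 n] by simp
        also have "\<dots> \<le> s ^ n * 1" using H(4)[OF p] s by (intro mult_left_mono) auto
        finally show ?thesis by simp
      qed
      ultimately have "H p n < e / C2" using N by linarith
      then have "C2 * H p n < e" using c by (simp add: field_simps)
      then show ?thesis using n(2) by (simp add: dist_commute)
    qed
  qed
qed

text \<open>Compactness gives a continuous inverse on the whole image. Passing to subsets afterwards
  is what serves the support of a product measure.\<close>

lemma homeomorphic:
  assumes "compact X" "X0 \<subseteq> X"
  shows "homeomorphic_map (top_of_set X0) (top_of_set (f ` X0)) f"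
proof -
  obtain g where "homeomorphism X (f ` X) f g"
    using homeomorphism_compact[OF assms(1) continuous refl inj] by blast
  then have "homeomorphism X0 (f ` X0) f g"
    by (rule homeomorphism_of_subsets) (use assms in auto)
  then show ?thesis by (rule homeomorphism_imp_homeomorphic_map)
qed

lemma qs_embedding:
  assumes "compact X"
  shows "qs_embedding X dist UNIV dist f"
  unfolding qs_embedding_def embedding_map_def mtopology_dist_eq
  using homeomorphic[OF assms order_refl] quasisymmetric[of UNIV] by simp

lemma qs_homeomorphism:
  assumes "compact X" "X0 \<subseteq> X"
  shows "qs_homeomorphism X0 dist (f ` X0) dist f"
proof -
  have "quasisymmetric X dist UNIV dist f" by (rule quasisymmetric) simp
  then have "quasisymmetric X0 dist (f ` X0) dist f"
    unfolding quasisymmetric_def using assms(2) by (fastforce simp: subset_iff)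
  then show ?thesis
    unfolding qs_homeomorphism_def mtopology_dist_eq using homeomorphic[OF assms] by simp
qed

end

section \<open>Hausdorff measure and coverings\<close>

lemma set_diam_bounds:
  assumes "U \<noteq> {}" "\<And>x y. x \<in> U \<Longrightarrow> y \<in> U \<Longrightarrow> dist x y \<le> \<rho>"
  shows "0 \<le> set_diam dist U" "set_diam dist U \<le> \<rho>"
    and "\<And>x y. x \<in> U \<Longrightarrow> y \<in> U \<Longrightarrow> dist x y \<le> set_diam dist U"
proof -
  have bdd: "bdd_above {dist x y | x y. x \<in> U \<and> y \<in> U}"
    using assms(2) by (auto intro!: bdd_aboveI[of _ \<rho>])
  show *: "dist x y \<le> set_diam dist U" if "x \<in> U" "y \<in> U" for x y
    unfolding set_diam_def using that by (intro cSup_upper bdd) auto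
  obtain x where "x \<in> U" using assms(1) by blast
  then show "0 \<le> set_diam dist U" using *[of x x] by simp
  show "set_diam dist U \<le> \<rho>"
    unfolding set_diam_def using assms(2) \<open>x \<in> U\<close> by (intro cSup_least) blast+
qed

lemma diam_pow_le:
  assumes "0 < s" "\<And>x y. x \<in> U \<Longrightarrow> y \<in> U \<Longrightarrow> dist x y \<le> \<rho>"
  shows "diam_pow dist s U \<le> ennreal (\<rho> powr s)"
proof (cases "U = {}")
  case False
  then show ?thesis
    using set_diam_bounds[OF False assms(2)] assms(1)
    by (auto simp: diam_pow_def intro!: ennreal_leI powr_mono2)
qed (simp add: diam_pow_def)

text \<open>The finite families are padded with empty sets, which cost 0 by the convention in
  \<open>diam_pow\<close>, and flattened to one sequence by \<open>prod_decode\<close>.\<close>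

lemma hausdorff_pre_le:
  fixes B :: "nat \<Rightarrow> 'c \<Rightarrow> 'a::metric_space set"
  assumes s: "0 < s" and fin: "\<And>n. finite (C n)"
    and B: "\<And>n c. c \<in> C n \<Longrightarrow> B n c \<subseteq> Y" "\<And>n c x y. c \<in> C n \<Longrightarrow> x \<in> B n c \<Longrightarrow> y \<in> B n c \<Longrightarrow> dist x y \<le> \<rho> n"
    and \<rho>: "\<And>n. C n \<noteq> {} \<Longrightarrow> \<rho> n \<le> \<delta>" and A: "A \<subseteq> (\<Union>n. \<Union>c\<in>C n. B n c)"
    and \<delta>: "0 < \<delta>"
  shows "hausdorff_pre Y dist \<delta> s A \<le> (\<Sum>n. of_nat (card (C n)) * ennreal (\<rho> n powr s))"
proof -
  have "\<exists>h. bij_betw h {0..<card (C n)} (C n)" for n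
    using ex_bij_betw_nat_finite[OF fin] by blast
  then obtain h where h: "\<And>n. bij_betw (h n) {0..<card (C n)} (C n)" by metis
  define U where "U = (\<lambda>(n, i). if i < card (C n) then B n (h n i) else {})"
  have hC: "h n i \<in> C n" if "i < card (C n)" for n i
    using h[of n] that by (auto simp: bij_betw_def)
  have cover: "A \<subseteq> (\<Union>k. U (prod_decode k))"
  proof
    fix x assume "x \<in> A"
    then obtain n c where c: "c \<in> C n" "x \<in> B n c" using A by blast
    then have "c \<in> h n ` {0..<card (C n)}" using h[of n] by (simp add: bij_betw_def)
    then obtain i where "i < card (C n)" "c = h n i" by auto
    then have "x \<in> U (prod_decode (prod_encode (n, i)))" using c by (simp add: U_def)
    then show "x \<in> (\<Union>k. U (prod_decode k))" by blast
  qed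
  have "hausdorff_pre Y dist \<delta> s A \<le> (\<Sum>k. diam_pow dist s (U (prod_decode k)))"
    unfolding hausdorff_pre_def
  proof (intro Inf_lower CollectI exI[of _ "\<lambda>k. U (prod_decode k)"] conjI allI cover refl)
    fix k
    obtain n i where k: "prod_decode k = (n, i)" by (cases "prod_decode k")
    show "U (prod_decode k) \<subseteq> Y" using B(1) hC by (auto simp: k U_def)
    have "dist x y \<le> \<delta>" if "i < card (C n)" "x \<in> B n (h n i)" "y \<in> B n (h n i)" for x y
      using B(2)[OF hC[OF that(1)] that(2,3)] \<rho>[of n] hC[OF that(1)] by force
    then show "\<forall>x\<in>U (prod_decode k). \<forall>y\<in>U (prod_decode k). dist x y \<le> \<delta>"
      by (auto simp: k U_def)
  qed
  also have "\<dots> = (\<Sum>n. \<Sum>i. diam_pow dist s (U (n, i)))"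
    by (rule suminf_ennreal_2dimen[of _ "\<lambda>x. diam_pow dist s (U x)"]) simp
  also have "\<dots> \<le> (\<Sum>n. of_nat (card (C n)) * ennreal (\<rho> n powr s))"
  proof (intro suminf_le summableI)
    fix n
    have "(\<Sum>i. diam_pow dist s (U (n, i))) = (\<Sum>i<card (C n). diam_pow dist s (U (n, i)))"
      by (intro suminf_finite) (auto simp: U_def diam_pow_def)
    also have "\<dots> \<le> (\<Sum>i<card (C n). ennreal (\<rho> n powr s))"
      by (intro sum_mono diam_pow_le s) (auto simp: U_def intro: B(2) hC)
    also have "\<dots> = of_nat (card (C n)) * ennreal (\<rho> n powr s)" by simp
    finally show "(\<Sum>i. diam_pow dist s (U (n, i))) \<le> of_nat (card (C n)) * ennreal (\<rho> n powr s)" .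
  qed
  finally show ?thesis .
qed

text \<open>Every tail of the families covers the limsup set, and the tails of a convergent series
  tend to 0. The balls are cut with \<open>Y\<close> because covers have to lie in the
  carrier.\<close>

lemma hausdorff_measure_limsup_balls:
  fixes C :: "nat \<Rightarrow> 'a::metric_space set"
  assumes s: "0 < s" and fin: "\<And>n. finite (C n)" and r: "\<And>n. 0 \<le> r n" "r \<longlonglongrightarrow> 0"
    and sm: "summable (\<lambda>n. real (card (C n)) * (2 * r n) powr s)"
  shows "hausdorff_measure Y dist s ((\<Inter>N. \<Union>n\<in>{N..}. \<Union>c\<in>C n. cball c (r n)) \<inter> Y) = 0"
proof -
  let ?A = "(\<Inter>N. \<Union>n\<in>{N..}. \<Union>c\<in>C n. cball c (r n)) \<inter> Y"
  define F where "F n = real (card (C n)) * (2 * r n) powr s" for n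
  have F0: "0 \<le> F n" for n by (simp add: F_def)
  have "hausdorff_pre Y dist \<delta> s ?A = 0" if \<delta>: "0 < \<delta>" for \<delta>
  proof -
    have "hausdorff_pre Y dist \<delta> s ?A \<le> ennreal \<eta>" if \<eta>: "0 < \<eta>" for \<eta>
    proof -
      have "(\<lambda>N. \<Sum>n. F (n + N)) \<longlonglongrightarrow> 0"
        using sm by (intro suminf_exist_split2) (simp add: F_def[abs_def])
      then have "\<forall>\<^sub>F N in sequentially. (\<Sum>n. F (n + N)) < \<eta>"
        using \<eta> by (rule order_tendstoD(2))
      then obtain N1 where N1: "\<And>N. N1 \<le> N \<Longrightarrow> (\<Sum>n. F (n + N)) < \<eta>"
        unfolding eventually_sequentially by blast
      have "\<forall>\<^sub>F n in sequentially. r n < \<delta> / 2"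
        using r(2) \<delta> by (intro order_tendstoD(2)) auto
      then obtain N2 where N2: "\<And>n. N2 \<le> n \<Longrightarrow> r n < \<delta> / 2"
        unfolding eventually_sequentially by blast
      obtain N where N: "N1 \<le> N" "N2 \<le> N" by (metis max.cobounded1 max.cobounded2)
      have "hausdorff_pre Y dist \<delta> s ?A \<le> (\<Sum>n. of_nat (card (C (n + N))) * ennreal ((2 * r (n + N)) powr s))"
      proof (rule hausdorff_pre_le[where B = "\<lambda>n c. cball c (r (n + N)) \<inter> Y"])
        show "dist x y \<le> 2 * r (n + N)" if "x \<in> cball c (r (n + N)) \<inter> Y" "y \<in> cball c (r (n + N)) \<inter> Y" for n c x y
          using that dist_triangle3[of x y c] by auto
        show "2 * r (n + N) \<le> \<delta>" for n using N2[OF trans_le_add2[OF N(2)], of n] by simp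
        show "?A \<subseteq> (\<Union>n. \<Union>c\<in>C (n + N). cball c (r (n + N)) \<inter> Y)"
        proof
          fix x assume x: "x \<in> ?A"
          then have "x \<in> (\<Union>n\<in>{N..}. \<Union>c\<in>C n. cball c (r n))" by blast
          then obtain n c where "N \<le> n" "c \<in> C n" "x \<in> cball c (r n)" by auto
          then have "c \<in> C ((n - N) + N)" "x \<in> cball c (r ((n - N) + N)) \<inter> Y" using x by auto
          then show "x \<in> (\<Union>n. \<Union>c\<in>C (n + N). cball c (r (n + N)) \<inter> Y)" by blast
        qed
      qed (use s \<delta> in \<open>simp_all add: fin\<close>)
      also have "\<dots> = (\<Sum>n. ennreal (F (n + N)))"
        by (simp add: F_def ennreal_mult ennreal_of_nat_eq_real_of_nat)
      also have "\<dots> = ennreal (\<Sum>n. F (n + N))"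
      proof (intro suminf_ennreal2 F0)
        have "summable F" using sm by (simp add: F_def[abs_def])
        then show "summable (\<lambda>n. F (n + N))" by (rule summable_ignore_initial_segment)
      qed
      also have "\<dots> \<le> ennreal \<eta>" using N1[OF N(1)] by (intro ennreal_leI) simp
      finally show ?thesis .
    qed
    then have "hausdorff_pre Y dist \<delta> s ?A \<le> 0"
      by - (rule ennreal_le_epsilon, simp)
    then show ?thesis by simp
  qed
  then show ?thesis unfolding hausdorff_measure_def by simp
qed

section \<open>The embedding of a coded set\<close>

text \<open>By \<open>close\<close> and \<open>far\<close>, distances in \<open>E\<close> are
  comparable to \<open>1 / b ^ n\<close> with \<open>n\<close> the first position at which the codes
  differ. \<open>J\<close> is an isometry that carries the construction into the target
  space.\<close>

locale coded_cascade = cascade b a D \<sigma> \<gamma> I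
  for b a D :: nat and \<sigma> \<gamma> :: real and I :: "'v::euclidean_space set" +
  fixes E :: "'v set" and code :: "'v \<Rightarrow> nat \<Rightarrow> 'v" and c\<^sub>0 C\<^sub>0 :: real
    and J :: "real \<times> 'v \<Rightarrow> 'w::euclidean_space"
  assumes code: "\<And>x n. x \<in> E \<Longrightarrow> code x n \<in> I"
    and close: "\<And>x y n. x \<in> E \<Longrightarrow> y \<in> E \<Longrightarrow> (\<And>i. i < n \<Longrightarrow> code x i = code y i) \<Longrightarrow> dist x y \<le> C\<^sub>0 / real b ^ n"
    and far: "\<And>x y n. x \<in> E \<Longrightarrow> y \<in> E \<Longrightarrow> code x n \<noteq> code y n \<Longrightarrow> c\<^sub>0 / real b ^ n \<le> dist x y"
    and c0: "0 < c\<^sub>0" "0 < C\<^sub>0"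
    and J: "\<And>p q. dist (J p) (J q) = dist p q"
begin

definition embed :: "real \<times> 'v \<Rightarrow> 'w" where
  "embed p = J (point (code (snd p)) (fst p))"

definition size_at :: "real \<times> 'v \<Rightarrow> nat \<Rightarrow> real" where
  "size_at p n = csiz (cell_at (code (snd p)) (fst p) n)"

lemma idx_bounds:
  assumes "0 \<le> t"
  shows "real (idx t n) \<le> real b ^ n * t" "real b ^ n * t < real (idx t n) + 1"
proof -
  have "0 \<le> real b ^ n * t" using assms by simp
  then have "real (idx t n) = of_int \<lfloor>real b ^ n * t\<rfloor>" unfolding idx_def by simp
  then show "real (idx t n) \<le> real b ^ n * t" "real b ^ n * t < real (idx t n) + 1" by linarith+
qed

text \<open>At level \<open>n\<close> the points are in equal or adjacent cells along the same rows,
  and at level \<open>Suc n\<close> no longer. Adjacent cells have to count as near, since points on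
  the two sides of a common face can be arbitrarily close. When nearness fails, either the next
  offsets differ or the next indices are at least 2 apart, the two cases of
  \<open>point_dist_bounds\<close>.\<close>

lemma dist_level:
  assumes p: "p \<in> {0..1} \<times> E" and q: "q \<in> {0..1} \<times> E" and ne: "p \<noteq> q"
  shows "\<exists>n. min c\<^sub>0 (1 / real b) / real b ^ n \<le> dist p q \<and> dist p q \<le> (2 + C\<^sub>0) / real b ^ n \<and>
      sep_const * size_at p n \<le> dist (embed p) (embed q) \<and> dist (embed p) (embed q) \<le> 6 * size_at p n"
proof -
  obtain t x t' y where pq: "p = (t, x)" "q = (t', y)" by (metis surj_pair)
  have t: "0 \<le> t" "t \<le> 1" "0 \<le> t'" "t' \<le> 1" and E: "x \<in> E" "y \<in> E" using p q by (auto simp: pq)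
  have b1: "1 < real b" using b_ge by simp
  define near where "near m \<longleftrightarrow> (\<forall>i<m. code x i = code y i) \<and> idx t' m \<le> Suc (idx t m) \<and> idx t m \<le> Suc (idx t' m)" for m
  have near_upper: "\<bar>t - t'\<bar> \<le> 2 / real b ^ m" "dist x y \<le> C\<^sub>0 / real b ^ m" if "near m" for m
  proof -
    show "dist x y \<le> C\<^sub>0 / real b ^ m" using that by (intro close E) (auto simp: near_def)
    have "real b ^ m * \<bar>t - t'\<bar> = \<bar>real b ^ m * t - real b ^ m * t'\<bar>"
      by (simp add: abs_mult right_diff_distrib[symmetric])
    also have "\<dots> \<le> 2"
      using idx_bounds[OF t(1), of m] idx_bounds[OF t(3), of m] that unfolding near_def by linarith
    finally show "\<bar>t - t'\<bar> \<le> 2 / real b ^ m" using b1 by (simp add: field_simps)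
  qed
  have "\<exists>m. \<not> near m"
  proof (rule ccontr)
    assume "\<not> (\<exists>m. \<not> near m)"
    then have all: "near m" for m by blast
    have lim: "(\<lambda>m. K / real b ^ m) \<longlonglongrightarrow> 0" for K
      using LIMSEQ_divide_realpow_zero[OF b1] by blast
    have "\<bar>t - t'\<bar> \<le> 0" by (rule LIMSEQ_le_const[OF lim[of 2]]) (use near_upper(1)[OF all] in blast)
    moreover have "dist x y \<le> 0" by (rule LIMSEQ_le_const[OF lim[of "C\<^sub>0"]]) (use near_upper(2)[OF all] in blast)
    ultimately show False using ne by (simp add: pq)
  qed
  moreover have "near 0"
  proof -
    \<comment> \<open>The index 1 occurs at level 0 for \<open>t = 1\<close>.\<close>
    have "idx t 0 \<le> 1" "idx t' 0 \<le> 1" using t idx_bounds[of t 0] idx_bounds[of t' 0] by auto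
    then show ?thesis by (auto simp: near_def)
  qed
  ultimately obtain n where n: "near n" "\<not> near (Suc n)"
    by (metis (no_types) nat_induct)
  have w: "\<And>i. code x i \<in> I" "\<And>i. code y i \<in> I" using code E by auto
  have agree: "code x i = code y i" if "i < n" for i using n(1) that by (auto simp: near_def)
  have idxs: "idx t' n \<le> Suc (idx t n)" "idx t n \<le> Suc (idx t' n)" using n(1) by (auto simp: near_def)
  have sep: "code x n \<noteq> code y n \<or> idx t (Suc n) + 2 \<le> idx t' (Suc n) \<or> idx t' (Suc n) + 2 \<le> idx t (Suc n)"
    using n agree unfolding near_def by (auto simp: less_Suc_eq)
  have de: "dist (embed p) (embed q) = norm (point (code x) t - point (code y) t')"
    by (simp add: embed_def J pq) (simp add: dist_norm)
  show ?thesis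
  proof (intro exI[of _ n] conjI)
    have "dist p q \<le> \<bar>t - t'\<bar> + dist x y"
      unfolding pq dist_Pair_Pair using sqrt_sum_squares_le_sum[of "dist t t'" "dist x y"]
      by (simp add: dist_real_def)
    also have "\<dots> \<le> 2 / real b ^ n + C\<^sub>0 / real b ^ n" using near_upper[OF n(1)] by linarith
    finally show "dist p q \<le> (2 + C\<^sub>0) / real b ^ n" by (simp add: add_divide_distrib)
    show "min c\<^sub>0 (1 / real b) / real b ^ n \<le> dist p q"
    proof (cases "code x n = code y n")
      case False
      have "min c\<^sub>0 (1 / real b) / real b ^ n \<le> c\<^sub>0 / real b ^ n"
        using b1 by (intro divide_right_mono) auto
      also have "\<dots> \<le> dist x y" by (rule far[OF E False])
      also have "\<dots> \<le> dist p q" by (simp add: pq dist_snd_le[of "(t, x)" "(t', y)", simplified])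
      finally show ?thesis .
    next
      case True
      have "min c\<^sub>0 (1 / real b) / real b ^ n \<le> 1 / real b / real b ^ n"
        using b1 by (intro divide_right_mono) auto
      also have "\<dots> = 1 / real b ^ Suc n" by simp
      also have "\<dots> \<le> \<bar>t - t'\<bar>"
      proof -
        have "1 \<le> \<bar>real b ^ Suc n * t - real b ^ Suc n * t'\<bar>"
          using sep True idx_bounds[OF t(1), of "Suc n"] idx_bounds[OF t(3), of "Suc n"] by linarith
        also have "\<dots> = real b ^ Suc n * \<bar>t - t'\<bar>"
          by (simp only: right_diff_distrib[symmetric] abs_mult) simp
        finally show ?thesis using b1 by (simp add: field_simps)
      qed
      also have "\<dots> \<le> dist p q"
        using dist_fst_le[of "(t, x)" "(t', y)"] by (simp add: pq dist_real_def)
      finally show ?thesis .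
    qed
    show "dist (embed p) (embed q) \<le> 6 * size_at p n"
      unfolding de size_at_def unfolding pq fst_conv snd_conv by (rule point_dist_bounds(1)[OF _ _ _ t(1,3) idxs]) (use w agree in auto)
    show "sep_const * size_at p n \<le> dist (embed p) (embed q)"
      unfolding de size_at_def unfolding pq fst_conv snd_conv
      by (rule point_dist_bounds(2)[OF _ _ _ t(1,3) idxs]) (use w agree sep in auto)
  qed
qed

sublocale scale_function "{0..1} \<times> E" embed size_at "real b" "\<sigma> / 2 ^ Suc D" \<sigma>
  "min c\<^sub>0 (1 / real b)" "2 + C\<^sub>0" sep_const 6
proof
  show "1 < real b" using b_ge by simp
  show "0 < \<sigma> / 2 ^ Suc D" using \<sigma>_pos by simp
  have "(1::real) \<le> 2 ^ Suc D" by (rule one_le_power) simp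
  then have "\<sigma> / 2 ^ Suc D \<le> \<sigma>" using \<sigma>_pos by (simp add: divide_le_eq del: power_Suc)
  then show "\<sigma> / 2 ^ Suc D < 1" "0 < \<sigma>" "\<sigma> < 1" using \<sigma>_small \<sigma>_pos by linarith+
  show "0 < min c\<^sub>0 (1 / real b)" "0 < 2 + C\<^sub>0" using c0 b_ge by auto
  show "0 < sep_const" "0 < (6::real)" using sep_const_pos by auto
  fix p :: "real \<times> 'v" assume "p \<in> {0..1} \<times> E"
  then have p: "\<And>i. code (snd p) i \<in> I" "0 \<le> fst p" using code by auto
  show "0 < size_at p n" for n unfolding size_at_def by (rule cell_size_pos[OF p(1)])
  show "\<sigma> / 2 ^ Suc D * size_at p n \<le> size_at p (Suc n)" "size_at p (Suc n) \<le> \<sigma> * size_at p n" for n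
    unfolding size_at_def using cell_size_step[OF p(1) p(2), of n] by (simp_all only: mult.commute)
  show "size_at p 0 \<le> 1" by (simp add: size_at_def)
qed (rule dist_level)

subsection \<open>The image of almost every point lies in a small set\<close>

text \<open>Past the \<open>D\<close> halvings that start at node \<open>a\<close>, and before the
  \<open>D\<close> doublings that end at node \<open>b - 4\<close>.\<close>

definition tiny :: "nat \<Rightarrow> bool" where
  "tiny j \<longleftrightarrow> a + D \<le> j \<and> j + D + 4 < b"

primrec ntiny :: "nat \<Rightarrow> nat \<Rightarrow> nat" where
  "ntiny 0 k = 0"
| "ntiny (Suc n) k = ntiny n (k div b) + (if tiny (k mod b) then 1 else 0)"

lemma cell_size_ntiny:
  assumes w: "\<And>i. w i \<in> I"
  shows "csiz (cell n w k) \<le> (1 / 2 ^ D) ^ ntiny n k"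
proof (induction n arbitrary: k)
  case (Suc n)
  have wf: "wf_cell (cell n w (k div b))" by (rule cell_wf[OF w])
  then have h: "0 < csiz (cell n w (k div b))" by (simp add: wf_cell_def)
  have m: "k mod b < b" using b_ge by simp
  have "csiz (cell (Suc n) w k) \<le> csiz (cell n w (k div b)) * (1 / 2 ^ D) ^ (if tiny (k mod b) then 1 else 0)"
  proof (cases "tiny (k mod b)")
    case True
    then have "csiz (cell (Suc n) w k) \<le> csiz (cell n w (k div b)) * (\<sigma> / 2 ^ D)"
      unfolding cell.simps using child_tiny[OF wf w m] by (simp add: tiny_def)
    also have "\<dots> \<le> csiz (cell n w (k div b)) * (1 / 2 ^ D)"
      using h \<sigma>_small by (intro mult_left_mono divide_right_mono) auto
    finally show ?thesis using True by simp
  next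
    case False
    have "csiz (cell (Suc n) w k) \<le> csiz (cell n w (k div b)) * \<sigma>"
      unfolding cell.simps by (rule child_size(2)[OF wf w m])
    also have "\<dots> \<le> csiz (cell n w (k div b)) * 1"
      using h \<sigma>_small by (intro mult_left_mono) auto
    finally show ?thesis using False by simp
  qed
  also have "\<dots> \<le> (1 / 2 ^ D) ^ ntiny n (k div b) * (1 / 2 ^ D) ^ (if tiny (k mod b) then 1 else 0)"
    by (intro mult_right_mono Suc) simp
  finally show ?case by (simp add: power_add mult.commute)
qed simp

definition good :: "nat \<Rightarrow> nat set" where
  "good n = {k. k < b ^ n \<and> n \<le> 2 * ntiny n k}"

text \<open>Words of length \<open>n\<close> are extensional functions, which makes the set finite
  when \<open>I\<close> is; \<open>cell n\<close> sees no more of a code than that.\<close>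

definition centres :: "nat \<Rightarrow> 'w set" where
  "centres n = (\<lambda>(w, k). J (cpos (cell n w k))) ` (({..<n} \<rightarrow>\<^sub>E I) \<times> good n)"

text \<open>\<open>12 / 10\<close> is the constant of \<open>point_near\<close>, and the power
  bounds the size of a cell with at least \<open>n / 2\<close> tiny digits.\<close>

definition radius :: "nat \<Rightarrow> real" where
  "radius n = 12 / 10 * (1 / 2) powr (real D / 2 * real n)"

text \<open>The limsup set of the balls. No measure occurs in it, so it serves all measures
  simultaneously.\<close>

definition core :: "'w set" where
  "core = (\<Inter>N. \<Union>n\<in>{N..}. \<Union>c\<in>centres n. cball c (radius n))"

lemma embed_in_core:
  assumes x: "x \<in> E" and t: "0 \<le> t" and inf: "\<forall>N. \<exists>n\<ge>N. idx t n \<in> good n"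
  shows "embed (t, x) \<in> core"
  unfolding core_def
proof
  fix N
  obtain n where n: "N \<le> n" "idx t n \<in> good n" using inf by blast
  have w: "\<And>i. code x i \<in> I" using code[OF x] .
  let ?w = "restrict (code x) {..<n}"
  have "cell_at (code x) t n = cell n ?w (idx t n)" by (rule cell_cong) simp
  then have c: "J (cpos (cell_at (code x) t n)) \<in> centres n"
    unfolding centres_def using n(2) w by (intro image_eqI[of _ _ "(?w, idx t n)"]) auto
  have "csiz (cell_at (code x) t n) \<le> (1 / 2 ^ D) ^ ntiny n (idx t n)" by (rule cell_size_ntiny[OF w])
  also have "\<dots> = (1 / 2) powr (real D * real (ntiny n (idx t n)))"
  proof -
    have "(1 / 2 ^ D :: real) ^ m = (1 / 2) ^ (D * m)" for m
      by (simp add: power_mult power_one_over)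
    then show ?thesis using powr_realpow[of "1 / 2" "D * ntiny n (idx t n)"] by simp
  qed
  also have "\<dots> \<le> (1 / 2) powr (real D / 2 * real n)"
  proof (rule powr_mono')
    have "n \<le> 2 * ntiny n (idx t n)" using n(2) by (simp add: good_def)
    then have "real n \<le> 2 * real (ntiny n (idx t n))" by linarith
    then show "real D / 2 * real n \<le> real D * real (ntiny n (idx t n))"
      using mult_left_mono[of "real n" "2 * real (ntiny n (idx t n))" "real D / 2"] by simp
  qed auto
  finally have "norm (point (code x) t - cpos (cell_at (code x) t n)) \<le> radius n"
    using point_near[of "code x" t n, OF w t] by (simp add: radius_def)
  then have "embed (t, x) \<in> cball (J (cpos (cell_at (code x) t n))) (radius n)"
    by (simp add: embed_def J dist_commute) (simp add: dist_norm)
  then show "embed (t, x) \<in> (\<Union>n\<in>{N..}. \<Union>c\<in>centres n. cball c (radius n))" using n c by fast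
qed

end

section \<open>Borel sets and measurability for subspaces\<close>

lemma Int_in_metric_borel:
  fixes Y :: "'a::metric_space set"
  assumes "A \<in> sets borel"
  shows "A \<inter> Y \<in> sets (metric_borel Y dist)"
proof -
  have Y: "Metric_space Y dist" by (rule Met_TC.subspace) simp
  have "A \<in> sigma_sets UNIV {S. open S}" using assms by (simp add: borel_def)
  then have "A \<inter> Y \<in> sigma_sets Y {U. openin (top_of_set Y) U}"
  proof (induction rule: sigma_sets.induct)
    case (Basic U)
    then show ?case by (auto simp: openin_open intro!: sigma_sets.Basic)
  next
    case Empty
    then show ?case by (simp add: sigma_sets.Empty)
  next
    case (Compl U)
    have "(UNIV - U) \<inter> Y = Y - U \<inter> Y" by blast
    then show ?case using Compl by (simp add: sigma_sets.Compl)
  next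
    case (Union U)
    have eq: "(\<Union>i. U i) \<inter> Y = (\<Union>i. U i \<inter> Y)" by blast
    show ?case unfolding eq by (rule sigma_sets.Union) (rule Union)
  qed
  then show ?thesis by (simp add: sets_metric_borel[OF Y] mtopology_dist_eq)
qed

lemma continuous_on_measurable_metric_borel:
  fixes f :: "'a::topological_space \<Rightarrow> 'b::metric_space"
  assumes f: "continuous_on X f" "f ` X \<subseteq> Y" and M: "sets M = sets borel" and X: "X \<in> sets borel"
  shows "f \<in> measurable (restrict_space M X) (metric_borel Y dist)"
  unfolding metric_borel_def
proof (rule measurable_measure_of)
  have sp: "space (restrict_space M X) = X"
    using sets_eq_imp_space_eq[OF M] by (simp add: space_restrict_space)
  show "{U. openin (Metric_space.mtopology Y dist) U} \<subseteq> Pow Y"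
    by (auto simp: mtopology_dist_eq dest: openin_imp_subset)
  show "f \<in> space (restrict_space M X) \<rightarrow> Y" using f(2) by (auto simp: sp)
  fix U assume "U \<in> {U. openin (Metric_space.mtopology Y dist) U}"
  then obtain T where T: "open T" "U = T \<inter> Y" by (auto simp: mtopology_dist_eq openin_open)
  then obtain S where S: "open S" "S \<inter> X = f -` T \<inter> X"
    using f(1) unfolding continuous_on_open_invariant by blast
  have "f -` U \<inter> X = f -` T \<inter> X" using T(2) f(2) by blast
  then have eq: "f -` U \<inter> space (restrict_space M X) = X \<inter> S" unfolding sp S(2)[symmetric] by blast
  show "f -` U \<inter> space (restrict_space M X) \<in> sets (restrict_space M X)"
    unfolding eq sets_restrict_space M using S(1) by (intro imageI) simp
qed

section \<open>Frequency of tiny digits, and the dimension of the image measures\<close>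

context coded_cascade
begin

text \<open>\<open>4\<close> to the number of digits that are not tiny: the exponential moment of a
  Chernoff bound. Its product form turns the sum over all indices into a power.\<close>

primrec weight :: "nat \<Rightarrow> nat \<Rightarrow> real" where
  "weight 0 k = 1"
| "weight (Suc n) k = weight n (k div b) * (if tiny (k mod b) then 1 else 4)"

lemma weight_ntiny: "weight n k * 4 ^ ntiny n k = 4 ^ n"
proof (induction n arbitrary: k)
  case (Suc n)
  have "weight (Suc n) k * 4 ^ ntiny (Suc n) k = 4 * (weight n (k div b) * 4 ^ ntiny n (k div b))"
    by simp
  then show ?case unfolding Suc by simp
qed simp

lemma weight_nonneg: "0 \<le> weight n k"
  by (induction n arbitrary: k) simp_all

lemma sum_weight: "(\<Sum>k<b ^ n. weight n k) = (\<Sum>j<b. if tiny j then 1 else 4) ^ n"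
proof (induction n)
  case (Suc n)
  let ?s = "\<Sum>j<b. if tiny j then 1 else 4 :: real"
  have "(\<Sum>k<b ^ Suc n. weight (Suc n) k) = (\<Sum>m<b ^ n. sum (weight (Suc n)) {m * b..<m * b + b})"
    using sum.nat_group[of "weight (Suc n)" b "b ^ n"] by (simp add: mult.commute del: weight.simps)
  also have "\<dots> = (\<Sum>m<b ^ n. weight n m * ?s)"
  proof (rule sum.cong[OF refl])
    fix m
    have "sum (weight (Suc n)) {m * b..<m * b + b} = (\<Sum>j\<in>{0..<b}. weight (Suc n) (j + m * b))"
      using sum.shift_bounds_nat_ivl[of "weight (Suc n)" 0 "m * b" b] by (simp add: add.commute del: weight.simps)
    also have "\<dots> = (\<Sum>j\<in>{0..<b}. weight n m * (if tiny j then 1 else 4))"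
      by (intro sum.cong) auto
    finally show "sum (weight (Suc n)) {m * b..<m * b + b} = weight n m * ?s"
      by (simp add: sum_distrib_left lessThan_atLeast0)
  qed
  also have "\<dots> = ?s ^ Suc n" by (simp add: sum_distrib_right[symmetric] Suc)
  finally show ?case .
qed simp

definition bad :: "nat \<Rightarrow> nat set" where
  "bad n = {k. k < b ^ n \<and> 2 * ntiny n k < n}"

text \<open>At most \<open>b / 8\<close> of the digits are not tiny, so the mean weight of a digit
  is at most \<open>1 + 3 / 8 = 11 / 8\<close>, while an index in \<open>bad n\<close> has weight at
  least \<open>2 ^ n\<close>. Markov's inequality leaves a factor \<open>11 / 16\<close> per
  digit.\<close>

lemma card_bad:
  assumes few: "8 * (a + 2 * D + 4) \<le> b"
  shows "real (card (bad n)) \<le> (11 / 16 * real b) ^ n"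
proof -
  have "2 ^ n \<le> weight n k" if "k \<in> bad n" for k
  proof -
    have "(4::real) ^ ntiny n k = 2 ^ (2 * ntiny n k)" by (simp add: power_mult)
    also have "\<dots> \<le> 2 ^ n" using that by (intro power_increasing) (auto simp: bad_def)
    finally have "weight n k * 4 ^ ntiny n k \<le> weight n k * 2 ^ n"
      by (intro mult_left_mono weight_nonneg)
    moreover have "(4::real) ^ n = 2 ^ n * 2 ^ n" by (simp add: power_mult_distrib[symmetric])
    ultimately show ?thesis by (simp add: weight_ntiny)
  qed
  then have "real (card (bad n)) * 2 ^ n \<le> (\<Sum>k\<in>bad n. weight n k)"
    using sum_mono[of "bad n" "\<lambda>_. 2 ^ n" "weight n"] by simp
  also have "\<dots> \<le> (\<Sum>k<b ^ n. weight n k)"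
    by (intro sum_mono2) (auto simp: bad_def weight_nonneg)
  also have "\<dots> \<le> (11 / 8 * real b) ^ n"
    unfolding sum_weight
  proof (rule power_mono)
    have "(\<Sum>j<b. if tiny j then 1 else 4 :: real) = (\<Sum>j<b. 1) + (\<Sum>j<b. if tiny j then 0 else 3)"
      unfolding sum.distrib[symmetric] by (rule sum.cong) simp_all
    also have "(\<Sum>j<b. if tiny j then 0 else 3 :: real) = (\<Sum>j\<in>{j. j < b \<and> \<not> tiny j}. 3)"
      by (rule sum.mono_neutral_cong_right) auto
    also have "\<dots> = 3 * real (card {j. j < b \<and> \<not> tiny j})" by simp
    also have "card {j. j < b \<and> \<not> tiny j} \<le> card ({..<a + D} \<union> {b - (D + 4)..<b})"
      by (intro card_mono) (auto simp: tiny_def)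
    also have "\<dots> \<le> a + 2 * D + 4"
      using card_Un_le[of "{..<a + D}" "{b - (D + 4)..<b}"] by simp
    also have "real (a + 2 * D + 4) \<le> real b / 8"
    proof -
      have "real (8 * (a + 2 * D + 4)) \<le> real b" using few by (rule of_nat_mono)
      then show ?thesis by simp
    qed
    finally show "(\<Sum>j<b. if tiny j then 1 else 4 :: real) \<le> 11 / 8 * real b" by simp
  qed (auto intro: sum_nonneg)
  finally have "real (card (bad n)) * 2 ^ n \<le> (11 / 16 * real b) ^ n * 2 ^ n"
    by (simp add: power_mult_distrib[symmetric])
  then show ?thesis by simp
qed

text \<open>A time \<open>t < 1\<close> with no good level from \<open>N\<close> on lies in
  \<open>W n\<close> for every \<open>n \<ge> N\<close>, and the measure of \<open>W n\<close> is at
  most \<open>(11 / 16) ^ n\<close>, which tends to 0. The time 1 is set apart because its index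
  \<open>b ^ n\<close> lies outside the range of \<open>bad n\<close> and
  \<open>good n\<close>.\<close>

lemma almost_all_good:
  assumes few: "8 * (a + 2 * D + 4) \<le> b"
  shows "\<exists>Z\<in>null_sets lborel. \<forall>t\<in>{0..1} - Z. \<forall>N. \<exists>n\<ge>N. idx t n \<in> good n"
proof -
  define W where "W n = (\<Union>k\<in>bad n. {real k / real b ^ n..<(real k + 1) / real b ^ n})" for n
  define V where "V N = (\<Inter>n\<in>{N..}. W n)" for N
  have b0: "0 < real b ^ n" for n using b_ge by simp
  have Wm: "W n \<in> sets lborel" for n
    unfolding W_def by (intro sets.finite_UN) (auto simp: bad_def)
  have Ve: "V N \<in> sets lborel" for N
    unfolding V_def using Wm by (intro sets.countable_INT') auto
  have We: "emeasure lborel (W n) \<le> ennreal ((11 / 16) ^ n)" for n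
  proof -
    have "emeasure lborel (W n) \<le> (\<Sum>k\<in>bad n. emeasure lborel {real k / real b ^ n..<(real k + 1) / real b ^ n})"
      unfolding W_def by (intro emeasure_subadditive_finite) (auto simp: bad_def)
    also have "\<dots> = (\<Sum>k\<in>bad n. ennreal (1 / real b ^ n))"
      using b0[of n] by (intro sum.cong) (auto simp: divide_right_mono diff_divide_distrib[symmetric])
    also have "\<dots> = ennreal (real (card (bad n)) * (1 / real b ^ n))"
      unfolding sum_constant ennreal_of_nat_eq_real_of_nat by (rule ennreal_mult[symmetric]) (use b0[of n] in auto)
    also have "\<dots> \<le> ennreal ((11 / 16) ^ n)"
    proof (rule ennreal_leI)
      have "real (card (bad n)) * (1 / real b ^ n) \<le> (11 / 16 * real b) ^ n * (1 / real b ^ n)"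
        using card_bad[OF few, of n] b0[of n] by (intro mult_right_mono) auto
      also have "\<dots> = (11 / 16) ^ n" using b0[of n] by (simp only: power_mult_distrib) simp
      finally show "real (card (bad n)) * (1 / real b ^ n) \<le> (11 / 16) ^ n" .
    qed
    finally show ?thesis .
  qed
  have V0: "V N \<in> null_sets lborel" for N
  proof (rule null_setsI[OF _ Ve])
    have "emeasure lborel (V N) \<le> ennreal ((11 / 16) ^ n)" if "N \<le> n" for n
    proof -
      have "V N \<subseteq> W n" using that by (auto simp: V_def)
      from emeasure_mono[OF this Wm] show ?thesis using We[of n] by (rule order_trans)
    qed
    moreover have "(\<lambda>n. ennreal ((11 / 16) ^ n)) \<longlonglongrightarrow> ennreal 0"
      by (intro tendsto_ennrealI LIMSEQ_realpow_zero) auto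
    ultimately have "emeasure lborel (V N) \<le> ennreal 0"
      by (intro LIMSEQ_le_const[of _ _ "emeasure lborel (V N)"]) auto
    then show "emeasure lborel (V N) = 0" by simp
  qed
  have "{1} \<union> (\<Union>N. V N) \<in> null_sets lborel"
  proof (rule null_sets.Un)
    show "{1 :: real} \<in> null_sets lborel" by (rule null_setsI) auto
    show "(\<Union>N. V N) \<in> null_sets lborel" by (rule null_sets_UN) (rule V0)
  qed
  moreover have "\<exists>n\<ge>N. idx t n \<in> good n" if t: "t \<in> {0..1} - ({1} \<union> (\<Union>N. V N))" for t N
  proof (rule ccontr)
    assume no: "\<not> (\<exists>n\<ge>N. idx t n \<in> good n)"
    have t01: "0 \<le> t" "t < 1" using t by auto
    have "t \<in> W n" if "N \<le> n" for n
    proof -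
      have "real b ^ n * t < real b ^ n" using t01 b0[of n] by simp
      then have "real (idx t n) < real (b ^ n)"
        using idx_bounds(1)[OF t01(1), of n] unfolding of_nat_power by linarith
      then have "idx t n < b ^ n" by (simp only: of_nat_less_iff)
      then have "idx t n \<in> bad n" using no that by (auto simp: good_def bad_def not_le)
      moreover have "t \<in> {real (idx t n) / real b ^ n..<(real (idx t n) + 1) / real b ^ n}"
        using idx_bounds[OF t01(1), of n] b0[of n] by (simp add: field_simps)
      ultimately show ?thesis unfolding W_def by blast
    qed
    then have "t \<in> V N" by (simp add: V_def)
    then show False using t by blast
  qed
  ultimately show ?thesis by blast
qed

lemma finite_good: "finite (good n)" "card (good n) \<le> b ^ n"
proof -
  have "good n \<subseteq> {..<b ^ n}" by (auto simp: good_def)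
  then show "finite (good n)" "card (good n) \<le> b ^ n"
    using finite_subset[of "good n" "{..<b ^ n}"] card_mono[of "{..<b ^ n}" "good n"] by simp_all
qed

text \<open>Generation \<open>n\<close> has at most \<open>(card I * b) ^ n\<close> balls, each
  costing a constant times \<open>(1 / 2) powr (D / 2 * e * n)\<close>; by \<open>small\<close> the
  costs form a convergent geometric series.\<close>

lemma core_measure_zero:
  assumes I: "finite I" and e: "0 < e" and D: "0 < D"
    and small: "real (card I) * real b * (1 / 2) powr (real D / 2 * e) < 1"
  shows "hausdorff_measure Y dist e (core \<inter> Y) = 0"
  unfolding core_def
proof (rule hausdorff_measure_limsup_balls)
  have fin: "finite (({..<n} \<rightarrow>\<^sub>E I) \<times> good n)" for n
    using I finite_good by (intro finite_cartesian_product finite_PiE) auto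
  show "finite (centres n)" for n unfolding centres_def using fin by blast
  have card: "real (card (centres n)) \<le> (real (card I) * real b) ^ n" for n
  proof -
    have "card (centres n) \<le> card (({..<n} \<rightarrow>\<^sub>E I) \<times> good n)"
      unfolding centres_def by (rule card_image_le[OF fin])
    also have "\<dots> = card I ^ n * card (good n)" by (simp add: card_cartesian_product card_PiE)
    also have "\<dots> \<le> card I ^ n * b ^ n" using finite_good(2) by (intro mult_left_mono) auto
    finally have "real (card (centres n)) \<le> real (card I ^ n * b ^ n)" by (rule of_nat_mono)
    then show ?thesis by (simp add: power_mult_distrib)
  qed
  have pow: "(1 / 2 :: real) powr (x * real n) = ((1 / 2) powr x) ^ n" for x n
    by (simp add: powr_powr[symmetric] powr_realpow)
  show r: "0 \<le> radius n" for n by (simp add: radius_def)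
  have "(\<lambda>n. 12 / 10 * ((1 / 2) powr (real D / 2)) ^ n) \<longlonglongrightarrow> 12 / 10 * 0"
  proof (intro tendsto_mult tendsto_const LIMSEQ_realpow_zero)
    show "(1 / 2 :: real) powr (real D / 2) < 1"
    proof -
      have "(1 / 2 :: real) powr (real D / 2) < (1 / 2) powr 0"
        using D by (intro powr_less_mono') auto
      then show ?thesis by simp
    qed
  qed simp
  moreover have "radius = (\<lambda>n. 12 / 10 * ((1 / 2) powr (real D / 2)) ^ n)"
    by (simp only: radius_def[abs_def] pow)
  ultimately show "radius \<longlonglongrightarrow> 0" by simp
  show "summable (\<lambda>n. real (card (centres n)) * (2 * radius n) powr e)"
  proof (rule summable_comparison_test')
    let ?\<theta> = "real (card I) * real b * (1 / 2) powr (real D / 2 * e)"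
    show "summable (\<lambda>n. (24 / 10) powr e * ?\<theta> ^ n)"
      using small by (intro summable_mult summable_geometric) simp
    fix n :: nat
    have "(2 * radius n) powr e = (24 / 10) powr e * ((1 / 2) powr (real D / 2 * real n)) powr e"
      by (simp add: radius_def powr_mult[symmetric])
    also have "((1 / 2 :: real) powr (real D / 2 * real n)) powr e = ((1 / 2) powr (real D / 2 * e)) ^ n"
      by (simp add: powr_powr pow[symmetric] mult.commute mult.left_commute)
    finally have "real (card (centres n)) * (2 * radius n) powr e
      \<le> (real (card I) * real b) ^ n * ((24 / 10) powr e * ((1 / 2) powr (real D / 2 * e)) ^ n)"
      using card[of n] by (simp add: mult_right_mono)
    then show "norm (real (card (centres n)) * (2 * radius n) powr e) \<le> (24 / 10) powr e * ?\<theta> ^ n"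
      by (simp add: power_mult_distrib mult.commute mult.left_commute)
  qed
qed (rule e)

lemma core_borel: "core \<in> sets borel"
  if "finite I"
proof -
  have "finite (centres n)" for n
    unfolding centres_def using that finite_good
    by (intro finite_imageI finite_cartesian_product finite_PiE) auto
  then have "(\<Union>n\<in>{N..}. \<Union>c\<in>centres n. cball c (radius n)) \<in> sets borel" for N
    by (intro sets.countable_UN') auto
  then show ?thesis unfolding core_def by (intro sets.countable_INT'') auto
qed

text \<open>Points mapped outside \<open>core\<close> lie over the null set \<open>Z\<close> of
  times, and \<open>Z \<times> UNIV\<close> is null for the product with any sigma-finite
  \<open>\<nu>\<close>. \<open>X\<close> and \<open>Y\<close> are left general: the embedding is
  tested on the whole product with target \<open>UNIV\<close>, the conformal dimension on the
  support with target its image.\<close>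

lemma push_forward_hdim_le:
  fixes \<nu> :: "'v measure"
  assumes I: "finite I" and e: "0 < e" and D: "0 < D" and few: "8 * (a + 2 * D + 4) \<le> b"
    and small: "real (card I) * real b * (1 / 2) powr (real D / 2 * e) < 1"
    and \<nu>: "sets \<nu> = sets borel" "sigma_finite_measure \<nu>"
    and X: "X \<subseteq> {0..1} \<times> E" "X \<in> sets borel" and Y: "embed ` X \<subseteq> Y"
  shows "measure_hdim Y dist (push_forward X Y dist embed (unit_lebesgue \<Otimes>\<^sub>M \<nu>)) \<le> ennreal e"
proof -
  define \<mu> where "\<mu> = unit_lebesgue \<Otimes>\<^sub>M \<nu>"
  interpret \<nu>: sigma_finite_measure \<nu> by fact
  have "sets \<mu> = sets (borel \<Otimes>\<^sub>M borel)"
    unfolding \<mu>_def by (intro sets_pair_measure_cong \<nu>) (simp add: unit_lebesgue_def)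
  then have \<mu>: "sets \<mu> = sets borel" by (simp only: borel_prod)
  have m: "embed \<in> measurable (restrict_space \<mu> X) (metric_borel Y dist)"
    by (rule continuous_on_measurable_metric_borel[OF continuous_on_subset[OF continuous X(1)] Y \<mu> X(2)])
  have sp: "space (metric_borel Y dist) = Y"
    by (rule sets_metric_borel(2)) (rule Met_TC.subspace, simp)
  have spX: "space (restrict_space \<mu> X) = X"
    using sets_eq_imp_space_eq[OF \<mu>] by (simp add: space_restrict_space)
  have AY: "core \<inter> Y \<in> sets (metric_borel Y dist)" by (rule Int_in_metric_borel[OF core_borel[OF I]])
  obtain Z where Z: "Z \<in> null_sets lborel" and good: "\<forall>t\<in>{0..1} - Z. \<forall>N. \<exists>n\<ge>N. idx t n \<in> good n"
    using almost_all_good[OF few] by blast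
  have "emeasure unit_lebesgue Z = 0"
  proof -
    have "AE x in lborel. x \<notin> Z" using Z by (rule AE_not_in)
    then have "Z \<in> null_sets unit_lebesgue"
      unfolding unit_lebesgue_def using Z by (subst null_sets_density_iff) (auto elim: eventually_mono)
    then show ?thesis by auto
  qed
  then have ZE: "emeasure \<mu> (Z \<times> UNIV) = 0"
    unfolding \<mu>_def using Z \<nu>(1)
    by (subst \<nu>.emeasure_pair_measure_Times) (auto simp: unit_lebesgue_def)
  have ZUs: "Z \<times> UNIV \<in> sets \<mu>"
    unfolding \<mu>_def using Z \<nu>(1) by (intro pair_measureI) (auto simp: unit_lebesgue_def)
  have pre: "embed -` (Y - core \<inter> Y) \<inter> X \<subseteq> Z \<times> UNIV"
  proof
    fix p assume p: "p \<in> embed -` (Y - core \<inter> Y) \<inter> X"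
    then obtain t x where tx: "p = (t, x)" "embed (t, x) \<notin> core" "t \<in> {0..1}" "x \<in> E"
      using X(1) by (cases p) auto
    then have "\<not> (\<forall>N. \<exists>n\<ge>N. idx t n \<in> good n)" using embed_in_core[of x t] by auto
    then show "p \<in> Z \<times> UNIV" using good tx by blast
  qed
  have pX: "embed -` (Y - core \<inter> Y) \<inter> X \<in> sets (restrict_space \<mu> X)"
    using measurable_sets[OF m, of "Y - core \<inter> Y"] sets.compl_sets[OF AY] by (simp add: sp spX)
  have "emeasure (push_forward X Y dist embed \<mu>) (Y - core \<inter> Y) = emeasure (restrict_space \<mu> X) (embed -` (Y - core \<inter> Y) \<inter> X)"
    unfolding push_forward_def using emeasure_distr[OF m, of "Y - core \<inter> Y"] sets.compl_sets[OF AY] by (simp add: sp spX)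
  also have "\<dots> = emeasure \<mu> (embed -` (Y - core \<inter> Y) \<inter> X)"
    using X(2) \<mu> sets_eq_imp_space_eq[OF \<mu>] by (intro emeasure_restrict_space) auto
  also have "\<dots> \<le> emeasure \<mu> (Z \<times> UNIV)" by (rule emeasure_mono[OF pre ZUs])
  finally have null: "emeasure (push_forward X Y dist embed \<mu>) (space (push_forward X Y dist embed \<mu>) - core \<inter> Y) = 0"
    using ZE by (simp add: push_forward_def sp)
  have "measure_hdim Y dist (push_forward X Y dist embed \<mu>) \<le> hausdorff_dim Y dist (core \<inter> Y)"
    unfolding measure_hdim_def
    by (rule Inf_lower) (use null AY in \<open>auto simp: push_forward_def\<close>)
  also have "\<dots> \<le> ennreal e"
    unfolding hausdorff_dim_def using core_measure_zero[OF I e D small] e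
    by (intro Inf_lower) (auto intro!: exI[of _ e])
  finally show ?thesis by (simp add: \<mu>_def)
qed

end

section \<open>Radix expansions\<close>

definition radix_value :: "nat \<Rightarrow> (nat \<Rightarrow> nat) \<Rightarrow> real" where
  "radix_value b a = (\<Sum>i. real (a i) / real b ^ Suc i)"

lemma radix_geometric:
  assumes "2 \<le> b"
  shows "(\<lambda>i. c / real b ^ Suc i) sums (c / (real b - 1))"
proof -
  have "(\<lambda>i. c / real b * (1 / real b) ^ i) sums (c / real b * (1 / (1 - 1 / real b)))"
    using assms by (intro sums_mult geometric_sums) simp
  moreover have "c / real b * (1 / (1 - 1 / real b)) = c / (real b - 1)"
    using assms by (simp add: field_simps)
  moreover have "(\<lambda>i. c / real b * (1 / real b) ^ i) = (\<lambda>i. c / real b ^ Suc i)"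
    by (simp add: power_one_over)
  ultimately show ?thesis by (simp only:)
qed

text \<open>The case \<open>p = b\<close> is included because the Hoelder map in the proof of
  positive measure reads digits below \<open>p\<close> in base \<open>p\<close>.\<close>

context
  fixes p b :: nat
  assumes pb: "2 \<le> p" "p \<le> b"
begin

lemma radix_summable:
  assumes "\<And>i. a i < p"
  shows "summable (\<lambda>i. real (a i) / real b ^ Suc i)"
proof (rule summable_comparison_test')
  show "summable (\<lambda>i. real p / real b ^ Suc i)"
    using radix_geometric[of b "real p"] pb by (auto intro: sums_summable)
  show "norm (real (a i) / real b ^ Suc i) \<le> real p / real b ^ Suc i" for i
    using assms[of i] by (simp add: divide_right_mono)
qed

lemma radix_value_bounds:
  assumes "\<And>i. a i < p"
  shows "0 \<le> radix_value b a" "radix_value b a \<le> (real p - 1) / (real b - 1)" "radix_value b a \<le> 1"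
proof -
  show "0 \<le> radix_value b a"
    unfolding radix_value_def by (intro suminf_nonneg radix_summable assms) auto
  have "radix_value b a \<le> (\<Sum>i. (real p - 1) / real b ^ Suc i)"
    unfolding radix_value_def
  proof (intro suminf_le radix_summable assms)
    show "summable (\<lambda>i. (real p - 1) / real b ^ Suc i)"
      using radix_geometric[of b "real p - 1"] pb by (auto intro: sums_summable)
    show "real (a i) / real b ^ Suc i \<le> (real p - 1) / real b ^ Suc i" for i
      using assms[of i] by (intro divide_right_mono) auto
  qed
  also have "\<dots> = (real p - 1) / (real b - 1)"
    using radix_geometric[of b "real p - 1"] pb by (simp add: sums_iff)
  finally show 1: "radix_value b a \<le> (real p - 1) / (real b - 1)" .
  have "(real p - 1) / (real b - 1) \<le> 1" using pb by (simp add: divide_le_eq)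
  then show "radix_value b a \<le> 1" using 1 by linarith
qed

lemma radix_value_split:
  assumes "\<And>i. a i < p"
  shows "radix_value b a = (\<Sum>i<n. real (a i) / real b ^ Suc i) + radix_value b (\<lambda>i. a (i + n)) / real b ^ n"
proof -
  have "radix_value b a = (\<Sum>i. real (a (i + n)) / real b ^ Suc (i + n)) + (\<Sum>i<n. real (a i) / real b ^ Suc i)"
    unfolding radix_value_def by (rule suminf_split_initial_segment[OF radix_summable[OF assms]])
  also have "(\<Sum>i. real (a (i + n)) / real b ^ Suc (i + n)) = (\<Sum>i. real (a (i + n)) / real b ^ Suc i / real b ^ n)"
    by (simp add: power_add mult.assoc)
  also have "\<dots> = radix_value b (\<lambda>i. a (i + n)) / real b ^ n"
    unfolding radix_value_def using radix_summable[of "\<lambda>i. a (i + n)"] assms by (intro suminf_divide) auto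
  finally show ?thesis by simp
qed

lemma radix_value_close:
  assumes "\<And>i. a i < p" "\<And>i. a' i < p" and agree: "\<And>i. i < n \<Longrightarrow> a i = a' i"
  shows "\<bar>radix_value b a - radix_value b a'\<bar> \<le> 1 / real b ^ n"
proof -
  let ?r = "radix_value b (\<lambda>i. a (i + n))" and ?r' = "radix_value b (\<lambda>i. a' (i + n))"
  have "(\<Sum>i<n. real (a i) / real b ^ Suc i) = (\<Sum>i<n. real (a' i) / real b ^ Suc i)"
    using agree by simp
  then have "radix_value b a - radix_value b a' = (?r - ?r') / real b ^ n"
    using radix_value_split[of a n] radix_value_split[of a' n] assms by (simp add: diff_divide_distrib)
  moreover have "\<bar>?r - ?r'\<bar> \<le> 1"
    using radix_value_bounds[of "\<lambda>i. a (i + n)"] radix_value_bounds[of "\<lambda>i. a' (i + n)"] assms(1,2)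
    by (simp add: abs_le_iff)
  ultimately show ?thesis by (simp add: divide_right_mono)
qed

text \<open>At the first differing position \<open>j\<close> the digits differ by at least 1 and the
  tails by at most \<open>(p - 1) / (b - 1)\<close>. The remaining \<open>(b - p) / (b - 1)\<close>
  counts at scale \<open>1 / b ^ Suc j\<close>, and \<open>j \<le> n \<le> m\<close>.\<close>

lemma radix_value_far:
  assumes a: "\<And>i. a i < p" "\<And>i. a' i < p" and ne: "a n \<noteq> a' n" and m: "n \<le> m"
  shows "(real b - real p) / (real b - 1) / real b ^ Suc m \<le> \<bar>radix_value b a - radix_value b a'\<bar>"
proof -
  define j where "j = (LEAST j. a j \<noteq> a' j)"
  have j: "a j \<noteq> a' j" "j \<le> n" "\<And>i. i < j \<Longrightarrow> a i = a' i"
    unfolding j_def using ne LeastI[of "\<lambda>j. a j \<noteq> a' j" n] Least_le[of "\<lambda>j. a j \<noteq> a' j" n]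
      not_less_Least[of _ "\<lambda>j. a j \<noteq> a' j"] by blast+
  let ?r = "radix_value b (\<lambda>i. a (i + Suc j))" and ?r' = "radix_value b (\<lambda>i. a' (i + Suc j))"
  let ?g = "(real b - real p) / (real b - 1)"
  have b0: "0 < real b" using pb by simp
  have "(\<Sum>i<j. real (a i) / real b ^ Suc i) = (\<Sum>i<j. real (a' i) / real b ^ Suc i)"
    using j(3) by simp
  then have "radix_value b a - radix_value b a' = (real (a j) - real (a' j) + (?r - ?r')) / real b ^ Suc j"
    using radix_value_split[of a "Suc j"] radix_value_split[of a' "Suc j"] a
    by (simp add: diff_divide_distrib add_divide_distrib)
  then have eq: "\<bar>radix_value b a - radix_value b a'\<bar> = \<bar>real (a j) - real (a' j) + (?r - ?r')\<bar> / real b ^ Suc j"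
    using b0 by (simp add: abs_divide)
  have "0 \<le> radix_value b (\<lambda>i. c (i + Suc j)) \<and> radix_value b (\<lambda>i. c (i + Suc j)) \<le> (real p - 1) / (real b - 1)"
    if "\<And>i. c i < p" for c
    using radix_value_bounds(1,2)[of "\<lambda>i. c (i + Suc j)"] that by blast
  from this[of a, OF a(1)] this[of a', OF a(2)]
  have "\<bar>?r - ?r'\<bar> \<le> (real p - 1) / (real b - 1)"
    by linarith
  moreover have "1 \<le> \<bar>real (a j) - real (a' j)\<bar>" using j(1) by linarith
  moreover have "?g = 1 - (real p - 1) / (real b - 1)" using pb by (simp add: field_simps)
  ultimately have "?g \<le> \<bar>real (a j) - real (a' j) + (?r - ?r')\<bar>" by linarith
  then have "?g / real b ^ Suc j \<le> \<bar>radix_value b a - radix_value b a'\<bar>"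
    unfolding eq using b0 by (intro divide_right_mono) auto
  moreover have "?g / real b ^ Suc m \<le> ?g / real b ^ Suc j"
    using pb j(2) m by (intro divide_left_mono power_increasing) auto
  ultimately show ?thesis by linarith
qed

end

text \<open>With digits read off floors, the partial sums are
  \<open>\<lfloor>p ^ n * y\<rfloor> / p ^ n\<close>; the integer part vanishes because
  \<open>y < 1\<close>.\<close>

lemma radix_expansion:
  assumes p: "2 \<le> p" and y: "0 \<le> y" "y < 1"
  obtains a where "\<And>i. a i < p" "radix_value p a = y"
proof -
  define a where "a i = nat \<lfloor>real p ^ Suc i * y\<rfloor> mod p" for i
  have "\<lfloor>real p ^ Suc n * y\<rfloor> div int p = \<lfloor>real p ^ n * y\<rfloor>" for n
    using floor_divide_real_eq_div[of "int p" "real p ^ Suc n * y"] p by simp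
  then have "nat \<lfloor>real p ^ Suc n * y\<rfloor> div p = nat \<lfloor>real p ^ n * y\<rfloor>" for n
    by (metis nat_div_distrib' nat_int of_nat_0_le_iff)
  then have step: "nat \<lfloor>real p ^ Suc n * y\<rfloor> = p * nat \<lfloor>real p ^ n * y\<rfloor> + a n" for n
    unfolding a_def by (metis mult_div_mod_eq)
  have partial: "(\<Sum>i<n. real (a i) / real p ^ Suc i) = real (nat \<lfloor>real p ^ n * y\<rfloor>) / real p ^ n" for n
  proof (induction n)
    case 0
    have "\<lfloor>y\<rfloor> = 0" using y by (simp add: floor_eq_iff)
    then show ?case by simp
  next
    case (Suc n)
    show ?case using p by (simp only: sum.lessThan_Suc Suc step) (simp add: field_simps)
  qed
  have "(\<lambda>n. \<Sum>i<n. real (a i) / real p ^ Suc i) \<longlonglongrightarrow> y"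
  proof (rule tendsto_sandwich)
    have fl: "real p ^ n * y - 1 \<le> real (nat \<lfloor>real p ^ n * y\<rfloor>)" "real (nat \<lfloor>real p ^ n * y\<rfloor>) \<le> real p ^ n * y" for n
    proof -
      have "real (nat \<lfloor>real p ^ n * y\<rfloor>) = of_int \<lfloor>real p ^ n * y\<rfloor>" using y by simp
      then show "real p ^ n * y - 1 \<le> real (nat \<lfloor>real p ^ n * y\<rfloor>)" "real (nat \<lfloor>real p ^ n * y\<rfloor>) \<le> real p ^ n * y"
        by linarith+
    qed
    have p0: "0 < real p ^ n" for n using p by simp
    have "y - 1 / real p ^ n = (real p ^ n * y - 1) / real p ^ n" "y = real p ^ n * y / real p ^ n" for n
      using p0[of n] by (simp_all add: diff_divide_distrib)
    then have "y - 1 / real p ^ n \<le> (\<Sum>i<n. real (a i) / real p ^ Suc i)" "(\<Sum>i<n. real (a i) / real p ^ Suc i) \<le> y" for n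
      unfolding partial using fl[of n] p0[of n] by (metis divide_right_mono less_imp_le)+
    then show "\<forall>\<^sub>F n in sequentially. y - 1 / real p ^ n \<le> (\<Sum>i<n. real (a i) / real p ^ Suc i)"
      "\<forall>\<^sub>F n in sequentially. (\<Sum>i<n. real (a i) / real p ^ Suc i) \<le> y"
      by (intro always_eventually allI; blast)+
    have "(\<lambda>n. 1 / real p ^ n) \<longlonglongrightarrow> 0" using p by (intro LIMSEQ_divide_realpow_zero) simp
    then show "(\<lambda>n. y - 1 / real p ^ n) \<longlonglongrightarrow> y" using tendsto_diff[OF tendsto_const[of y]] by force
  qed simp
  then have "radix_value p a = y"
    unfolding radix_value_def by (simp add: sums_def[symmetric] sums_iff)
  moreover have "a i < p" for i using p by (simp add: a_def)
  ultimately show thesis using that by blast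
qed

section \<open>A Cantor set of prescribed dimension\<close>

definition radix_point :: "nat \<Rightarrow> ('n \<Rightarrow> nat \<Rightarrow> nat) \<Rightarrow> real ^ 'n::finite" where
  "radix_point b a = (\<chi> k. radix_value b (a k))"

definition radix_cantor :: "nat \<Rightarrow> nat \<Rightarrow> (real ^ 'n::finite) set" where
  "radix_cantor p b = radix_point b ` {a. \<forall>k i. a k i < p}"

definition radix_digits :: "nat \<Rightarrow> nat \<Rightarrow> real ^ 'n::finite \<Rightarrow> 'n \<Rightarrow> nat \<Rightarrow> nat" where
  "radix_digits p b x = (SOME a. (\<forall>k i. a k i < p) \<and> radix_point b a = x)"

lemma radix_digits:
  assumes "x \<in> radix_cantor p b"
  shows "radix_digits p b x k i < p" "radix_point b (radix_digits p b x) = x"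
proof -
  have "\<exists>a. (\<forall>k i. a k i < p) \<and> radix_point b a = x" using assms by (auto simp: radix_cantor_def)
  from someI_ex[OF this, folded radix_digits_def]
  show "radix_digits p b x k i < p" "radix_point b (radix_digits p b x) = x" by auto
qed

locale radix_set =
  fixes p b :: nat
  assumes p2: "2 \<le> p" and pb: "p < b"
begin

definition gap :: real where
  "gap = (real b - real p) / (real b - 1)"

lemma gap_pos: "0 < gap"
  using p2 pb by (simp add: gap_def)

lemma radix_point_close:
  fixes a a' :: "'n::finite \<Rightarrow> nat \<Rightarrow> nat"
  assumes a: "\<And>k i. a k i < p" "\<And>k i. a' k i < p" and agree: "\<And>k i. i < n \<Longrightarrow> a k i = a' k i"
  shows "dist (radix_point b a) (radix_point b a') \<le> real CARD('n) / real b ^ n"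
proof -
  have "dist (radix_point b a) (radix_point b a') \<le> (\<Sum>k\<in>UNIV. \<bar>(radix_point b a - radix_point b a') $ k\<bar>)"
    unfolding dist_norm by (rule norm_le_l1_cart)
  also have "\<dots> \<le> (\<Sum>k\<in>(UNIV::'n set). 1 / real b ^ n)"
    using p2 pb a agree by (intro sum_mono) (auto simp: radix_point_def intro!: radix_value_close[of p b])
  finally show ?thesis by simp
qed

lemma radix_point_far:
  fixes a a' :: "'n::finite \<Rightarrow> nat \<Rightarrow> nat"
  assumes a: "\<And>k i. a k i < p" "\<And>k i. a' k i < p" and ne: "a k i \<noteq> a' k i" and n: "i \<le> n"
  shows "gap / real b ^ Suc n \<le> dist (radix_point b a) (radix_point b a')"
proof -
  have "gap / real b ^ Suc n \<le> \<bar>radix_value b (a k) - radix_value b (a' k)\<bar>"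
    unfolding gap_def using p2 pb a ne n by (intro radix_value_far) auto
  also have "\<dots> = \<bar>(radix_point b a - radix_point b a') $ k\<bar>" by (simp add: radix_point_def)
  also have "\<dots> \<le> dist (radix_point b a) (radix_point b a')"
    unfolding dist_norm by (rule component_le_norm_cart)
  finally show ?thesis .
qed

text \<open>Along a convergent sequence every digit stabilises, since points with different
  \<open>n\<close>-th digits keep a positive distance by \<open>radix_point_far\<close>. The stable
  digits then represent the limit.\<close>

lemma compact_radix_cantor: "compact (radix_cantor p b :: (real ^ 'n::finite) set)"
proof -
  let ?E = "radix_cantor p b :: (real ^ 'n) set"
  have "closed ?E"
    unfolding closed_sequential_limits
  proof (intro allI impI)
    fix x :: "nat \<Rightarrow> real ^ 'n" and l
    assume "(\<forall>m. x m \<in> ?E) \<and> x \<longlonglongrightarrow> l"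
    then have x: "\<And>m. x m \<in> ?E" and lim: "x \<longlonglongrightarrow> l" by auto
    define d where "d m = radix_digits p b (x m)" for m
    have d: "d m k i < p" "radix_point b (d m) = x m" for m k i
      unfolding d_def using radix_digits[OF x[of m]] by auto
    have "\<exists>M. \<forall>m\<ge>M. \<forall>m'\<ge>M. \<forall>k. d m k n = d m' k n" for n
    proof -
      have "0 < gap / real b ^ Suc n" using gap_pos p2 pb by simp
      then obtain M where M: "\<And>m m'. M \<le> m \<Longrightarrow> M \<le> m' \<Longrightarrow> dist (x m) (x m') < gap / real b ^ Suc n"
        using metric_CauchyD[OF LIMSEQ_imp_Cauchy[OF lim]] by blast
      have "d m k n = d m' k n" if "M \<le> m" "M \<le> m'" for m m' k
        using M[OF that] radix_point_far[of "d m" "d m'" k n n] d by fastforce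
      then show ?thesis by blast
    qed
    then obtain M where M: "\<And>n m m' k. M n \<le> m \<Longrightarrow> M n \<le> m' \<Longrightarrow> d m k n = d m' k n" by metis
    define a where "a k n = d (M n) k n" for k n
    have a: "a k n < p" for k n by (simp add: a_def d)
    have "x \<longlonglongrightarrow> radix_point b a"
    proof (rule metric_LIMSEQ_I)
      fix e :: real assume e: "0 < e"
      have "(\<lambda>n. real CARD('n) / real b ^ n) \<longlonglongrightarrow> 0"
        using p2 pb by (intro LIMSEQ_divide_realpow_zero) simp
      then have "\<forall>\<^sub>F n in sequentially. real CARD('n) / real b ^ n < e" using e by (rule order_tendstoD(2))
      then obtain n where n: "real CARD('n) / real b ^ n < e" unfolding eventually_sequentially by blast
      \<comment> \<open>The sum dominates every \<open>M i\<close> with \<open>i < n\<close> and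
        stands in for their maximum.\<close>
      have "dist (x m) (radix_point b a) < e" if m: "(\<Sum>i<n. M i) \<le> m" for m
      proof -
        have "M i \<le> m" if "i < n" for i using member_le_sum[of i "{..<n}" M] that m by auto
        then have "d m k i = a k i" if "i < n" for k i using M[of i m "M i" k] that by (simp add: a_def)
        then have "dist (radix_point b (d m)) (radix_point b a) \<le> real CARD('n) / real b ^ n"
          by (intro radix_point_close d a)
        then show ?thesis using n d(2) by simp
      qed
      then show "\<exists>no. \<forall>m\<ge>no. dist (x m) (radix_point b a) < e" by blast
    qed
    then have "l = radix_point b a" using lim LIMSEQ_unique by blast
    then show "l \<in> ?E" using a by (auto simp: radix_cantor_def)
  qed
  moreover have "bounded ?E"
  proof (rule boundedI)
    fix y assume "y \<in> ?E"
    then obtain a where a: "\<And>k i. a k i < p" "y = radix_point b a" by (auto simp: radix_cantor_def)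
    have "norm y \<le> (\<Sum>k\<in>UNIV. \<bar>y $ k\<bar>)" by (rule norm_le_l1_cart)
    also have "\<dots> \<le> (\<Sum>k\<in>(UNIV::'n set). 1)"
      using radix_value_bounds[of p b] p2 pb a by (intro sum_mono) (auto simp: radix_point_def)
    finally show "norm y \<le> real CARD('n)" by simp
  qed
  ultimately show ?thesis by (simp add: compact_eq_bounded_closed)
qed

text \<open>With N the dimension, the \<open>p ^ (N * n)\<close> cylinders of depth \<open>n\<close>
  have diameter at most \<open>N / b ^ n\<close>, and \<open>b powr s = p ^ N\<close> makes the
  resulting bound \<open>N powr s\<close> for every \<open>n\<close>.\<close>

lemma hausdorff_measure_finite:
  fixes s :: real
  assumes s: "0 < s" "real b powr s = real p ^ CARD('n)"
  shows "hausdorff_measure UNIV dist s (radix_cantor p b :: (real ^ 'n::finite) set) < \<infinity>"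
proof -
  let ?E = "radix_cantor p b :: (real ^ 'n) set" and ?N = "real CARD('n)"
  have b0: "0 < real b" "1 < real b" using p2 pb by auto
  have "hausdorff_pre UNIV dist \<delta> s ?E \<le> ennreal (?N powr s)" if \<delta>: "0 < \<delta>" for \<delta>
  proof -
    have "(\<lambda>n. ?N / real b ^ n) \<longlonglongrightarrow> 0" using b0 by (intro LIMSEQ_divide_realpow_zero) simp
    then have "\<forall>\<^sub>F n in sequentially. ?N / real b ^ n < \<delta>" using \<delta> by (rule order_tendstoD(2))
    then obtain n where n: "?N / real b ^ n < \<delta>" unfolding eventually_sequentially by blast
    \<comment> \<open>One finite cover is presented as a sequence of families that are empty after
      the first.\<close>
    define C :: "nat \<Rightarrow> ('n \<Rightarrow> nat \<Rightarrow> nat) set" where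
      "C m = (if m = 0 then UNIV \<rightarrow>\<^sub>E ({..<n} \<rightarrow>\<^sub>E {..<p}) else {})" for m
    define B where "B c = radix_point b ` {a. (\<forall>k i. a k i < p) \<and> (\<forall>k. \<forall>i<n. a k i = c k i)}" for c :: "'n \<Rightarrow> nat \<Rightarrow> nat"
    have "hausdorff_pre UNIV dist \<delta> s ?E \<le> (\<Sum>m. of_nat (card (C m)) * ennreal ((?N / real b ^ n) powr s))"
    proof (rule hausdorff_pre_le[where B = "\<lambda>m. B"])
      show "finite (C m)" for m by (auto simp: C_def intro!: finite_PiE)
      show "dist x y \<le> ?N / real b ^ n" if "x \<in> B c" "y \<in> B c" for c x y
        using that by (auto simp: B_def intro!: radix_point_close)
      show "?E \<subseteq> (\<Union>m. \<Union>c\<in>C m. B c)"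
      proof
        fix x assume "x \<in> ?E"
        then obtain a where a: "\<And>k i. a k i < p" "x = radix_point b a" by (auto simp: radix_cantor_def)
        let ?c = "\<lambda>k. restrict (a k) {..<n}"
        have "?c \<in> C 0" using a(1) by (simp add: C_def PiE_iff restrict_extensional)
        moreover have "x \<in> B ?c" unfolding B_def using a by auto
        ultimately show "x \<in> (\<Union>m. \<Union>c\<in>C m. B c)" by blast
      qed
    qed (use s n \<delta> in auto)
    also have "\<dots> = of_nat (card (C 0)) * ennreal ((?N / real b ^ n) powr s)"
      by (subst suminf_finite[of "{0}"]) (auto simp: C_def)
    also have "\<dots> = ennreal (real (card (C 0)) * (?N / real b ^ n) powr s)"
      by (simp add: ennreal_mult ennreal_of_nat_eq_real_of_nat)
    also have "real (card (C 0)) * (?N / real b ^ n) powr s = ?N powr s"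
    proof -
      have "real (card (C 0)) = (real p ^ CARD('n)) ^ n"
        by (simp add: C_def card_PiE power_mult[symmetric] mult.commute)
      moreover have "(?N / real b ^ n) powr s = ?N powr s / (real p ^ CARD('n)) ^ n"
      proof -
        have "(real b ^ n) powr s = (real b powr s) ^ n"
          using b0 by (simp add: powr_realpow[symmetric] powr_powr mult.commute)
        then show ?thesis using b0 by (simp add: powr_divide s(2))
      qed
      ultimately show ?thesis using p2 by simp
    qed
    finally show ?thesis .
  qed
  then have "hausdorff_measure UNIV dist s ?E \<le> ennreal (?N powr s)"
    unfolding hausdorff_measure_def by (intro SUP_least) auto
  then show ?thesis using le_less_trans by fastforce
qed

text \<open>Reading the digits in base \<open>p\<close> maps the set onto a cube, and this map is Hoelder continuous.\<close>

lemma hausdorff_measure_positive: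
  fixes s :: real
  assumes s: "0 < s" "real b powr s = real p ^ CARD('n)"
  shows "0 < hausdorff_measure UNIV dist s (radix_cantor p b :: (real ^ 'n::finite) set)"
proof -
  let ?E = "radix_cantor p b :: (real ^ 'n) set" and ?N = "real CARD('n)"
  have b0: "0 < real b" "1 < real b" "0 < real p" using p2 pb by auto
  define h :: "real ^ 'n \<Rightarrow> real ^ 'n" where "h x = radix_point p (radix_digits p b x)" for x
  \<comment> \<open>The exponent with \<open>b powr \<theta> = p\<close>: a first difference at
    digit \<open>j\<close> means a distance of at least order \<open>1 / b ^ j\<close> in the set
    and at most \<open>1 / p ^ j\<close> in the cube.\<close>
  define \<theta> where "\<theta> = s / ?N"
  have \<theta>: "0 < \<theta>" using s by (simp add: \<theta>_def)
  have b\<theta>: "real b powr \<theta> = real p"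
  proof -
    have "real b powr \<theta> = (real p ^ CARD('n)) powr (1 / ?N)"
      unfolding s(2)[symmetric] by (simp add: powr_powr \<theta>_def)
    also have "\<dots> = real p" using b0 by (simp add: powr_realpow[symmetric] powr_powr)
    finally show ?thesis .
  qed
  define K where "K = (real b / gap) powr \<theta>"
  have K: "0 < K" using b0 gap_pos by (simp add: K_def)
  have hoelder: "\<bar>h x $ k - h y $ k\<bar> \<le> K * dist x y powr \<theta>" if x: "x \<in> ?E" and y: "y \<in> ?E" for x y k
  proof -
    let ?a = "radix_digits p b x k" and ?a' = "radix_digits p b y k"
    show ?thesis
    proof (cases "?a = ?a'")
      case True
      then show ?thesis using K by (simp add: h_def radix_point_def)
    next
      case False
      define j where "j = (LEAST j. ?a j \<noteq> ?a' j)"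
      have j: "?a j \<noteq> ?a' j" "\<And>i. i < j \<Longrightarrow> ?a i = ?a' i"
        unfolding j_def using False LeastI_ex[of "\<lambda>j. ?a j \<noteq> ?a' j"] not_less_Least[of _ "\<lambda>j. ?a j \<noteq> ?a' j"] by blast+
      have "\<bar>h x $ k - h y $ k\<bar> \<le> 1 / real p ^ j"
        unfolding h_def radix_point_def using radix_digits(1)[OF x] radix_digits(1)[OF y] p2 j(2)
        by (auto intro!: radix_value_close[of p p])
      also have "\<dots> = (1 / real b ^ j) powr \<theta>"
      proof -
        have "(real b ^ j) powr \<theta> = (real b powr \<theta>) ^ j"
          using b0 by (simp add: powr_realpow[symmetric] powr_powr mult.commute)
        then show ?thesis using b0 by (simp add: powr_divide b\<theta>)
      qed
      also have "\<dots> \<le> (real b / gap * dist x y) powr \<theta>"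
      proof (rule powr_mono2)
        have "gap / real b ^ Suc j \<le> dist x y"
          using radix_point_far[of "radix_digits p b x" "radix_digits p b y" k j j] radix_digits[OF x] radix_digits[OF y] j(1) by simp
        then have "real b / gap * (gap / real b ^ Suc j) \<le> real b / gap * dist x y"
          using b0 gap_pos by (intro mult_left_mono) auto
        then show "1 / real b ^ j \<le> real b / gap * dist x y" using b0 gap_pos by simp
      qed (use \<theta> in auto)
      also have "\<dots> = K * dist x y powr \<theta>" unfolding K_def using b0 gap_pos by (subst powr_mult) auto
      finally show ?thesis .
    qed
  qed
  \<comment> \<open>Faces with a coordinate equal to 1 are left out because
    \<open>radix_expansion\<close> asks for \<open>y < 1\<close>; they form a null set.\<close>
  have onto: "\<exists>x\<in>?E. h x = y" if y: "\<And>k. 0 \<le> y $ k \<and> y $ k < 1" for y :: "real ^ 'n"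
  proof -
    have "\<exists>a. (\<forall>i. a i < p) \<and> radix_value p a = y $ k" for k
      using radix_expansion[OF p2, of "y $ k"] y[of k] by metis
    then obtain a where a: "\<And>k i. a k i < p" "\<And>k. radix_value p (a k) = y $ k" by metis
    have x: "radix_point b a \<in> ?E" using a(1) by (auto simp: radix_cantor_def)
    have "radix_digits p b (radix_point b a) = a"
    proof (rule ccontr)
      assume "radix_digits p b (radix_point b a) \<noteq> a"
      then obtain k i where "radix_digits p b (radix_point b a) k i \<noteq> a k i" by (meson ext)
      then have "gap / real b ^ Suc i \<le> 0"
        using radix_point_far[of "radix_digits p b (radix_point b a)" a k i i] radix_digits[OF x] a(1) by simp
      moreover have "0 < gap / real b ^ Suc i" using gap_pos b0 by simp
      ultimately show False by linarith
    qed
    then have "h (radix_point b a) = y" using a(2) by (simp add: h_def radix_point_def vec_eq_iff)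
    then show ?thesis using x by blast
  qed
  \<comment> \<open>The image of a set of diameter \<open>r\<close> lies in a cube of side
    \<open>2 * K * r powr \<theta>\<close>, whose volume is \<open>(2 * K) ^ N * r powr s\<close>.
    These volumes add up to at least 1.\<close>
  define c where "c = 1 / (2 * K) ^ CARD('n)"
  have c: "0 < c" using K by (simp add: c_def)
  have "ennreal c \<le> hausdorff_pre UNIV dist 1 s ?E"
    unfolding hausdorff_pre_def
  proof (rule Inf_greatest, clarify)
    fix U :: "nat \<Rightarrow> (real ^ 'n) set"
    assume U: "\<forall>i. U i \<subseteq> UNIV \<and> (\<forall>x\<in>U i. \<forall>y\<in>U i. dist x y \<le> 1)" and cover: "?E \<subseteq> (\<Union>i. U i)"
    define \<rho> where "\<rho> i = K * set_diam dist (U i) powr \<theta>" for i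
    define z where "z i = h (SOME x. x \<in> U i \<inter> ?E)" for i
    define Q where "Q i = (if U i \<inter> ?E = {} then {} else cbox (z i - vec (\<rho> i)) (z i + vec (\<rho> i)))" for i
    have \<rho>0: "0 \<le> \<rho> i" for i using K by (simp add: \<rho>_def)
    have diam: "dist x y \<le> set_diam dist (U i)" if "x \<in> U i" "y \<in> U i" for i x y
      using that U by (intro set_diam_bounds(3)[of _ 1]) auto
    have cube: "cbox 0 (vec 1) - {y. \<exists>k. y $ k = 1} \<subseteq> (\<Union>i. Q i)"
    proof
      fix y :: "real ^ 'n" assume y: "y \<in> cbox 0 (vec 1) - {y. \<exists>k. y $ k = 1}"
      then have "0 \<le> y $ k \<and> y $ k < 1" for k by (auto simp: mem_box_cart less_le)
      then obtain x where x: "x \<in> ?E" "h x = y" using onto by blast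
      then obtain i where i: "x \<in> U i" using cover by blast
      define x0 where "x0 = (SOME x. x \<in> U i \<inter> ?E)"
      have x0: "x0 \<in> U i \<inter> ?E" unfolding x0_def by (rule someI[of _ x]) (use x i in auto)
      have "\<bar>h x $ k - h x0 $ k\<bar> \<le> \<rho> i" for k
      proof -
        have "\<bar>h x $ k - h x0 $ k\<bar> \<le> K * dist x x0 powr \<theta>" using hoelder x x0 by auto
        also have "\<dots> \<le> \<rho> i"
          unfolding \<rho>_def using K \<theta> diam[OF i, of x0] x0 by (intro mult_left_mono powr_mono2) auto
        finally show ?thesis .
      qed
      then have "y \<in> cbox (z i - vec (\<rho> i)) (z i + vec (\<rho> i))"
        unfolding z_def x0_def[symmetric] mem_box_cart x(2)[symmetric]
        by (auto simp: abs_le_iff algebra_simps)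
      then show "y \<in> (\<Union>i. Q i)" using x0 by (auto simp: Q_def)
    qed
    have em: "emeasure lborel (cbox l (l + vec r)) = ennreal (r ^ CARD('n))" if "0 \<le> r" for l :: "real ^ 'n" and r
    proof -
      have ne: "cbox l (l + vec r) \<noteq> {}" using that by (auto simp: interval_ne_empty_cart)
      have "emeasure lborel (cbox l (l + vec r)) = ennreal (measure lborel (cbox l (l + vec r)))"
        using emeasure_lborel_cbox_finite[of l "l + vec r"] by (intro emeasure_eq_ennreal_measure) auto
      then show ?thesis using content_cbox_cart[OF ne] by simp
    qed
    have Qm: "Q i \<in> sets lborel" for i by (simp add: Q_def)
    have Qe: "emeasure lborel (Q i) \<le> ennreal ((2 * K) ^ CARD('n)) * diam_pow dist s (U i)" for i
    proof (cases "U i \<inter> ?E = {}")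
      case False
      then have "U i \<noteq> {}" by auto
      then have dp: "diam_pow dist s (U i) = ennreal (set_diam dist (U i) powr s)" using s by (simp add: diam_pow_def)
      have "emeasure lborel (Q i) = ennreal ((2 * \<rho> i) ^ CARD('n))"
      proof -
        have "z i + vec (\<rho> i) = (z i - vec (\<rho> i)) + vec (2 * \<rho> i)" by (simp add: vec_eq_iff)
        then have "Q i = cbox (z i - vec (\<rho> i)) ((z i - vec (\<rho> i)) + vec (2 * \<rho> i))"
          using False by (simp only: Q_def if_False)
        then show ?thesis using em[of "2 * \<rho> i" "z i - vec (\<rho> i)"] \<rho>0[of i] by simp
      qed
      also have "(2 * \<rho> i) ^ CARD('n) = (2 * K) ^ CARD('n) * set_diam dist (U i) powr s"
      proof -
        have "(set_diam dist (U i) powr \<theta>) ^ CARD('n) = set_diam dist (U i) powr s"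
          by (cases "set_diam dist (U i) = 0") (simp_all add: powr_realpow[symmetric] powr_powr \<theta>_def)
        then show ?thesis by (simp add: \<rho>_def power_mult_distrib)
      qed
      finally show ?thesis using K by (simp add: dp ennreal_mult)
    qed (simp add: Q_def)
    have "{y. \<exists>k. y $ k = 1} = (\<Union>k::'n. {y :: real ^ 'n. axis k 1 \<bullet> y = 1})"
      by (auto simp: inner_axis')
    moreover have "{y :: real ^ 'n. axis k 1 \<bullet> y = 1} \<in> null_sets lborel" for k
      using negligible_hyperplane[of "axis k 1 :: real ^ 'n" 1]
      by (auto simp: negligible_iff_null_sets null_sets_completion_iff axis_eq_0_iff closed_hyperplane)
    ultimately have null: "{y :: real ^ 'n. \<exists>k. y $ k = 1} \<in> null_sets lborel" by auto
    have "1 = emeasure lborel (cbox 0 (vec 1) :: (real ^ 'n) set)" using em[of 1 0] by simp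
    also have "\<dots> = emeasure lborel (cbox 0 (vec 1) - {y :: real ^ 'n. \<exists>k. y $ k = 1})"
      using null by (intro emeasure_Diff_null_set[symmetric]) auto
    also have "\<dots> \<le> emeasure lborel (\<Union>i. Q i)" by (rule emeasure_mono[OF cube]) (use Qm in blast)
    also have "\<dots> \<le> (\<Sum>i. emeasure lborel (Q i))" using Qm by (intro emeasure_subadditive_countably) auto
    also have "\<dots> \<le> (\<Sum>i. ennreal ((2 * K) ^ CARD('n)) * diam_pow dist s (U i))"
      by (intro suminf_le Qe summableI)
    also have "\<dots> = ennreal ((2 * K) ^ CARD('n)) * (\<Sum>i. diam_pow dist s (U i))" by simp
    finally have "ennreal c * 1 \<le> ennreal c * (ennreal ((2 * K) ^ CARD('n)) * (\<Sum>i. diam_pow dist s (U i)))"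
      by (rule mult_left_mono) simp
    also have "\<dots> = (\<Sum>i. diam_pow dist s (U i))"
    proof -
      have "ennreal c * ennreal ((2 * K) ^ CARD('n)) = 1"
        using K by (subst ennreal_mult[symmetric]) (auto simp: c_def)
      then show ?thesis by (metis mult.assoc mult_1)
    qed
    finally show "ennreal c \<le> (\<Sum>i. diam_pow dist s (U i))" by simp
  qed
  also have "\<dots> \<le> hausdorff_measure UNIV dist s ?E"
    unfolding hausdorff_measure_def by (rule SUP_upper) simp
  finally show ?thesis using c by (meson ennreal_less_zero_iff less_le_trans)
qed

end

section \<open>Choice of the parameters\<close>

lemma power_at_top:
  fixes x :: real
  assumes "1 < x"
  shows "filterlim (\<lambda>n. x ^ n) at_top sequentially"
  unfolding filterlim_at_top eventually_sequentially
proof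
  fix Z
  obtain n where "Z < x ^ n" using real_arch_pow[OF assms] by blast
  then have "Z \<le> x ^ m" if "n \<le> m" for m
    using power_increasing[OF that, of x] assms by linarith
  then show "\<exists>n. \<forall>m\<ge>n. Z \<le> x ^ m" by blast
qed

text \<open>With \<open>B = b ^ K\<close>, the last expression is at most
  \<open>B ^ Suc N * exp (- c * B)\<close>, a power against an exponential. The constant
  \<open>c\<close> allows for rounding through \<open>B / 200 \<le> B div 100\<close>.\<close>

lemma eventually_block_length:
  fixes p b N :: nat and e :: real
  assumes pb: "1 \<le> p" "p < b" and e: "0 < e"
  shows "\<forall>\<^sub>F K in sequentially. 10000000 * N * p ^ K \<le> b ^ K \<and> 1000 \<le> b ^ K \<and>
    real (p ^ K) ^ N * real (b ^ K) * (1 / 2) powr (real (b ^ K div 100) / 2 * e) < 1"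
proof -
  have b2: "1 < real b" "0 < real p" using pb by auto
  have "filterlim (\<lambda>K. (real b / real p) ^ K) at_top sequentially"
    using pb by (intro power_at_top) auto
  then have 1: "\<forall>\<^sub>F K in sequentially. 10000000 * real N \<le> (real b / real p) ^ K"
    by (simp add: filterlim_at_top)
  have lim: "filterlim (\<lambda>K. real b ^ K) at_top sequentially"
    using b2 by (intro power_at_top) auto
  then have 2: "\<forall>\<^sub>F K in sequentially. 1000 \<le> real b ^ K"
    by (simp add: filterlim_at_top)
  define c where "c = e * ln 2 / 400"
  have c: "0 < c" using e by (simp add: c_def)
  have "filterlim (\<lambda>K. c * real b ^ K) at_top sequentially"
    by (rule filterlim_tendsto_pos_mult_at_top[OF tendsto_const c lim])
  from filterlim_compose[OF tendsto_power_div_exp_0 this]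
  have "(\<lambda>K. (c * real b ^ K) ^ Suc N / exp (c * real b ^ K)) \<longlonglongrightarrow> 0" .
  then have 3: "\<forall>\<^sub>F K in sequentially. (c * real b ^ K) ^ Suc N / exp (c * real b ^ K) < c ^ Suc N"
    using c by (intro order_tendstoD(2)) auto
  show ?thesis
    using 1 2 3
  proof eventually_elim
    case (elim K)
    define B where "B = real b ^ K"
    have B: "1000 \<le> B" using elim by (simp add: B_def)
    have "10000000 * real N * real p ^ K \<le> B"
      using elim(1) b2 by (simp add: B_def power_divide pos_le_divide_eq)
    then have "real (10000000 * N * p ^ K) \<le> real (b ^ K)" by (simp add: B_def)
    then have i: "10000000 * N * p ^ K \<le> b ^ K" by (simp only: of_nat_le_iff)
    have "real 1000 \<le> real (b ^ K)" using B by (simp add: B_def)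
    then have ii: "1000 \<le> b ^ K" by (simp only: of_nat_le_iff)
    have "b ^ K < 100 * (b ^ K div 100) + 100"
      using mod_less_divisor[of 100 "b ^ K"] mult_div_mod_eq[of 100 "b ^ K"] by linarith
    then have "real (b ^ K) < real (100 * (b ^ K div 100) + 100)" by (simp only: of_nat_less_iff)
    then have D: "B / 200 \<le> real (b ^ K div 100)" using B by (simp add: B_def)
    have "real (p ^ K) ^ N * real (b ^ K) * (1 / 2) powr (real (b ^ K div 100) / 2 * e)
      \<le> B ^ N * B * exp (- (c * B))"
    proof (intro mult_mono)
      show "real (p ^ K) ^ N \<le> B ^ N" unfolding B_def of_nat_power using pb by (intro power_mono) auto
      have "(1 / 2 :: real) powr (real (b ^ K div 100) / 2 * e) \<le> (1 / 2) powr (B / 200 / 2 * e)"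
        using D e by (intro powr_mono') (auto intro!: mult_right_mono)
      also have "\<dots> = exp (- (c * B))"
        by (simp add: powr_def c_def ln_div mult.commute)
      finally show "(1 / 2 :: real) powr (real (b ^ K div 100) / 2 * e) \<le> exp (- (c * B))" .
    qed (use B in \<open>auto simp: B_def\<close>)
    also have "\<dots> = B ^ Suc N / exp (c * B)" by (simp add: exp_minus divide_inverse mult.commute)
    also have "\<dots> < 1"
    proof -
      have "c ^ Suc N * (B ^ Suc N / exp (c * B)) < c ^ Suc N * 1"
        using elim(3) unfolding B_def[symmetric] by (simp only: power_mult_distrib times_divide_eq_right mult_1_right)
      then show ?thesis using c by (simp only: mult_less_cancel_left_pos zero_less_power)
    qed
    finally show ?case using i ii by blast
  qed
qed

text \<open>\<open>f\<close> is fixed before the measure. Quantifying over \<open>X\<close> and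
  \<open>Y\<close> covers both the whole product and the support of a particular measure.\<close>

definition flattens :: "(real \<times> 'v::euclidean_space \<Rightarrow> 'w::euclidean_space) \<Rightarrow> 'v set \<Rightarrow> real \<Rightarrow> bool" where
  "flattens f E e \<longleftrightarrow> (\<forall>\<nu> X Y. sets \<nu> = sets borel \<longrightarrow> sigma_finite_measure \<nu> \<longrightarrow>
     X \<subseteq> {0..1} \<times> E \<longrightarrow> X \<in> sets borel \<longrightarrow> f ` X \<subseteq> Y \<longrightarrow>
     measure_hdim Y dist (push_forward X Y dist f (unit_lebesgue \<Otimes>\<^sub>M \<nu>)) \<le> ennreal e)"

lemma flattensD:
  assumes "flattens f E e" "sets \<nu> = sets borel" "sigma_finite_measure \<nu>"
    and "X \<subseteq> {0..1} \<times> E" "X \<in> sets borel" "f ` X \<subseteq> Y"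
  shows "measure_hdim Y dist (push_forward X Y dist f (unit_lebesgue \<Otimes>\<^sub>M \<nu>)) \<le> ennreal e"
  using assms unfolding flattens_def by blast

lemma (in radix_set) embedding_exists:
  fixes J :: "real \<times> (real ^ 'n::finite) \<Rightarrow> 'w::euclidean_space" and e :: real
  defines "E \<equiv> radix_cantor p b :: (real ^ 'n) set"
  assumes J: "\<And>x y. dist (J x) (J y) = dist x y" and e: "0 < e"
  shows "\<exists>f :: real \<times> (real ^ 'n) \<Rightarrow> 'w. qs_embedding ({0..1} \<times> E) dist UNIV dist f \<and>
    (\<forall>X \<subseteq> {0..1} \<times> E. qs_homeomorphism X dist (f ` X) dist f) \<and>
    flattens f E e"
proof -
  let ?N = "CARD('n)"
  have b0: "1 < real b" using p2 pb by simp
  obtain K where K: "10000000 * ?N * p ^ K \<le> b ^ K" "1000 \<le> b ^ K"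
    "real (p ^ K) ^ ?N * real (b ^ K) * (1 / 2) powr (real (b ^ K div 100) / 2 * e) < 1"
  proof -
    have "1 \<le> p" using p2 by simp
    from eventually_happens'[OF sequentially_bot eventually_block_length[OF this pb e, of ?N]] show thesis
      using that by blast
  qed
  define B where "B = b ^ K"
  define P where "P = p ^ K"
  \<comment> \<open>\<open>a\<close> has to be much larger than \<open>P\<close>, so that
    \<open>\<sigma>\<close>, of order \<open>1 / a\<close>, is small against the spacing of the
    offsets, and yet leave most cells tiny; a small fixed fraction of \<open>B\<close> does both.
    \<open>D\<close> is a fraction of \<open>B\<close> to make tiny cells exponentially small in
    \<open>B\<close>.\<close>
  define a where "a = B div 32"
  define D where "D = B div 100"
  have BP: "10000000 * ?N * P \<le> B" "1000 \<le> B" using K by (auto simp: B_def P_def)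
  have P0: "1 \<le> P" using p2 by (simp add: P_def)
  have K0: "0 < K" using K(2) by (cases "K = 0") auto
  have few: "8 * (a + 2 * D + 4) \<le> B" "3 < a" "a \<le> B - 4" "0 < D"
  proof -
    have "32 * a \<le> B" "100 * D \<le> B" by (simp_all add: a_def D_def)
    then have "real (32 * a) \<le> real B" "real (100 * D) \<le> real B" "real 1000 \<le> real B"
      using BP(2) by (simp_all only: of_nat_le_iff)
    then have "real a \<le> real B / 32" "real D \<le> real B / 100" "4 \<le> real B / 250" by simp_all
    then have "real (8 * (a + 2 * D + 4)) \<le> real B" "real (a + 4) \<le> real B" by simp_all
    then have "8 * (a + 2 * D + 4) \<le> B" "a + 4 \<le> B" by (simp_all only: of_nat_le_iff)
    then show "8 * (a + 2 * D + 4) \<le> B" "a \<le> B - 4" by (blast, simp)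
    show "3 < a" using div_le_mono[OF BP(2), of 32] by (simp add: a_def)
    show "0 < D" using div_le_mono[OF BP(2), of 100] by (simp add: D_def)
  qed
  \<comment> \<open>Coordinates \<open>q * c\<close> with \<open>c < P\<close> stay below
    \<open>1 / (100 * N)\<close>, N being the dimension, so every offset has norm at most
    \<open>1 / 100\<close>.\<close>
  define q where "q = 1 / (100 * real ?N * real P)"
  have q0: "0 < q" using P0 by (simp add: q_def)
  define I where "I = (\<lambda>c. (\<chi> k. q * real (c k)) :: real ^ 'n) ` (UNIV \<rightarrow>\<^sub>E {..<P})"
  \<comment> \<open>Any bijection serves: distinct blocks only have to receive distinct grid values,
    whatever their order.\<close>
  obtain g where g: "bij_betw g ({..<K} \<rightarrow>\<^sub>E {..<p}) {0..<card ({..<K} \<rightarrow>\<^sub>E {..<p})}"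
    using ex_bij_betw_finite_nat[of "{..<K} \<rightarrow>\<^sub>E {..<p}"] by (auto intro: finite_PiE)
  have cardg: "card ({..<K} \<rightarrow>\<^sub>E {..<p}) = P" by (simp add: card_PiE P_def)
  define block where "block x m k = restrict (\<lambda>l. radix_digits p b x k (m * K + l)) {..<K}" for x :: "real ^ 'n" and m k
  define code where "code x m = (\<chi> k. q * real (g (block x m k)))" for x :: "real ^ 'n" and m
  have rd: "radix_digits p b x k i < p" "radix_point b (radix_digits p b x) = x" if "x \<in> E" for x k i
    using radix_digits[of x p b] that by (auto simp: E_def)
  have block: "block x m k \<in> {..<K} \<rightarrow>\<^sub>E {..<p}" if "x \<in> E" for x m k
    using rd(1)[OF that] by (auto simp: block_def)
  have code_eq: "code x m = code y m \<longleftrightarrow> (\<forall>k. block x m k = block y m k)" if "x \<in> E" "y \<in> E" for x y m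
    using block[OF that(1)] block[OF that(2)] bij_betw_imp_inj_on[OF g] q0
    by (auto simp: code_def vec_eq_iff inj_on_def)
  have pw: "real B ^ n = real b ^ (n * K)" for n
    by (simp add: B_def power_mult[symmetric] mult.commute)
  interpret coded_cascade B a D "row_scale B a D" q I E code "gap / real B" "real ?N" J
  proof
    show "3 < a" "a \<le> B - 4" using few by auto
    have "real (10000000 * ?N * P) \<le> real B" using BP(1) by (simp only: of_nat_le_iff)
    then have B1: "10000000 * (real ?N * real P) \<le> real B" by simp
    have "1 \<le> real ?N * real P" using P0 mult_mono[of 1 "real ?N" 1 "real P"] by simp
    moreover have "real B < 32 * (real a + 1)"
    proof -
      have "B < 32 * (a + 1)" unfolding a_def by presburger
      then have "real B < real (32 * (a + 1))" by (simp only: of_nat_less_iff)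
      then show ?thesis by simp
    qed
    ultimately have a1: "150000 * (real ?N * real P) \<le> real a - 3" using B1 by argo
    have "row_scale B a D \<le> 3 / (2 * (real a - 3))" by (rule row_scale_le(2)[OF few(2,3)])
    also have "\<dots> \<le> 3 / (2 * (150000 * (real ?N * real P)))"
      using a1 P0 few(2) by (intro divide_left_mono) (auto intro!: mult_pos_pos)
    also have "\<dots> = q / 1000" by (simp add: q_def)
    finally show sc: "row_scale B a D \<le> q / 1000" .
    have "q \<le> 1 / 100" using \<open>1 \<le> real ?N * real P\<close> by (simp add: q_def field_simps)
    then show "row_scale B a D \<le> 1 / 2000" using sc by linarith
    show "norm v \<le> 1 / 100" if vI: "v \<in> I" for v
    proof -
      obtain c where cP: "c \<in> UNIV \<rightarrow>\<^sub>E {..<P}" and v: "v = (\<chi> k. q * real (c k))"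
        using vI unfolding I_def by blast
      have c: "c k < P" for k using PiE_mem[OF cP, of k] by simp
      have "norm v \<le> (\<Sum>k\<in>UNIV. \<bar>v $ k\<bar>)" by (rule norm_le_l1_cart)
      also have "\<dots> \<le> (\<Sum>k\<in>(UNIV::'n set). q * real P)"
        using q0 by (intro sum_mono) (simp add: v less_imp_le[OF c])
      also have "\<dots> = 1 / 100" using P0 by (simp add: q_def)
      finally show ?thesis .
    qed
    show "q \<le> norm (v - v')" if vI: "v \<in> I" "v' \<in> I" and ne: "v \<noteq> v'" for v v'
    proof -
      obtain c c' where c: "v = (\<chi> k. q * real (c k))" "v' = (\<chi> k. q * real (c' k))"
        using vI unfolding I_def by blast
      then obtain k where "c k \<noteq> c' k" using ne by (metis ext)
      then have "1 \<le> \<bar>real (c k) - real (c' k)\<bar>" by linarith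
      then have "q * 1 \<le> q * \<bar>real (c k) - real (c' k)\<bar>" using q0 by (intro mult_left_mono) auto
      also have "\<dots> = \<bar>(v - v') $ k\<bar>" using q0 by (simp add: c abs_mult right_diff_distrib[symmetric])
      also have "\<dots> \<le> norm (v - v')" by (rule component_le_norm_cart)
      finally show ?thesis by simp
    qed
    show "code x n \<in> I" if "x \<in> E" for x n
      unfolding code_def I_def
      using bij_betwE[OF g] block[OF that] by (intro image_eqI[of _ _ "\<lambda>k. g (block x n k)"]) (auto simp: cardg)
    show "dist x y \<le> real ?N / real B ^ n" if xy: "x \<in> E" "y \<in> E" and agree: "\<And>i. i < n \<Longrightarrow> code x i = code y i" for x y n
    proof -
      have "radix_digits p b x k i = radix_digits p b y k i" if i: "i < n * K" for k i
      proof -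
        have "i div K < n" using i K0 by (simp add: less_mult_imp_div_less)
        then have "block x (i div K) k = block y (i div K) k" using agree code_eq[OF xy] by blast
        then have "block x (i div K) k (i mod K) = block y (i div K) k (i mod K)" by simp
        then show ?thesis using K0 by (simp add: block_def)
      qed
      then have "dist (radix_point b (radix_digits p b x)) (radix_point b (radix_digits p b y)) \<le> real ?N / real b ^ (n * K)"
        using xy rd(1) by (intro radix_point_close) auto
      then show ?thesis using xy by (simp add: rd(2) pw)
    qed
    \<comment> \<open>A difference in block \<open>n\<close> occurs at digit
      \<open>n * K + K - 1\<close> at the latest, which costs one further factor
      \<open>B\<close>.\<close>
    show "gap / real B / real B ^ n \<le> dist x y" if xy: "x \<in> E" "y \<in> E" and ne: "code x n \<noteq> code y n" for x y n
    proof -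
      obtain k where "block x n k \<noteq> block y n k" using ne code_eq[OF xy] by blast
      then obtain l where l: "l < K" "radix_digits p b x k (n * K + l) \<noteq> radix_digits p b y k (n * K + l)"
        unfolding block_def by (metis (no_types, lifting) lessThan_iff restrict_ext)
      have "gap / real b ^ Suc (n * K + (K - 1)) \<le> dist (radix_point b (radix_digits p b x)) (radix_point b (radix_digits p b y))"
        using xy rd(1) l by (intro radix_point_far[of _ _ k "n * K + l"]) auto
      moreover have "real b ^ Suc (n * K + (K - 1)) = real B * real B ^ n"
        using K0 by (simp add: B_def power_mult[symmetric] power_add[symmetric] mult.commute add.commute)
      ultimately show ?thesis using xy by (simp add: rd(2))
    qed
    show "0 < gap / real B" using gap_pos BP(2) by simp
    show "0 < real ?N" by simp
  qed (simp_all add: J)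
  have fin: "finite I" unfolding I_def by (intro finite_imageI finite_PiE) auto
  have "card I \<le> card ((UNIV :: 'n set) \<rightarrow>\<^sub>E {..<P})"
    unfolding I_def by (intro card_image_le finite_PiE) auto
  then have "card I \<le> P ^ ?N" by (simp add: card_PiE)
  then have "real (card I) \<le> real (P ^ ?N)" by (simp only: of_nat_le_iff)
  then have "real (card I) * real B * (1 / 2) powr (real D / 2 * e) \<le> real P ^ ?N * real B * (1 / 2) powr (real D / 2 * e)"
    by (intro mult_right_mono) auto
  then have small: "real (card I) * real B * (1 / 2) powr (real D / 2 * e) < 1"
    using K(3) unfolding B_def P_def D_def by linarith
  have comp: "compact (({0..1} :: real set) \<times> E)"
    unfolding E_def by (intro compact_Times compact_radix_cantor) simp
  show ?thesis
  proof (intro exI[of _ embed] conjI allI impI)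
    show "qs_embedding ({0..1} \<times> E) dist UNIV dist embed" by (rule qs_embedding[OF comp])
    show "qs_homeomorphism X dist (embed ` X) dist embed" if "X \<subseteq> {0..1} \<times> E" for X
      by (rule qs_homeomorphism[OF comp that])
    show "flattens embed E e"
      unfolding flattens_def using push_forward_hdim_le[OF fin e few(4) few(1) small] by blast
  qed
qed

section \<open>Radon measures, supports of products, and density of the dimensions\<close>

lemma radon_measure_sigma_finite:
  fixes \<nu> :: "'a::euclidean_space measure"
  assumes "radon_measure \<nu>"
  shows "sets \<nu> = sets borel" "sigma_finite_measure \<nu>"
proof -
  show s: "sets \<nu> = sets borel" using assms by (simp add: radon_measure_def)
  have fin: "emeasure \<nu> (cball 0 (real n)) \<noteq> \<infinity>" for n
    using assms compact_cball[of "0 :: 'a" "real n"] unfolding radon_measure_def by (metis less_irrefl)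
  show "sigma_finite_measure \<nu>"
  proof
    have "(\<Union>n. cball (0 :: 'a) (real n)) = UNIV"
      using real_arch_simple by (auto simp: dist_norm)
    then show "\<exists>A. countable A \<and> A \<subseteq> sets \<nu> \<and> \<Union> A = space \<nu> \<and> (\<forall>a\<in>A. emeasure \<nu> a \<noteq> \<infinity>)"
      using fin sets_eq_imp_space_eq[OF s] s by (intro exI[of _ "range (\<lambda>n. cball 0 (real n))"]) auto
  qed
qed

lemma spt_product:
  fixes \<nu> :: "'a::euclidean_space measure"
  assumes s: "sets \<nu> = sets borel" and \<nu>: "sigma_finite_measure \<nu>"
  shows "spt (unit_lebesgue \<Otimes>\<^sub>M \<nu>) \<subseteq> {0..1} \<times> spt \<nu>"
proof
  interpret sigma_finite_measure \<nu> by fact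
  fix p assume p: "p \<in> spt (unit_lebesgue \<Otimes>\<^sub>M \<nu>)"
  obtain t x where tx: "p = (t, x)" by (cases p)
  have em: "emeasure (unit_lebesgue \<Otimes>\<^sub>M \<nu>) (U \<times> V) = emeasure unit_lebesgue U * emeasure \<nu> V"
    if "open U" "open V" for U V
    using that s by (intro emeasure_pair_measure_Times) (auto simp: unit_lebesgue_def)
  have pos: "0 < emeasure unit_lebesgue U * emeasure \<nu> V" if "open U" "open V" "t \<in> U" "x \<in> V" for U V
    using p that open_Times[of U V] em[of U V] unfolding spt_def tx by auto
  have "t \<in> {0..1}"
  proof (rule ccontr)
    assume "t \<notin> {0..1}"
    moreover have "emeasure unit_lebesgue (- {0..1}) = 0"
    proof -
      have "(\<lambda>x::real. indicator {0..1} x * indicator (- {0..1}) x) = (\<lambda>_. 0 :: ennreal)"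
        by (auto simp: indicator_def fun_eq_iff)
      then show ?thesis unfolding unit_lebesgue_def by (subst emeasure_density) auto
    qed
    ultimately show False using pos[of "- {0..1}" UNIV] by auto
  qed
  moreover have "x \<in> spt \<nu>"
    unfolding spt_def
  proof (intro CollectI allI impI)
    fix V assume "open V \<and> x \<in> V"
    then show "0 < emeasure \<nu> V" using pos[of UNIV V] by (auto simp: zero_less_iff_neq_zero)
  qed
  ultimately show "p \<in> {0..1} \<times> spt \<nu>" by (simp add: tx)
qed

text \<open>Given \<open>u\<close>, pair \<open>p\<close> with the ceiling of
  \<open>p powr c\<close> for \<open>c = N / u\<close>. Rounding changes the logarithm by at most
  \<open>ln 2\<close>, which is negligible against \<open>ln p\<close> as \<open>p\<close> grows, so
  the ratios tend to \<open>u\<close>.\<close>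

lemma log_ratio_dense:
  fixes N :: real
  assumes N: "0 < N"
  defines "S \<equiv> {N * ln (real p) / ln (real b) | p b. 2 \<le> p \<and> p < b}"
  shows "S \<subseteq> {0<..<N}" "{0<..<N} \<subseteq> closure S"
proof -
  show "S \<subseteq> {0<..<N}"
  proof
    fix s assume "s \<in> S"
    then obtain p b :: nat where pb: "2 \<le> p" "p < b" "s = N * ln (real p) / ln (real b)" by (auto simp: S_def)
    then have "0 < ln (real p)" "ln (real p) < ln (real b)" by auto
    then show "s \<in> {0<..<N}" using N pb(3) by (simp add: divide_less_eq)
  qed
  show "{0<..<N} \<subseteq> closure S"
  proof
    fix u assume u: "u \<in> {0<..<N}"
    define c where "c = N / u"
    have c: "1 < c" using u by (simp add: c_def)
    define q where "q p = nat \<lceil>real p powr c\<rceil>" for p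
    define f where "f p = N * ln (real p) / ln (real (q p))" for p
    have qb: "real p powr c \<le> real (q p)" "real (q p) \<le> 2 * real p powr c" "p < q p" if "2 \<le> p" for p
    proof -
      have "real p powr 1 < real p powr c" using c that by (intro powr_less_mono) auto
      then have *: "real p < real p powr c" using that by simp
      have q_eq: "real (q p) = of_int \<lceil>real p powr c\<rceil>" by (simp add: q_def)
      show **: "real p powr c \<le> real (q p)" unfolding q_eq by linarith
      have "real (q p) \<le> real p powr c + 1" unfolding q_eq by linarith
      then show "real (q p) \<le> 2 * real p powr c" using * that by linarith
      show "p < q p" using * ** by linarith
    qed
    have lnp: "filterlim (\<lambda>p. ln (real p)) at_top sequentially"
      by (rule filterlim_compose[OF ln_at_top filterlim_real_sequentially])
    have "f \<longlonglongrightarrow> u"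
    proof (rule tendsto_sandwich)
      have ev: "\<forall>\<^sub>F p in sequentially. 2 \<le> (p :: nat)" by (rule eventually_ge_at_top)
      have lnq: "c * ln (real p) \<le> ln (real (q p))" "ln (real (q p)) \<le> ln 2 + c * ln (real p)" "0 < ln (real p)"
          "0 < ln (real (q p))" "0 < ln 2 + c * ln (real p)"
        if "2 \<le> p" for p
      proof -
        have "ln (real p powr c) \<le> ln (real (q p))" using qb(1)[OF that] that by (intro ln_mono) auto
        then show "c * ln (real p) \<le> ln (real (q p))" using that by (simp add: ln_powr)
        have "ln (real (q p)) \<le> ln (2 * real p powr c)" using qb[OF that] that by (intro ln_mono) auto
        also have "\<dots> = ln 2 + c * ln (real p)" using that by (simp add: ln_mult ln_powr)
        finally show "ln (real (q p)) \<le> ln 2 + c * ln (real p)" .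
        show "0 < ln (real p)" using that by simp
        then show "0 < ln (real (q p))" "0 < ln 2 + c * ln (real p)"
          using \<open>c * ln (real p) \<le> ln (real (q p))\<close> \<open>ln (real (q p)) \<le> ln 2 + c * ln (real p)\<close>
            mult_pos_pos[of c "ln (real p)"] c by linarith+
      qed
      show "\<forall>\<^sub>F p in sequentially. N / (ln 2 / ln (real p) + c) \<le> f p"
        using ev
      proof eventually_elim
        case (elim p)
        have "N / (ln 2 / ln (real p) + c) = N * ln (real p) / (ln 2 + c * ln (real p))"
          using lnq(3)[OF elim] by (simp add: field_simps)
        also have "\<dots> \<le> f p"
          unfolding f_def using lnq[OF elim] c N by (intro divide_left_mono mult_pos_pos) auto
        finally show ?case .
      qed
      show "\<forall>\<^sub>F p in sequentially. f p \<le> u"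
        using ev
      proof eventually_elim
        case (elim p)
        have "f p \<le> N * ln (real p) / (c * ln (real p))"
          unfolding f_def using lnq[OF elim] c N by (intro divide_left_mono mult_pos_pos) auto
        also have "\<dots> = u" using lnq(3)[OF elim] N u by (simp add: c_def)
        finally show ?case .
      qed
      have "(\<lambda>p. N / (ln 2 / ln (real p) + c)) \<longlonglongrightarrow> N / (0 + c)"
        using c by (intro tendsto_intros tendsto_divide_0[OF tendsto_const] filterlim_at_top_imp_at_infinity lnp) auto
      then show "(\<lambda>p. N / (ln 2 / ln (real p) + c)) \<longlonglongrightarrow> u" using N u by (simp add: c_def)
    qed simp
    moreover have "f (p + 2) \<in> S" for p
      unfolding S_def f_def using qb(3)[of "p + 2"] by (intro CollectI exI[of _ "p + 2"] exI[of _ "q (p + 2)"]) auto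
    ultimately show "u \<in> closure S"
      unfolding closure_sequential
      by (intro exI[of _ "\<lambda>p. f (p + 2)"]) (simp add: LIMSEQ_ignore_initial_segment del: add_2_eq_Suc')
  qed
qed

theorem theorem1p7:
  fixes d :: nat
  assumes "d \<ge> 2" and "CARD('n::finite) = d - 1" and "CARD('m::finite) = d"
  shows "\<exists>S \<subseteq> {0<..<real d - 1}. {0<..<real d - 1} \<subseteq> closure S \<and>
    (\<forall>s\<in>S. \<exists>E :: (real^'n) set.
       compact E \<and>
       0 < hausdorff_measure UNIV dist s E \<and> hausdorff_measure UNIV dist s E < \<infinity> \<and>
       (\<forall>\<nu>. radon_measure \<nu> \<and> spt \<nu> \<subseteq> E \<longrightarrow> conformal_dim (unit_lebesgue \<Otimes>\<^sub>M \<nu>) = 0) \<and>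
       (\<forall>\<epsilon>>0. \<exists>F :: real \<times> (real^'n) \<Rightarrow> real^'m.
          qs_embedding ({0..1} \<times> E) dist UNIV dist F \<and>
          (\<forall>\<nu>. radon_measure \<nu> \<and> spt \<nu> \<subseteq> E \<longrightarrow>
             measure_hdim UNIV dist
               (push_forward ({0..1} \<times> E) UNIV dist F (unit_lebesgue \<Otimes>\<^sub>M \<nu>)) < ennreal \<epsilon>)))"
proof -
  define N where "N = real d - 1"
  have N: "0 < N" "real CARD('n) = N" using assms by (auto simp: N_def of_nat_diff)
  define S where "S = {N * ln (real p) / ln (real b) | p b. 2 \<le> p \<and> p < b}"
  \<comment> \<open>The construction lives in a product type, the target is a vector type of the
    same dimension; a linear isometry joins them.\<close>
  have "DIM(real \<times> (real ^ 'n)) = DIM(real ^ 'm)" using assms by simp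
  then obtain J :: "real \<times> (real ^ 'n) \<Rightarrow> real ^ 'm" where J: "linear J" "\<And>x. norm (J x) = norm x"
    using isomorphisms_UNIV_UNIV by metis
  have J: "dist (J x) (J y) = dist x y" for x y
    using J by (simp add: dist_norm linear_diff[symmetric])
  show ?thesis
    unfolding N_def[symmetric]
  proof (intro exI[of _ S] conjI ballI)
    show "S \<subseteq> {0<..<N}" "{0<..<N} \<subseteq> closure S" unfolding S_def by (rule log_ratio_dense[OF N(1)])+
    fix s assume sS: "s \<in> S"
    then obtain p b where pb: "2 \<le> p" "p < b" and s: "s = N * ln (real p) / ln (real b)" by (auto simp: S_def)
    interpret radix_set p b by unfold_locales (use pb in auto)
    have s0: "0 < s" using sS \<open>S \<subseteq> {0<..<N}\<close> by auto
    have bs: "real b powr s = real p ^ CARD('n)"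
    proof -
      have "1 < real b" using p2 pb by linarith
      then have "0 < ln (real b)" by (rule ln_gt_zero)
      then have "s * ln (real b) = N * ln (real p)" by (simp add: s)
      then have "real b powr s = exp (N * ln (real p))" using p2 pb by (simp add: powr_def)
      also have "\<dots> = real p powr real CARD('n)" using p2 by (simp add: powr_def N(2))
      finally show ?thesis using p2 by (simp add: powr_realpow)
    qed
    define E where "E = (radix_cantor p b :: (real ^ 'n) set)"
    have comp: "compact E" unfolding E_def by (rule compact_radix_cantor)
    have XB: "({0..1} :: real set) \<times> E \<in> sets borel"
      using comp by (intro borel_closed closed_Times compact_imp_closed) auto
    have emb: "\<exists>f :: real \<times> (real ^ 'n) \<Rightarrow> real ^ 'm. qs_embedding ({0..1} \<times> E) dist UNIV dist f \<and>
      (\<forall>X \<subseteq> {0..1} \<times> E. qs_homeomorphism X dist (f ` X) dist f) \<and>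
      flattens f E e" if "0 < e" for e
      unfolding E_def by (rule embedding_exists[OF J that])
    show "\<exists>E :: (real^'n) set.
       compact E \<and>
       0 < hausdorff_measure UNIV dist s E \<and> hausdorff_measure UNIV dist s E < \<infinity> \<and>
       (\<forall>\<nu>. radon_measure \<nu> \<and> spt \<nu> \<subseteq> E \<longrightarrow> conformal_dim (unit_lebesgue \<Otimes>\<^sub>M \<nu>) = 0) \<and>
       (\<forall>\<epsilon>>0. \<exists>F :: real \<times> (real^'n) \<Rightarrow> real^'m.
          qs_embedding ({0..1} \<times> E) dist UNIV dist F \<and>
          (\<forall>\<nu>. radon_measure \<nu> \<and> spt \<nu> \<subseteq> E \<longrightarrow>
             measure_hdim UNIV dist
               (push_forward ({0..1} \<times> E) UNIV dist F (unit_lebesgue \<Otimes>\<^sub>M \<nu>)) < ennreal \<epsilon>))"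
      (is "\<exists>E. _ E \<and> _ E \<and> _ E \<and> _ E \<and> (\<forall>\<epsilon>>0. ?Q E \<epsilon>)")
    proof (intro exI[of _ E] conjI comp allI impI)
      show "0 < hausdorff_measure UNIV dist s E" "hausdorff_measure UNIV dist s E < \<infinity>"
        unfolding E_def using hausdorff_measure_positive[OF s0 bs] hausdorff_measure_finite[OF s0 bs] by auto
      show "conformal_dim (unit_lebesgue \<Otimes>\<^sub>M \<nu>) = 0" if \<nu>: "radon_measure \<nu> \<and> spt \<nu> \<subseteq> E" for \<nu> :: "(real ^ 'n) measure"
      proof -
        let ?\<mu> = "unit_lebesgue \<Otimes>\<^sub>M \<nu>"
        have rm: "sets \<nu> = sets borel" "sigma_finite_measure \<nu>" using radon_measure_sigma_finite \<nu> by auto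
        have X: "spt ?\<mu> \<subseteq> {0..1} \<times> E" using spt_product[OF rm] \<nu> by blast
        have "sets ?\<mu> = sets (borel \<Otimes>\<^sub>M borel)"
          by (intro sets_pair_measure_cong rm) (simp add: unit_lebesgue_def)
        then have \<mu>: "sets ?\<mu> = sets borel" by (simp only: borel_prod)
        have "conformal_dim ?\<mu> \<le> ennreal e" if e: "0 < e" for e
        proof -
          obtain f :: "real \<times> (real ^ 'n) \<Rightarrow> real ^ 'm" where f: "\<And>X. X \<subseteq> {0..1} \<times> E \<Longrightarrow> qs_homeomorphism X dist (f ` X) dist f"
            "flattens f E e"
            using emb[OF e] by blast
          have "conformal_dim ?\<mu> \<le> measure_hdim (f ` spt ?\<mu>) dist (push_forward (spt ?\<mu>) (f ` spt ?\<mu>) dist f ?\<mu>)"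
            by (rule conformal_dim_le[OF \<mu> _ f(1)[OF X]]) (rule Met_TC.subspace, simp)
          also have "\<dots> \<le> ennreal e"
            by (rule flattensD[OF f(2) rm X]) (auto intro: borel_closed closed_spt)
          finally show ?thesis .
        qed
        then have "conformal_dim ?\<mu> \<le> 0" by - (rule ennreal_le_epsilon, simp)
        then show ?thesis by simp
      qed
      show "?Q E \<epsilon>"
        if \<epsilon>: "0 < \<epsilon>" for \<epsilon> :: real
      proof -
        \<comment> \<open>\<open>flattens\<close> gives a weak inequality, so
          \<open>\<epsilon> / 2\<close> is used to reach a strict one.\<close>
        obtain f :: "real \<times> (real ^ 'n) \<Rightarrow> real ^ 'm" where f: "qs_embedding ({0..1} \<times> E) dist UNIV dist f"
            "flattens f E (\<epsilon> / 2)"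
          using emb[OF half_gt_zero[OF \<epsilon>]] by blast
        have "ennreal (\<epsilon> / 2) < ennreal \<epsilon>" using \<epsilon> by (simp add: ennreal_less_iff)
        then show ?thesis
          using f(1) flattensD[OF f(2) radon_measure_sigma_finite order_refl XB subset_UNIV]
          by (intro exI[of _ f]) (auto intro: le_less_trans)
      qed
    qed
  qed
qed

end
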